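(* Let $n\geq 1$ and let $\underline{G}\in\mathbb{C}^{2^{2n}}$ be the standard signature of a generator matchgate of arity $2n$, regarded as a signature of arity $n$ on the domain $\{0,1\}^{2}$ (domain size $4$). Suppose $\underline{G}$ is of full rank and that for some $1\leq t\leq n$ the matrix $\underline{G}(t)$ has rank $4$. Then there exists a standard signature $\underline{R}\in\mathbb{C}^{2^{2n}}$ of a recognizer matchgate of arity $2n$ such that $\underline{G}(t)\underline{R}(t)=I_{4}$.
   Context: A matchgate is a planar graph $H$ with complex edge weights together with designated external (input or output) nodes on the outer face, labelled in counterclockwise order; a generator matchgate has only output nodes, a recognizer matchgate only input nodes. Its standard signature is the vector in $\mathbb{C}^{2^{m}}$ ($m$ the number of external nodes) whose entry indexed by $i_{1}\cdots i_{m}\in\{0,1\}^{m}$ (lexicographic order) is the sum over perfect matchings of $H-Z$ of the product of edge weights, $Z$ being the set of external nodes $j$ with $i_{j}=1$. A vector in $\mathbb{C}^{2^{2n}}$ has indices $\alpha_{1}\cdots\alpha_{n}$ with blocks $\alpha_{i}\in\{0,1\}^{2}$. For such $\underline{G}$, $\underline{G}(t)$ is the $4\times 4^{n-1}$ matrix with rows indexed by $\alpha_{t}$ and columns by $\alpha_{1}\cdots\alpha_{t-1}\alpha_{t+1}\cdots\alpha_{n}$ (lexicographically); for $\underline{R}$, $\underline{R}(t)$ is the $4^{n-1}\times 4$ matrix with rows indexed by $\alpha_{1}\cdots\alpha_{t-1}\alpha_{t+1}\cdots\alpha_{n}$ and columns by $\alpha_{t}$. A signature of arity $n$ on domain size $k$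 is degenerate if it is a tensor product $\gamma_{1}\otimes\cdots\otimes\gamma_{n}$ of vectors in $\mathbb{C}^{k}$, and of full rank if it is not degenerate and some matrix form ($\underline{G}(s)$ for some $s$) has rank $k$. *)

theory Defs
  imports "HOL-Analysis.Path_Connected" "Jordan_Normal_Form.DL_Rank"
begin

section \<open>Plane drawings\<close>

text \<open>Graphs are finite, simple and undirected; an edge is a two-element set of vertices.\<close>

definition finite_graph :: "'v set \<Rightarrow> 'v set set \<Rightarrow> bool" where
  "finite_graph V E \<longleftrightarrow> finite V \<and> (\<forall>e\<in>E. e \<subseteq> V \<and> card e = 2)"

text \<open>A drawing places the vertex \<open>v\<close> at the point \<open>p v\<close> and draws the edge \<open>e\<close> as
  the simple arc \<open>c e\<close>, with no crossings and no edge running through a vertex.\<close>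

definition plane_drawing ::
  "'v set \<Rightarrow> 'v set set \<Rightarrow> ('v \<Rightarrow> complex) \<Rightarrow> ('v set \<Rightarrow> real \<Rightarrow> complex) \<Rightarrow> bool" where
  "plane_drawing V E p c \<longleftrightarrow>
     inj_on p V \<and>
     (\<forall>e\<in>E. arc (c e) \<and> {pathstart (c e), pathfinish (c e)} = p ` e) \<and>
     (\<forall>e\<in>E. path_image (c e) \<inter> p ` V = p ` e) \<and>
     (\<forall>e\<in>E. \<forall>e'\<in>E. e \<noteq> e' \<longrightarrow> path_image (c e) \<inter> path_image (c e') \<subseteq> p ` V)"

definition drawn_points ::
  "'v set \<Rightarrow> 'v set set \<Rightarrow> ('v \<Rightarrow> complex) \<Rightarrow> ('v set \<Rightarrow> real \<Rightarrow> complex) \<Rightarrow> complex set" where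
  "drawn_points V E p c = p ` V \<union> (\<Union>e\<in>E. path_image (c e))"

text \<open>The outer face is the unbounded component of the complement of the drawing, that is
  \<^term>\<open>outside (drawn_points V E p c)\<close>. The nodes \<open>xs\<close> lie on its boundary in
  counterclockwise order if they can be joined, by pairwise disjoint arcs running through the
  outer face (the dangling external edges by which matchgates are usually drawn), to points of
  a circle around the whole drawing that follow each other counterclockwise within one turn.
  The first angle is arbitrary, so any node may carry the label 1. Only the order along the
  outer boundary matters: at a cut vertex, which a boundary walk meets several times, the arc
  may leave at any of these visits.\<close>

definition outer_face_ccw ::
  "'v set \<Rightarrow> 'v set set \<Rightarrow> ('v \<Rightarrow> complex) \<Rightarrow> ('v set \<Rightarrow> real \<Rightarrow> complex) \<Rightarrow> 'v list \<Rightarrow> bool" where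
  "outer_face_ccw V E p c xs \<longleftrightarrow>
     (let D = drawn_points V E p c; m = length xs in
       (\<forall>x\<in>set xs. p x \<in> frontier (outside D)) \<and>
       (\<exists>(l :: nat \<Rightarrow> real \<Rightarrow> complex) (\<theta> :: nat \<Rightarrow> real) (r :: real).
          0 < r \<and> D \<subseteq> ball 0 r \<and>
          (\<forall>i<m. arc (l i) \<and> pathstart (l i) = p (xs ! i) \<and>
                 pathfinish (l i) = rcis r (\<theta> i) \<and>
                 path_image (l i) - {p (xs ! i)} \<subseteq> outside D \<and>
                 path_image (l i) - {rcis r (\<theta> i)} \<subseteq> ball 0 r) \<and>
          (\<forall>i<m. \<forall>j<m. i \<noteq> j \<longrightarrow> path_image (l i) \<inter> path_image (l j) = {}) \<and>
          (\<forall>i<m. \<forall>j<m. i < j \<longrightarrow> \<theta> i < \<theta> j \<and> \<theta> j < \<theta> i + 2 * pi)))"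

section \<open>Matchgates\<close>

text \<open>\<open>exts\<close> lists the external nodes in the order of their labels; each of them is either
  an input or an output node.\<close>

record 'v matchgate =
  verts :: "'v set"
  edges :: "'v set set"
  weight :: "'v set \<Rightarrow> complex"
  exts :: "'v list"
  inputs :: "'v set"
  outputs :: "'v set"

definition is_matchgate :: "'v matchgate \<Rightarrow> bool" where
  "is_matchgate H \<longleftrightarrow>
     finite_graph (verts H) (edges H) \<and>
     distinct (exts H) \<and> set (exts H) \<subseteq> verts H \<and>
     inputs H \<union> outputs H = set (exts H) \<and> inputs H \<inter> outputs H = {} \<and>
     (\<exists>p c. plane_drawing (verts H) (edges H) p c \<and>
            outer_face_ccw (verts H) (edges H) p c (exts H))"

definition arity :: "'v matchgate \<Rightarrow> nat" where
  "arity H = length (exts H)"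

definition generator :: "'v matchgate \<Rightarrow> bool" where
  "generator H \<longleftrightarrow> is_matchgate H \<and> inputs H = {}"

definition recognizer :: "'v matchgate \<Rightarrow> bool" where
  "recognizer H \<longleftrightarrow> is_matchgate H \<and> outputs H = {}"

definition perfect_matching :: "'v set \<Rightarrow> 'v set set \<Rightarrow> 'v set set \<Rightarrow> bool" where
  "perfect_matching V E M \<longleftrightarrow> M \<subseteq> E \<and> (\<forall>v\<in>V. \<exists>!e. e \<in> M \<and> v \<in> e)"

definition perfmatch_sum ::
  "'v set \<Rightarrow> 'v set set \<Rightarrow> ('v set \<Rightarrow> complex) \<Rightarrow> complex" where
  "perfmatch_sum V E w = (\<Sum>M\<in>{M. perfect_matching V E M}. \<Prod>e\<in>M. w e)"

text \<open>Multi-indices: \<open>digits k n x\<close> is the \<open>x\<close>-th (counting from 0) element of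
  \<open>{0..<k}\<^sup>n\<close> in lexicographic order, and \<open>lex_index k\<close> is the inverse map. For \<open>k = 4\<close> a
  digit \<open>2 * a + b\<close> is the block \<open>(a, b)\<close> of two bits, so that position \<open>x < 4 ^ n\<close>
  denotes the same string of \<open>2 * n\<close> bits whether it is read in base 2 or in base 4.\<close>

definition digits :: "nat \<Rightarrow> nat \<Rightarrow> nat \<Rightarrow> nat list" where
  "digits k n x = map (\<lambda>i. x div k ^ (n - 1 - i) mod k) [0..<n]"

definition lex_index :: "nat \<Rightarrow> nat list \<Rightarrow> nat" where
  "lex_index k ds = foldl (\<lambda>x d. k * x + d) 0 ds"

text \<open>Lists count from 0: the external node with label \<open>j + 1\<close> is \<open>exts H ! j\<close>.\<close>

definition removed :: "'v matchgate \<Rightarrow> nat list \<Rightarrow> 'v set" where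
  "removed H bs = {exts H ! j | j. j < arity H \<and> bs ! j = 1}"

definition std_signature :: "'v matchgate \<Rightarrow> complex vec" where
  "std_signature H = vec (2 ^ arity H) (\<lambda>x.
     let Z = removed H (digits 2 (arity H) x)
     in perfmatch_sum (verts H - Z) {e \<in> edges H. e \<inter> Z = {}} (weight H))"

section \<open>Signatures of arity \<open>n\<close> on a domain of size \<open>k\<close>\<close>

text \<open>The position in a signature of arity \<open>n\<close> of the multi-index whose \<open>t\<close>-th entry
  (\<open>1 \<le> t \<le> n\<close>) is \<open>a\<close> and whose other entries form the \<open>b\<close>-th element of
  \<open>{0..<k}\<^bsup>n - 1\<^esup>\<close>.\<close>

definition insert_index :: "nat \<Rightarrow> nat \<Rightarrow> nat \<Rightarrow> nat \<Rightarrow> nat \<Rightarrow> nat" where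
  "insert_index k n t a b =
     (let ds = digits k (n - 1) b in lex_index k (take (t - 1) ds @ a # drop (t - 1) ds))"

definition gen_form :: "nat \<Rightarrow> nat \<Rightarrow> nat \<Rightarrow> complex vec \<Rightarrow> complex mat" where
  "gen_form k n t G = mat k (k ^ (n - 1)) (\<lambda>(a, b). G $ insert_index k n t a b)"

definition rec_form :: "nat \<Rightarrow> nat \<Rightarrow> nat \<Rightarrow> complex vec \<Rightarrow> complex mat" where
  "rec_form k n t R = mat (k ^ (n - 1)) k (\<lambda>(b, a). R $ insert_index k n t a b)"

definition tensor_product :: "nat \<Rightarrow> nat \<Rightarrow> (nat \<Rightarrow> complex vec) \<Rightarrow> complex vec" where
  "tensor_product k n \<gamma> = vec (k ^ n) (\<lambda>x. \<Prod>i<n. \<gamma> i $ (digits k n x ! i))"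

definition degenerate :: "nat \<Rightarrow> nat \<Rightarrow> complex vec \<Rightarrow> bool" where
  "degenerate k n G \<longleftrightarrow>
     (\<exists>\<gamma>. (\<forall>i<n. \<gamma> i \<in> carrier_vec k) \<and> G = tensor_product k n \<gamma>)"

text \<open>The first argument of \<^const>\<open>vec_space.rank\<close> is the number of rows.\<close>

definition full_rank :: "nat \<Rightarrow> nat \<Rightarrow> complex vec \<Rightarrow> bool" where
  "full_rank k n G \<longleftrightarrow>
     \<not> degenerate k n G \<and> (\<exists>s. 1 \<le> s \<and> s \<le> n \<and> vec_space.rank k (gen_form k n s G) = k)"

end

(* Write F(S) for the signature entry obtained by removing the external nodes in S. Planarity
   enters only through the matchgate identities
     sum over p in D, with alternating signs, of F(alpha + p) F(beta + p) = 0,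
   where D is the symmetric difference of alpha and beta, and + p toggles p. Superposing a
   matching of each factor gives paths that join the nodes of D in pairs; exchanging the two
   matchings along the path that starts at p moves the toggled node to its other end p'. Since
   paths cannot cross in a disc, an even number of nodes of D lies between p and p', so the
   exchange reverses the sign.

   Let c, c + 1 be the bits of the block t. As G(t) has rank 4, F(S) is nonzero for some S
   avoiding c and c + 1, and the identities express the rows c and c + 1 linearly through the
   vectors F(S + i + c) and F(S + i + (c + 1)) indexed by i. So these are independent, which
   gives i, j such that the columns S, S + i, S + j, S + i + j form an invertible 4 by 4 submatrix.
   Its inverse is supported on toggles of the four bits c, c + 1, i, j and satisfies the only
   matchgate identity on four nodes. A vector with these properties is realized by a recognizer
   with two inner nodes p, q, whose drawing is written down explicitly. *)

theory Submission
  imports Defs "HOL-Analysis.Fashoda_Theorem"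
begin

text \<open>By parity the 4 by 4 submatrix splits into two 2 by 2 blocks: rows \<open>{}\<close> and
  \<open>{c, c + 1}\<close> meet columns S and S + i + j, rows \<open>{c}\<close> and
  \<open>{c + 1}\<close> meet S + i and S + j. The identity on the four positions says that the two
  block determinants are opposite, so independence of the rows \<open>{c}\<close> and
  \<open>{c + 1}\<close> makes the other block invertible too. The entries of the inverse are signed
  entries of the same blocks at complementary places, divided by one common determinant. Hence the
  relation between the determinants returns as the identity that the inverse has to satisfy, and
  F(S), being nonzero, supplies the entry by which the weights of the gadget divide. Confining the
  inverse to toggles of four bits replaces a characterisation of all matchgate signatures by one
  explicit graph. The two inner nodes are there because both diagonals of a 4-cycle cannot be drawn
  inside it: through \<open>p\<close> and \<open>q\<close>, each diagonal pair is matched without a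
  crossing.\<close>

section \<open>Crossing paths in a disc\<close>

text \<open>The Moebius map that sends \<open>w\<close> to infinity and the disc around 0 whose
  boundary passes through \<open>w\<close> to the upper half plane.\<close>

definition cayley :: "complex \<Rightarrow> complex \<Rightarrow> complex" where
  "cayley w z = \<i> * (w + z) / (w - z)"

text \<open>With \<open>u\<close> half the angle difference, 1 + e^(2iu) and 1 - e^(2iu) are 2 cos u
  and -2i sin u times the same factor e^(iu).\<close>

lemma cayley_circle:
  assumes "0 < r" "0 < \<theta> - \<phi>" "\<theta> - \<phi> < 2 * pi"
  shows "cayley (rcis r \<phi>) (rcis r \<theta>) = - of_real (cot ((\<theta> - \<phi>) / 2))"
proof -
  define u where "u = (\<theta> - \<phi>) / 2"
  have u: "0 < u" "u < pi" using assms by (auto simp: u_def)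
  have s: "sin u \<noteq> 0" using sin_gt_zero[OF u] by simp
  have th: "\<theta> = \<phi> + 2 * u" by (simp add: u_def field_simps)
  have z: "rcis r \<theta> = rcis r \<phi> * cis (2 * u)"
    by (simp add: th rcis_def cis_mult)
  have w: "rcis r \<phi> \<noteq> 0" using assms by simp
  have c2: "cos (2 * u) = 1 - 2 * (sin u)\<^sup>2" "sin (2 * u) = 2 * sin u * cos u"
    by (auto simp: cos_double_sin sin_double)
  have p: "1 + cis (2 * u) = of_real (2 * cos u) * cis u"
    using c2(2) cos_double_cos[of u] by (auto simp: complex_eq_iff power2_eq_square)
  have m: "1 - cis (2 * u) = - \<i> * of_real (2 * sin u) * cis u"
    using c2 by (auto simp: complex_eq_iff power2_eq_square)
  have "cayley (rcis r \<phi>) (rcis r \<theta>) = \<i> * (1 + cis (2 * u)) / (1 - cis (2 * u))"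
  proof -
    have "rcis r \<phi> + rcis r \<theta> = rcis r \<phi> * (1 + cis (2*u))"
      "rcis r \<phi> - rcis r \<theta> = rcis r \<phi> * (1 - cis (2*u))"
      using z by (auto simp: algebra_simps)
    then show ?thesis using w by (simp add: cayley_def)
  qed
  also have "\<dots> = - of_real (cot u)"
    unfolding p m using s by (simp add: cot_def field_simps)
  finally show ?thesis by (simp add: u_def)
qed

text \<open>The numerator shows that the closed disc of radius \<open>norm w\<close>, without
  \<open>w\<close>, goes to the closed upper half plane.\<close>

lemma Im_cayley:
  assumes "z \<noteq> w"
  shows "Im (cayley w z) = ((norm w)\<^sup>2 - (norm z)\<^sup>2) / (norm (w - z))\<^sup>2"
proof -
  have n: "(norm (w - z))\<^sup>2 = (Re w - Re z)\<^sup>2 + (Im w - Im z)\<^sup>2"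
    by (simp add: cmod_power2)
  show ?thesis
    unfolding cayley_def n
    by (simp add: Im_divide cmod_power2) (simp add: cmod_def algebra_simps power2_eq_square)
qed

lemma neg_cot_strict_mono:
  assumes "0 < u" "u < v" "v < (pi::real)"
  shows "- cot u < - cot v"
proof -
  have s: "0 < sin u" "0 < sin v" "0 < sin (v - u)"
    using assms by (auto intro!: sin_gt_zero)
  have "cot u - cot v = sin (v - u) / (sin u * sin v)"
    using s by (simp add: cot_def sin_diff field_simps)
  then have "0 < cot u - cot v" using s by simp
  then show ?thesis by simp
qed

text \<open>The Cayley map with pole between the angles \<open>b'\<close> and \<open>a + 2 * pi\<close> takes the disc to the upper half
  plane and preserves the order of the end points, so the rectangular case applies.\<close>

lemma disc_paths_meet:
  fixes f g :: "real \<Rightarrow> complex"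
  assumes "0 < r" and pf: "path f" and pg: "path g"
    and f: "pathstart f = rcis r a" "pathfinish f = rcis r b"
    and g: "pathstart g = rcis r a'" "pathfinish g = rcis r b'"
    and fin: "path_image f \<subseteq> ball 0 r \<union> {rcis r a, rcis r b}"
    and gin: "path_image g \<subseteq> ball 0 r \<union> {rcis r a', rcis r b'}"
    and ord: "a < a'" "a' < b" "b < b'" "b' < a + 2 * pi"
  shows "path_image f \<inter> path_image g \<noteq> {}"
proof -
  \<comment> \<open>Halfway along the free arc from \<open>b' - 2 * pi\<close> to \<open>a\<close>,
    so that all four angles lie strictly between \<phi> and \<phi> + 2 pi.\<close>
  define \<phi> where "\<phi> = (a + b' - 2 * pi) / 2"
  define w where "w = rcis r \<phi>"
  define T where "T = cayley w"
  define h :: "complex \<Rightarrow> real^2" where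
    "h z = Re (T z) *\<^sub>R axis 1 1 + Im (T z) *\<^sub>R axis 2 1" for z
  have rng: "0 < a - \<phi>" "b' - \<phi> < 2 * pi" using ord by (auto simp: \<phi>_def field_simps)
  have h12: "vec_nth (h z) 1 = Re (T z)" "vec_nth (h z) 2 = Im (T z)" for z
    by (auto simp: h_def axis_def)
  have on: "T (rcis r \<theta>) = - of_real (cot ((\<theta> - \<phi>) / 2))" "rcis r \<theta> \<noteq> w" if "a \<le> \<theta>" "\<theta> \<le> b'" for \<theta>
  proof -
    have b: "0 < \<theta> - \<phi>" "\<theta> - \<phi> < 2 * pi" using that rng by auto
    show "T (rcis r \<theta>) = - of_real (cot ((\<theta> - \<phi>) / 2))"
      using cayley_circle[OF \<open>0 < r\<close> b] by (simp add: T_def w_def)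
    have s: "sin ((\<theta> - \<phi>) / 2) > 0" using b by (intro sin_gt_zero) auto
    have "cis (\<theta> - \<phi>) \<noteq> 1"
    proof
      assume "cis (\<theta> - \<phi>) = 1"
      then have "cos (\<theta> - \<phi>) = 1" by (simp add: complex_eq_iff)
      moreover have "cos (\<theta> - \<phi>) = 1 - 2 * (sin ((\<theta> - \<phi>) / 2))\<^sup>2"
        using cos_double_sin[of "(\<theta> - \<phi>) / 2"] by (simp only: mult_2 field_sum_of_halves)
      ultimately show False using s by auto
    qed
    moreover have "rcis r \<theta> = rcis r \<phi> * cis (\<theta> - \<phi>)" by (simp add: rcis_def cis_mult)
    ultimately show "rcis r \<theta> \<noteq> w" using \<open>0 < r\<close> by (auto simp: w_def)
  qed
  have ne: "z \<noteq> w" "norm z \<le> r" if "z \<in> path_image f \<union> path_image g" for z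
  proof -
    have "z \<in> ball 0 r \<union> {rcis r a, rcis r b, rcis r a', rcis r b'}" using that fin gin by blast
    moreover have "rcis r a \<noteq> w" "rcis r b \<noteq> w" "rcis r a' \<noteq> w" "rcis r b' \<noteq> w"
      using on(2) ord by auto
    moreover have "w \<notin> ball 0 r" using \<open>0 < r\<close> by (simp add: w_def)
    ultimately show "z \<noteq> w" "norm z \<le> r" using \<open>0 < r\<close> by auto
  qed
  have cont: "continuous_on (path_image f \<union> path_image g) h"
    unfolding h_def T_def cayley_def using ne(1) by (intro continuous_intros) auto
  have "compact (path_image f \<union> path_image g)"
    using pf pg by (intro compact_Un compact_path_image)
  then have "bounded (h ` (path_image f \<union> path_image g))"
    using cont compact_continuous_image compact_imp_bounded by blast
  then obtain N where N: "norm (h z) \<le> N" if "z \<in> path_image f \<union> path_image g" for z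
    unfolding bounded_iff by blast
  \<comment> \<open>The lower side of the box is the real axis: \<open>fashoda_interlace\<close>
    wants the four end points on it, in alternating order.\<close>
  define A B :: "real^2" where "A = vector [-N, 0]" and "B = vector [N, N]"
  have box: "h z \<in> cbox A B" if z: "z \<in> path_image f \<union> path_image g" for z
  proof -
    have c: "\<bar>vec_nth (h z) i\<bar> \<le> N" for i using component_le_norm_cart[of "h z" i] N[OF z] by linarith
    have "(norm z)\<^sup>2 \<le> (norm w)\<^sup>2" using ne(2)[OF z] \<open>0 < r\<close> by (auto simp: w_def)
    then have "0 \<le> vec_nth (h z) 2" using Im_cayley[OF ne(1)[OF z]] by (simp add: h12 T_def)
    then show ?thesis using c[of 1] c[of 2] by (auto simp: mem_box_cart forall_2 A_def B_def)
  qed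
  have ends: "vec_nth (h (rcis r \<theta>)) 1 = - cot ((\<theta> - \<phi>) / 2)" "vec_nth (h (rcis r \<theta>)) 2 = vec_nth A 2"
    if "a \<le> \<theta>" "\<theta> \<le> b'" for \<theta>
    using on(1)[OF that] by (auto simp: h12 A_def)
  have less: "vec_nth (h (rcis r x)) 1 < vec_nth (h (rcis r y)) 1" if "a \<le> x" "x < y" "y \<le> b'" for x y
    using that rng neg_cot_strict_mono[of "(x - \<phi>)/2" "(y - \<phi>)/2"] by (simp add: ends)
  obtain z where "z \<in> path_image (h \<circ> f)" "z \<in> path_image (h \<circ> g)"
  proof (rule fashoda_interlace[of "h \<circ> f" "h \<circ> g" A B])
    show "path (h \<circ> f)" "path (h \<circ> g)"
      using pf pg cont by (auto intro!: path_continuous_image intro: continuous_on_subset)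
    show "path_image (h \<circ> f) \<subseteq> cbox A B" "path_image (h \<circ> g) \<subseteq> cbox A B"
      using box by (auto simp: path_image_compose)
  qed (use ord less in \<open>auto simp: pathstart_compose pathfinish_compose f g ends\<close>)
  then obtain x y where xy: "x \<in> path_image f" "y \<in> path_image g" "h x = h y"
    by (auto simp: path_image_compose)
  then have "T x = T y" by (metis h12 complex_eqI)
  moreover have "x \<noteq> w" "y \<noteq> w" using ne xy by auto
  moreover have "w \<noteq> 0" using \<open>0 < r\<close> by (simp add: w_def)
  ultimately have "x = y" by (simp add: T_def cayley_def field_simps)
  then show ?thesis using xy by blast
qed

section \<open>Walks in a plane drawing\<close>

definition adj_rel :: "'v set set \<Rightarrow> ('v \<times> 'v) set" where
  "adj_rel K = {(u, v). {u, v} \<in> K}"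

lemma sym_adj_rel: "sym (adj_rel K)"
  by (auto simp: adj_rel_def sym_def insert_commute)

lemma adj_rel_rtrancl_sym: "(u, v) \<in> (adj_rel K)\<^sup>* \<Longrightarrow> (v, u) \<in> (adj_rel K)\<^sup>*"
  by (meson symD sym_rtrancl sym_adj_rel)

text \<open>The arcs of the edges are concatenated. The path is confined to the drawing of the
  component of \<open>u\<close>, so that walks in different components can be kept apart.\<close>

lemma walk_imp_path_component:
  assumes pd: "plane_drawing V E p c" and "K \<subseteq> E" and "(u, v) \<in> (adj_rel K)\<^sup>*"
    and W: "W = {v. (u, v) \<in> (adj_rel K)\<^sup>*}"
  shows "path_component (drawn_points W {e \<in> K. e \<subseteq> W} p c) (p u) (p v)"
  using assms(3)
proof (induction rule: rtrancl_induct)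
  case base
  then show ?case by (auto simp: path_component_refl_eq drawn_points_def W)
next
  case (step v v')
  let ?S = "drawn_points W {e \<in> K. e \<subseteq> W} p c"
  have e: "{v, v'} \<in> K" using step by (simp add: adj_rel_def)
  have sub: "{v, v'} \<subseteq> W" using step W by auto
  have "arc (c {v, v'}) \<and> {pathstart (c {v, v'}), pathfinish (c {v, v'})} = p ` {v, v'}"
    using pd subsetD[OF \<open>K \<subseteq> E\<close> e] unfolding plane_drawing_def by (elim conjE) (drule bspec)
  then have a: "arc (c {v, v'})" "{pathstart (c {v, v'}), pathfinish (c {v, v'})} = {p v, p v'}"
    by auto
  have pi: "path_image (c {v, v'}) \<subseteq> ?S" using e sub by (auto simp: drawn_points_def)
  have pc: "path_component ?S (pathstart (c {v, v'})) (pathfinish (c {v, v'}))"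
    unfolding path_component_def
    by (rule exI[of _ "c {v, v'}"]) (use a(1) pi in \<open>simp add: arc_imp_path\<close>)
  then have "path_component ?S (p v) (p v')"
    using a(2) by (auto simp: doubleton_eq_iff intro: path_component_sym)
  then show ?case by (rule path_component_trans[OF step.IH])
qed

text \<open>Arcs of two edges meet only in drawn vertices, and an arc contains no drawn vertices but
  its own ends. An edge common to both subgraphs would have to be empty.\<close>

lemma drawn_points_disjoint:
  assumes pd: "plane_drawing V E p c" and KE: "K \<subseteq> E" "K' \<subseteq> E" and WV: "W \<subseteq> V" "W' \<subseteq> V" "W \<inter> W' = {}"
    and KW: "\<And>e. e \<in> K \<Longrightarrow> e \<subseteq> W" "\<And>e. e \<in> K' \<Longrightarrow> e \<subseteq> W'" "{} \<notin> E"
  shows "drawn_points W K p c \<inter> drawn_points W' K' p c = {}"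
proof -
  have inj: "inj_on p V" using pd by (simp add: plane_drawing_def)
  have vv: "p ` W \<inter> p ` W' = {}"
    using inj WV by (simp add: inj_on_image_Int[symmetric])
  have sets: "A \<inter> B' = {}" if "A \<inter> U = C" "C \<subseteq> B" "B' \<subseteq> U" "B \<inter> B' = {}" for A B B' C U :: "complex set"
    using that by blast
  have sets2: "A \<inter> B = {}" if "A \<inter> U = C" "B \<inter> U = C'" "A \<inter> B \<subseteq> U" "C \<subseteq> X" "C' \<subseteq> X'" "X \<inter> X' = {}"
    for A B C C' U X X' :: "complex set"
    using that by blast
  have ev: "path_image (c e) \<inter> p ` V = p ` e" if "e \<in> E" for e
    using pd that by (simp add: plane_drawing_def)
  have 1: "path_image (c e) \<inter> p ` W' = {}" if "e \<in> K" for e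
    by (rule sets[OF ev image_mono[OF KW(1)[OF that]] image_mono vv]) (use that KE WV in auto)
  have 2: "p ` W \<inter> path_image (c e) = {}" if "e \<in> K'" for e
    unfolding Int_commute[of "p ` W"] by (rule sets[OF ev image_mono[OF KW(2)[OF that]] image_mono]) (use that KE WV vv in \<open>auto simp: Int_commute\<close>)
  have 3: "path_image (c e) \<inter> path_image (c e') = {}" if "e \<in> K" "e' \<in> K'" for e e'
  proof -
    have "e \<noteq> e'"
    proof
      assume "e = e'"
      then have "e \<subseteq> W \<inter> W'" using KW(1)[OF that(1)] KW(2)[OF that(2)] by blast
      then show False using WV(3) KW(3) KE that by auto
    qed
    then have sub: "path_image (c e) \<inter> path_image (c e') \<subseteq> p ` V"
      using pd that KE unfolding plane_drawing_def by (meson subsetD)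
    show ?thesis
      by (rule sets2[OF ev ev sub image_mono[OF KW(1)[OF that(1)]] image_mono[OF KW(2)[OF that(2)]] vv])
        (use that KE in auto)
  qed
  have UN: "(A \<union> (\<Union>e\<in>K. f e)) \<inter> (A' \<union> (\<Union>e\<in>K'. f e)) = {}"
    if "A \<inter> A' = {}" "\<And>e. e \<in> K \<Longrightarrow> f e \<inter> A' = {}" "\<And>e. e \<in> K' \<Longrightarrow> A \<inter> f e = {}"
      "\<And>e e'. e \<in> K \<Longrightarrow> e' \<in> K' \<Longrightarrow> f e \<inter> f e' = {}"
    for A A' :: "complex set" and f
    using that by blast
  show ?thesis
    unfolding drawn_points_def by (rule UN[OF vv 1 2 3])
qed

text \<open>Each walk, prolonged by the dangling arcs at its two ends, becomes a path between points
  of the outer circle. The end points alternate, so the paths meet, which is impossible if the walks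
  lie in different components.\<close>

lemma crossing_walks_meet:
  assumes pd: "plane_drawing V E p c" and of: "outer_face_ccw V E p c xs"
    and fg: "finite_graph V E" and xsV: "set xs \<subseteq> V" and KE: "K \<subseteq> E"
    and ord: "a < a'" "a' < b" "b < b'" "b' < length xs"
    and ab: "(xs ! a, xs ! b) \<in> (adj_rel K)\<^sup>*" and ab': "(xs ! a', xs ! b') \<in> (adj_rel K)\<^sup>*"
  shows "(xs ! a, xs ! a') \<in> (adj_rel K)\<^sup>*"
proof (rule ccontr)
  assume no: "(xs ! a, xs ! a') \<notin> (adj_rel K)\<^sup>*"
  define D where "D = drawn_points V E p c"
  obtain l :: "nat \<Rightarrow> real \<Rightarrow> complex" and \<theta> :: "nat \<Rightarrow> real" and r :: real where
    r: "0 < r" "D \<subseteq> ball 0 r" and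
    l0: "\<forall>i<length xs. arc (l i) \<and> pathstart (l i) = p (xs ! i) \<and>
                 pathfinish (l i) = rcis r (\<theta> i) \<and>
                 path_image (l i) - {p (xs ! i)} \<subseteq> outside D \<and>
                 path_image (l i) - {rcis r (\<theta> i)} \<subseteq> ball 0 r" and
    dis0: "\<forall>i<length xs. \<forall>j<length xs. i \<noteq> j \<longrightarrow> path_image (l i) \<inter> path_image (l j) = {}" and
    th0: "\<forall>i<length xs. \<forall>j<length xs. i < j \<longrightarrow> \<theta> i < \<theta> j \<and> \<theta> j < \<theta> i + 2 * pi"
    using of unfolding outer_face_ccw_def Let_def D_def[symmetric] by (elim conjE exE) (rule that; assumption)
  note l = l0[rule_format] and dis = dis0[rule_format]
  have th: "\<theta> i < \<theta> j \<and> \<theta> j < \<theta> i + 2 * pi" if "i < j" "j < length xs" for i j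
    using th0 that by auto
  have edge: "e \<subseteq> V" "e \<noteq> {}" if "e \<in> E" for e
    using fg that by (auto simp: finite_graph_def)
  have reach: "v \<in> V" if "(u, v) \<in> (adj_rel K)\<^sup>*" "u \<in> V" for u v
    using that(1,2) by (induction rule: rtrancl_induct) (use edge KE in \<open>auto simp: adj_rel_def\<close>)
  have inV: "xs ! i \<in> V" if "i < length xs" for i using that xsV by auto
  define W where "W u = {v. (u, v) \<in> (adj_rel K)\<^sup>*}" for u
  define S where "S u = drawn_points (W u) {e \<in> K. e \<subseteq> W u} p c" for u
  have WV: "W u \<subseteq> V" if "u \<in> V" for u using reach that by (auto simp: W_def)
  have SD: "S u \<subseteq> D" if "u \<in> V" for u
    using WV[OF that] KE by (auto simp: S_def D_def drawn_points_def)
  have dW: "W (xs ! a) \<inter> W (xs ! a') = {}"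
    using no unfolding W_def by (auto dest: adj_rel_rtrancl_sym rtrancl_trans)
  have dS: "S (xs ! a) \<inter> S (xs ! a') = {}"
    unfolding S_def
    by (rule drawn_points_disjoint[OF pd]) (use KE WV inV ord dW edge(2)[of "{}"] in auto)
  have join: "\<exists>F. path F \<and> pathstart F = rcis r (\<theta> i) \<and> pathfinish F = rcis r (\<theta> j) \<and>
       path_image F \<subseteq> path_image (l i) \<union> S (xs ! i) \<union> path_image (l j)"
    if ij: "i < length xs" "j < length xs" "(xs ! i, xs ! j) \<in> (adj_rel K)\<^sup>*" for i j
  proof -
    have "path_component (S (xs ! i)) (p (xs ! i)) (p (xs ! j))"
      unfolding S_def by (rule walk_imp_path_component[OF pd KE ij(3)]) (simp add: W_def)
    then obtain g where g: "path g" "path_image g \<subseteq> S (xs ! i)" "pathstart g = p (xs ! i)" "pathfinish g = p (xs ! j)"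
      by (auto simp: path_component_def)
    show ?thesis
      by (rule exI[of _ "reversepath (l i) +++ g +++ l j"])
        (use g l[OF ij(1)] l[OF ij(2)] in \<open>auto simp: path_image_join arc_imp_path\<close>)
  qed
  obtain F where F: "path F" "pathstart F = rcis r (\<theta> a)" "pathfinish F = rcis r (\<theta> b)"
       "path_image F \<subseteq> path_image (l a) \<union> S (xs ! a) \<union> path_image (l b)"
    using join[of a b] ord ab by auto
  obtain F' where F': "path F'" "pathstart F' = rcis r (\<theta> a')" "pathfinish F' = rcis r (\<theta> b')"
       "path_image F' \<subseteq> path_image (l a') \<union> S (xs ! a') \<union> path_image (l b')"
    using join[of a' b'] ord ab' by auto
  have lb: "path_image (l i) \<subseteq> ball 0 r \<union> {rcis r (\<theta> i)}" if "i < length xs" for i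
    using l[OF that] by blast
  have Sb: "S (xs ! i) \<subseteq> ball 0 r" if "i < length xs" for i
    using SD[OF inV[OF that]] r by blast
  have meet: "path_image F \<inter> path_image F' \<noteq> {}"
  proof (rule disc_paths_meet[OF r(1) F(1) F'(1) F(2,3) F'(2,3)])
    show "path_image F \<subseteq> ball 0 r \<union> {rcis r (\<theta> a), rcis r (\<theta> b)}"
      using F(4) lb[of a] lb[of b] Sb[of a] ord by auto
    show "path_image F' \<subseteq> ball 0 r \<union> {rcis r (\<theta> a'), rcis r (\<theta> b')}"
      using F'(4) lb[of a'] lb[of b'] Sb[of a'] ord by auto
  qed (use th ord in auto)
  \<comment> \<open>A dangling arc touches the drawing only in its own node, which belongs to one of
    the two components, so it misses the other one.\<close>
  have lD: "path_image (l i) \<inter> D \<subseteq> {p (xs ! i)}" if "i < length xs" for i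
    using l[OF that] outside_no_overlap[of D] by blast
  have end_in: "p (xs ! a) \<in> S (xs ! a)" "p (xs ! b) \<in> S (xs ! a)"
     "p (xs ! a') \<in> S (xs ! a')" "p (xs ! b') \<in> S (xs ! a')"
    using ab ab' by (auto simp: S_def W_def drawn_points_def)
  have sets: "A \<inter> B = {}" if "A \<inter> C \<subseteq> {x}" "B \<subseteq> C" "x \<in> B'" "B' \<inter> B = {}" for A B B' C :: "complex set" and x
    using that by blast
  have l0: "path_image (l i) \<inter> S (xs ! a') = {}" if "i \<in> {a, b}" for i
    by (rule sets[OF lD SD[OF inV] _ dS]) (use that ord end_in in auto)
  have l1: "S (xs ! a) \<inter> path_image (l i) = {}" if "i \<in> {a', b'}" for i
    unfolding Int_commute[of "S (xs ! a)"] by (rule sets[OF lD SD[OF inV]]) (use that ord end_in dS in \<open>auto simp: Int_commute\<close>)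
  have ll: "path_image (l i) \<inter> path_image (l j) = {}" if "i \<in> {a, b}" "j \<in> {a', b'}" for i j
    using that ord by (intro dis) auto
  have un: "(A \<union> B \<union> C) \<inter> (A' \<union> B' \<union> C') = {}"
    if "A \<inter> A' = {}" "A \<inter> B' = {}" "A \<inter> C' = {}" "B \<inter> A' = {}" "B \<inter> B' = {}" "B \<inter> C' = {}"
      "C \<inter> A' = {}" "C \<inter> B' = {}" "C \<inter> C' = {}" for A B C A' B' C' :: "complex set"
    using that by blast
  have "(path_image (l a) \<union> S (xs ! a) \<union> path_image (l b)) \<inter>
      (path_image (l a') \<union> S (xs ! a') \<union> path_image (l b')) = {}"
    by (intro un ll l0 l1 dS) auto
  with Int_mono[OF F(4) F'(4)] have "path_image F \<inter> path_image F' = {}"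
    by (metis subset_empty)
  then show False using meet by simp
qed

section \<open>The matchgate identities\<close>

lemma even_card_involution:
  assumes "finite A" "\<And>x. x \<in> A \<Longrightarrow> \<pi> x \<in> A \<and> \<pi> (\<pi> x) = x \<and> \<pi> x \<noteq> x"
  shows "even (card A)"
  using assms
proof (induction "card A" arbitrary: A rule: less_induct)
  case less
  show ?case
  proof (cases "A = {}")
    case False
    then obtain x where x: "x \<in> A" by blast
    let ?B = "A - {x, \<pi> x}"
    have sub: "{x, \<pi> x} \<subseteq> A" "card {x, \<pi> x} = 2" using less.prems(2)[OF x] x by (auto simp: card_2_iff)
    have cB: "card ?B = card A - 2" using sub less.prems(1) by (simp add: card_Diff_subset)
    have c2: "2 \<le> card A" using card_mono[OF less.prems(1) sub(1)] sub(2) by simp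
    have "even (card ?B)"
    proof (rule less.hyps)
      show "\<pi> y \<in> ?B \<and> \<pi> (\<pi> y) = y \<and> \<pi> y \<noteq> y" if "y \<in> ?B" for y
        using that less.prems(2)[of y] less.prems(2)[OF x] by auto
    qed (use cB c2 less.prems(1) in auto)
    then show ?thesis using cB c2 by simp
  qed simp
qed

text \<open>A partner outside the interval would make two pairs interlace, so \<open>\<pi>\<close>
  restricts to a fixed-point-free involution of the points strictly between \<open>p\<close> and
  \<open>\<pi> p\<close>.\<close>

lemma noncrossing_even_between:
  fixes \<pi> :: "nat \<Rightarrow> nat"
  assumes "finite D" and inv: "\<And>q. q \<in> D \<Longrightarrow> \<pi> q \<in> D \<and> \<pi> (\<pi> q) = q \<and> \<pi> q \<noteq> q"
    and nc: "\<And>a a'. a \<in> D \<Longrightarrow> a' \<in> D \<Longrightarrow> a < a' \<Longrightarrow> a' < \<pi> a \<Longrightarrow> \<pi> a < \<pi> a' \<Longrightarrow> False"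
    and p: "p \<in> D" "p < \<pi> p"
  shows "even (card {q \<in> D. p < q \<and> q < \<pi> p})"
proof (rule even_card_involution[where \<pi> = \<pi>])
  fix q assume "q \<in> {q \<in> D. p < q \<and> q < \<pi> p}"
  then have q: "q \<in> D" "p < q" "q < \<pi> p" by auto
  have "\<pi> q \<noteq> p" "\<pi> q \<noteq> \<pi> p" using inv[OF q(1)] inv[OF p(1)] q by force+
  moreover have "\<not> \<pi> p < \<pi> q" using nc[OF p(1) q(1)] q by blast
  moreover have "\<not> \<pi> q < p" using nc[of "\<pi> q" p] inv[OF q(1)] p q by auto
  ultimately show "\<pi> q \<in> {q \<in> D. p < q \<and> q < \<pi> p} \<and> \<pi> (\<pi> q) = q \<and> \<pi> q \<noteq> q"
    using inv[OF q(1)] by auto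
qed (use assms in simp)

text \<open>With \<open>h = g \<circ> f\<close> and \<open>x\<^sub>k = h\<^sup>k v\<close> the orbit of \<open>v\<close> is a cycle of some length \<open>L\<close>, on which \<open>f\<close> acts
  as \<open>k \<mapsto> L - k\<close> and \<open>g\<close> as \<open>k \<mapsto> L + 1 - k\<close>: the only other fixed point of either map sits at
  half the length.\<close>

lemma involution_orbit_two_endpoints:
  fixes f g :: "'v \<Rightarrow> 'v"
  assumes "finite V" and fV: "\<And>u. u \<in> V \<Longrightarrow> f u \<in> V" and gV: "\<And>u. u \<in> V \<Longrightarrow> g u \<in> V"
    and ff: "\<And>u. f (f u) = u" and gg: "\<And>u. g (g u) = u"
    and v: "v \<in> V" "f v = v" "g v \<noteq> v"
    and R: "R = {(x, y). y = f x \<or> y = g x}"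
  shows "\<exists>!w. w \<noteq> v \<and> (v, w) \<in> R\<^sup>* \<and> (f w = w \<longleftrightarrow> g w \<noteq> w)"
proof -
  define x where "x k = ((g \<circ> f) ^^ k) v" for k
  have x0: "x 0 = v" and xS: "x (Suc k) = g (f (x k))" for k by (auto simp: x_def)
  have xV: "x k \<in> V" for k by (induction k) (auto simp: x0 xS v fV gV)
  have gi: "a = b" if "g a = g b" for a b using arg_cong[OF that, of g] gg by simp
  have fi: "a = b" if "f a = f b" for a b using arg_cong[OF that, of f] ff by simp
  \<comment> \<open>Both maps are injective, so two equal points can be moved back together until
    the earlier one is \<open>v\<close>: the sequence is purely periodic.\<close>
  have shift: "x (j - i) = v" if "x i = x j" "i \<le> j" for i j
    using that
  proof (induction i arbitrary: j)
    case (Suc i)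
    then obtain j' where j: "j = Suc j'" by (cases j) auto
    with Suc.prems have "g (f (x i)) = g (f (x j'))" by (simp add: xS)
    then have "x i = x j'" by (rule fi[OF gi])
    with Suc j show ?case by auto
  qed (simp add: x0)
  have "finite (range x)" by (rule finite_subset[OF _ \<open>finite V\<close>]) (use xV in auto)
  then have "\<not> inj x" using range_inj_infinite by blast
  then obtain i j where ij: "x i = x j" "i < j" unfolding inj_def by (metis nat_neq_iff)
  then have ex: "0 < j - i \<and> x (j - i) = v" using shift by auto
  define L where "L = (LEAST k. 0 < k \<and> x k = v)"
  have L: "0 < L" "x L = v" using LeastI[of "\<lambda>k. 0 < k \<and> x k = v", OF ex] by (auto simp: L_def)
  have Lmin: "x k \<noteq> v" if "0 < k" "k < L" for k
    using not_less_Least[of k "\<lambda>k. 0 < k \<and> x k = v"] that by (auto simp: L_def)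
  have inj: "i = j" if "x i = x j" "i < L" "j < L" for i j
  proof (rule ccontr)
    assume "i \<noteq> j"
    then consider "i < j" | "j < i" by linarith
    then show False
    proof cases
      case 1
      then show False using shift[of i j] Lmin[of "j - i"] that by auto
    next
      case 2
      then show False using shift[of j i] Lmin[of "i - j"] that by auto
    qed
  qed
  \<comment> \<open>Conjugation by \<open>f\<close> turns \<open>g \<circ> f\<close> into its
    inverse, and \<open>f\<close> fixes \<open>v\<close>; hence \<open>f\<close> reverses the cycle
    about \<open>v\<close>.\<close>
  have fx: "f (x k) = x (L - k)" if "k \<le> L" for k
    using that
  proof (induction k)
    case (Suc k)
    have "x (L - k) = g (f (x (L - Suc k)))" using xS[of "L - Suc k"] Suc.prems by (simp add: Suc_diff_Suc)
    then have "g (f (x k)) = f (x (L - Suc k))" using Suc gg by auto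
    then show ?case by (simp add: xS ff)
  qed (simp add: x0 v L)
  have gx: "g (x (Suc k)) = x (L - k)" if "k \<le> L" for k
    using fx[OF that] by (simp add: xS gg)
  have x1: "x 1 = g v" using xS[of 0] by (simp add: x0 v)
  have L2: "2 \<le> L" using L v(3) x1 by (cases "L = 1") auto
  define C where "C = x ` {..<L}"
  have xC: "x k \<in> C" if "k \<le> L" for k
    using that L by (cases "k = L") (auto simp: C_def x0[symmetric])
  have C: "u \<in> C" if "(v, u) \<in> R\<^sup>*" for u
    using that
  proof (induction rule: rtrancl_induct)
    case base
    then show ?case using xC[of 0] by (simp add: x0)
  next
    case (step y z)
    then obtain k where k: "y = x k" "k < L" by (auto simp: C_def)
    show ?case
    proof (cases "z = f y")
      case True
      then show ?thesis using fx[of k] k xC by simp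
    next
      case False
      then have z: "z = g y" using step R by auto
      show ?thesis
      proof (cases k)
        case 0
        then show ?thesis using z k x1 xC[of 1] L2 by (simp add: x0)
      next
        case (Suc k')
        then show ?thesis using z k gx[of k'] xC by simp
      qed
    qed
  qed
  have reach: "(v, x k) \<in> R\<^sup>*" for k
  proof (induction k)
    case (Suc k)
    have "(x k, f (x k)) \<in> R" "(f (x k), x (Suc k)) \<in> R" by (auto simp: R xS)
    with Suc show ?case by (meson rtrancl.rtrancl_into_rtrancl)
  qed (simp add: x0)
  have ffix: "f (x k) = x k \<longleftrightarrow> 2 * k = L" if "0 < k" "k < L" for k
    using fx[of k] that inj[of "L - k" k] by auto
  have gfix: "g (x k) = x k \<longleftrightarrow> 2 * k = L + 1" if "0 < k" "k < L" for k
  proof (cases "k = 1")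
    case True
    then show ?thesis using gx[of 0] L L2 Lmin[of 1] that by auto
  next
    case False
    then have k: "k = Suc (k - 1)" "0 < k - 1" using that by auto
    have "g (x k) = x (L - (k - 1))" using gx[of "k - 1"] k(1) that by simp
    moreover have "L - (k - 1) < L" using k L by linarith
    ultimately have "g (x k) = x k \<longleftrightarrow> L - (k - 1) = k" using that inj by metis
    then show ?thesis using that k by linarith
  qed
  \<comment> \<open>The middle of the cycle, fixed by \<open>f\<close> if \<open>L\<close> is even
    and by \<open>g\<close> if \<open>L\<close> is odd.\<close>
  define m where "m = (L + 1) div 2"
  have m: "0 < m" "m < L" using L2 by (auto simp: m_def)
  show ?thesis
  proof (rule ex1I[of _ "x m"])
    show "x m \<noteq> v \<and> (v, x m) \<in> R\<^sup>* \<and> (f (x m) = x m \<longleftrightarrow> g (x m) \<noteq> x m)"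
      using Lmin[OF m] reach ffix[OF m] gfix[OF m] by (auto simp: m_def)
  next
    fix w assume w: "w \<noteq> v \<and> (v, w) \<in> R\<^sup>* \<and> (f w = w \<longleftrightarrow> g w \<noteq> w)"
    then obtain k where k: "w = x k" "k < L" using C by (force simp: C_def)
    then have "0 < k" using w x0 by (cases k) auto
    with k w ffix gfix have "2 * k = L \<or> 2 * k = L + 1" by blast
    then have "k = m" by (auto simp: m_def)
    then show "w = x m" using k by simp
  qed
qed

section \<open>Matchings as involutions and their superposition\<close>

definition matchings :: "'v set \<Rightarrow> 'v set set \<Rightarrow> 'v set \<Rightarrow> 'v set set set" where
  "matchings V E Z = {M. perfect_matching (V - Z) {e \<in> E. e \<inter> Z = {}} M}"

lemma matchingsI:
  assumes "M \<subseteq> E" "\<And>e. e \<in> M \<Longrightarrow> e \<inter> Z = {}" "\<And>v. v \<in> V \<Longrightarrow> v \<notin> Z \<Longrightarrow> \<exists>!e. e \<in> M \<and> v \<in> e"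
  shows "M \<in> matchings V E Z"
  using assms unfolding matchings_def perfect_matching_def by auto

lemma matchingsD:
  assumes "M \<in> matchings V E Z"
  shows "M \<subseteq> E" "\<And>e. e \<in> M \<Longrightarrow> e \<inter> Z = {}" "\<And>v. v \<in> V \<Longrightarrow> v \<notin> Z \<Longrightarrow> \<exists>!e. e \<in> M \<and> v \<in> e"
  using assms unfolding matchings_def perfect_matching_def by auto

text \<open>Letting unmatched vertices be their own mates makes a matching an involution defined
  everywhere, whose fixed points in \<open>V\<close> are the removed nodes.\<close>

definition mate :: "'v set set \<Rightarrow> 'v \<Rightarrow> 'v" where
  "mate M v = (if \<exists>w. {v, w} \<in> M then THE w. {v, w} \<in> M else v)"

lemma finite_graph_edge:
  assumes "finite_graph V E" "e \<in> E" "v \<in> e"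
  obtains w where "e = {v, w}" "w \<noteq> v" "v \<in> V" "w \<in> V"
proof -
  have "card e = 2" "e \<subseteq> V" using assms by (auto simp: finite_graph_def)
  then obtain a b where "e = {a, b}" "a \<noteq> b" by (auto simp: card_2_iff)
  then show ?thesis using that[of b] that[of a] assms(3) \<open>e \<subseteq> V\<close> by (auto simp: insert_commute)
qed

context
  fixes V :: "'v set" and E :: "'v set set"
  assumes fg: "finite_graph V E"
begin

lemma mate_eqI:
  assumes M: "M \<in> matchings V E Z" and "{v, w} \<in> M"
  shows "mate M v = w" "w \<noteq> v" "v \<in> V" "v \<notin> Z" "w \<in> V"
proof -
  have e: "{v, w} \<in> E" using assms matchingsD(1)[OF M] by auto
  then have c: "card {v, w} = 2" "{v, w} \<subseteq> V" using fg by (auto simp: finite_graph_def)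
  show wv: "w \<noteq> v" using c(1) by (metis card_2_iff doubleton_eq_iff insert_absorb2)
  show V: "v \<in> V" "w \<in> V" using c by auto
  show Z: "v \<notin> Z" using matchingsD(2)[OF M assms(2)] by auto
  have "w' = w" if "{v, w'} \<in> M" for w'
  proof -
    have "{v, w'} = {v, w}" using matchingsD(3)[OF M V(1) Z] assms(2) that by blast
    then show ?thesis by (auto simp: doubleton_eq_iff)
  qed
  then have "(THE w. {v, w} \<in> M) = w" using assms(2) by (intro the_equality)
  then show "mate M v = w" using assms(2) by (auto simp: mate_def)
qed

lemma mate_unmatched:
  assumes M: "M \<in> matchings V E Z" and "v \<in> Z \<or> v \<notin> V"
  shows "mate M v = v"
  using assms mate_eqI[OF M] by (auto simp: mate_def)

lemma mate_matched:
  assumes M: "M \<in> matchings V E Z" and "v \<in> V" "v \<notin> Z"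
  shows "{v, mate M v} \<in> M" "mate M v \<noteq> v" "mate M v \<in> V"
proof -
  obtain e where e: "e \<in> M" "v \<in> e" using matchingsD(3)[OF assms] by auto
  then have "e \<in> E" using matchingsD(1)[OF M] by auto
  then obtain w where "e = {v, w}" using finite_graph_edge[OF fg _ e(2)] by metis
  with e have "{v, w} \<in> M" by simp
  with mate_eqI[OF M this] show "{v, mate M v} \<in> M" "mate M v \<noteq> v" "mate M v \<in> V" by auto
qed

lemma mate_fixed_iff:
  assumes "M \<in> matchings V E Z" "v \<in> V"
  shows "mate M v = v \<longleftrightarrow> v \<in> Z"
  using mate_matched[OF assms] mate_unmatched[OF assms(1)] by auto

lemma mate_mate:
  assumes M: "M \<in> matchings V E Z"
  shows "mate M (mate M v) = v"
proof (cases "v \<in> V \<and> v \<notin> Z")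
  case True
  then have "{mate M v, v} \<in> M" using mate_matched[OF M, of v] by (simp add: insert_commute)
  then show ?thesis using mate_eqI[OF M] by blast
qed (use mate_unmatched[OF M, of v] in auto)

lemma mate_in:
  assumes M: "M \<in> matchings V E Z" and "v \<in> V"
  shows "mate M v \<in> V"
  using assms mate_matched[OF M] mate_unmatched[OF M] by (cases "v \<in> Z") auto

text \<open>Unmatched vertices only add loops to the mate relation, so walks in the superposed graph
  and orbits under the two mates reach the same vertices.\<close>

lemma adj_rel_matchings_rtrancl:
  assumes M: "M \<in> matchings V E Z" and N: "N \<in> matchings V E Z'"
  shows "(adj_rel (M \<union> N))\<^sup>* = {(x, y). y = mate M x \<or> y = mate N x}\<^sup>*" (is "?A\<^sup>* = ?R\<^sup>*")
proof
  have "?A \<subseteq> ?R" using mate_eqI(1)[OF M] mate_eqI(1)[OF N] by (auto simp: adj_rel_def)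
  then show "?A\<^sup>* \<subseteq> ?R\<^sup>*" by (rule rtrancl_mono)
  have 1: "(x, mate M x) \<in> ?A\<^sup>*" for x
    using mate_matched(1)[OF M, of x] mate_unmatched[OF M, of x]
    by (cases "x \<in> V \<and> x \<notin> Z") (auto simp: adj_rel_def)
  have 2: "(x, mate N x) \<in> ?A\<^sup>*" for x
    using mate_matched(1)[OF N, of x] mate_unmatched[OF N, of x]
    by (cases "x \<in> V \<and> x \<notin> Z'") (auto simp: adj_rel_def)
  have "?R \<subseteq> ?A\<^sup>*" using 1 2 by auto
  then show "?R\<^sup>* \<subseteq> ?A\<^sup>*" by (metis rtrancl_mono rtrancl_idemp)
qed

text \<open>The ends of the paths in \<open>M \<union> N\<close> are the nodes missed by exactly one
  matching, that is, fixed by exactly one mate. The orbit lemma wants the map fixing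
  \<open>v\<close> first, so the roles of \<open>M\<close> and \<open>N\<close> depend on which of
  them misses \<open>v\<close>.\<close>

lemma component_one_other_end:
  assumes M: "M \<in> matchings V E Z" and N: "N \<in> matchings V E Z'"
    and v: "v \<in> V" "v \<in> Z \<longleftrightarrow> v \<notin> Z'"
  shows "\<exists>!w. w \<noteq> v \<and> (v, w) \<in> (adj_rel (M \<union> N))\<^sup>* \<and> w \<in> V \<and> (w \<in> Z \<longleftrightarrow> w \<notin> Z')"
proof -
  let ?R = "{(x, y). y = mate M x \<or> y = mate N x}"
  have fin: "finite V" using fg by (simp add: finite_graph_def)
  have ex: "\<exists>!w. w \<noteq> v \<and> (v, w) \<in> ?R\<^sup>* \<and> (mate M w = w \<longleftrightarrow> mate N w \<noteq> w)"
  proof (cases "v \<in> Z")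
    case True
    then show ?thesis
      using v mate_fixed_iff[OF M v(1)] mate_fixed_iff[OF N v(1)]
      by (intro involution_orbit_two_endpoints[OF fin mate_in[OF M] mate_in[OF N] mate_mate[OF M] mate_mate[OF N] v(1)])
        auto
  next
    case False
    have eq: "?R = {(x, y). y = mate N x \<or> y = mate M x}" by auto
    have "\<exists>!w. w \<noteq> v \<and> (v, w) \<in> ?R\<^sup>* \<and> (mate N w = w \<longleftrightarrow> mate M w \<noteq> w)"
      using False v mate_fixed_iff[OF M v(1)] mate_fixed_iff[OF N v(1)]
      by (intro involution_orbit_two_endpoints[OF fin mate_in[OF N] mate_in[OF M] mate_mate[OF N] mate_mate[OF M] v(1) _ _ eq])
        auto
    then show ?thesis by (metis (no_types, lifting))
  qed
  have V: "w \<in> V" if "(v, w) \<in> ?R\<^sup>*" for w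
    using that by (induction rule: rtrancl_induct) (use v mate_in[OF M] mate_in[OF N] in auto)
  have iff: "w \<noteq> v \<and> (v, w) \<in> ?R\<^sup>* \<and> w \<in> V \<and> (w \<in> Z \<longleftrightarrow> w \<notin> Z')
     \<longleftrightarrow> w \<noteq> v \<and> (v, w) \<in> ?R\<^sup>* \<and> (mate M w = w \<longleftrightarrow> mate N w \<noteq> w)" for w
    using V[of w] mate_fixed_iff[OF M, of w] mate_fixed_iff[OF N, of w] by blast
  show ?thesis unfolding adj_rel_matchings_rtrancl[OF M N] iff by (rule ex)
qed

end

section \<open>Exchanging two matchings along a component\<close>

definition exchange :: "'v set set \<Rightarrow> 'v set set \<Rightarrow> 'v set \<Rightarrow> 'v set set" where
  "exchange M N C = {e \<in> M. e \<inter> C = {}} \<union> {e \<in> N. e \<inter> C \<noteq> {}}"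

lemma exchange_exchange: "exchange (exchange M N C) (exchange N M C) C = M"
  by (auto simp: exchange_def)

lemma exchange_union: "exchange M N C \<union> exchange N M C = M \<union> N"
  by (auto simp: exchange_def)

text \<open>No edge of \<open>M\<close> or \<open>N\<close> leaves \<open>C\<close>, so every vertex
  sees the edges of just one of the two matchings: of \<open>N\<close> inside \<open>C\<close>, of
  \<open>M\<close> outside.\<close>

lemma exchange_matching:
  assumes M: "M \<in> matchings V E Z" and N: "N \<in> matchings V E Z'" and EV: "\<And>e. e \<in> E \<Longrightarrow> e \<subseteq> V"
    and C: "\<And>e. e \<in> M \<union> N \<Longrightarrow> e \<subseteq> C \<or> e \<inter> C = {}"
    and Y: "\<And>u. u \<in> V \<Longrightarrow> u \<in> Y \<longleftrightarrow> (if u \<in> C then u \<in> Z' else u \<in> Z)"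
  shows "exchange M N C \<in> matchings V E Y"
proof (rule matchingsI)
  show "exchange M N C \<subseteq> E" using matchingsD(1)[OF M] matchingsD(1)[OF N] by (auto simp: exchange_def)
next
  fix e assume "e \<in> exchange M N C"
  then consider "e \<in> M" "e \<inter> C = {}" | "e \<in> N" "e \<subseteq> C" using C by (auto simp: exchange_def)
  then show "e \<inter> Y = {}"
  proof cases
    case 1
    then have "e \<subseteq> V" "e \<inter> Z = {}" using EV[OF subsetD[OF matchingsD(1)[OF M]]] matchingsD(2)[OF M] by auto
    with 1 Y show ?thesis unfolding disjoint_iff by (metis subsetD)
  next
    case 2
    then have "e \<subseteq> V" "e \<inter> Z' = {}" using EV[OF subsetD[OF matchingsD(1)[OF N]]] matchingsD(2)[OF N] by auto
    with 2 Y show ?thesis unfolding disjoint_iff by (metis subsetD)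
  qed
next
  fix v assume v: "v \<in> V" "v \<notin> Y"
  show "\<exists>!e. e \<in> exchange M N C \<and> v \<in> e"
  proof (cases "v \<in> C")
    case True
    then have "\<exists>!e. e \<in> N \<and> v \<in> e" using v Y matchingsD(3)[OF N] by auto
    moreover have "e \<in> exchange M N C \<and> v \<in> e \<longleftrightarrow> e \<in> N \<and> v \<in> e" for e
      using True by (auto simp: exchange_def)
    ultimately show ?thesis by simp
  next
    case False
    then have "\<exists>!e. e \<in> M \<and> v \<in> e" using v Y matchingsD(3)[OF M] by auto
    moreover have "e \<in> exchange M N C \<and> v \<in> e \<longleftrightarrow> e \<in> M \<and> v \<in> e" for e
      using False C by (auto simp: exchange_def)
    ultimately show ?thesis by simp
  qed
qed

lemma prod_exchange:
  fixes w :: "'v set \<Rightarrow> 'a :: comm_monoid_mult"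
  assumes "finite M" "finite N"
  shows "prod w (exchange M N C) * prod w (exchange N M C) = prod w M * prod w N"
proof -
  have p: "prod w (exchange A B C) = prod w {e \<in> A. e \<inter> C = {}} * prod w {e \<in> B. e \<inter> C \<noteq> {}}"
    if "finite A" "finite B" for A B
    unfolding exchange_def using that by (intro prod.union_disjoint) auto
  have q: "prod w A = prod w {e \<in> A. e \<inter> C = {}} * prod w {e \<in> A. e \<inter> C \<noteq> {}}" if "finite A" for A
    using that by (subst prod.union_disjoint[symmetric]) (auto intro: prod.cong)
  show ?thesis
    unfolding p[OF assms] p[OF assms(2,1)] q[OF assms(1)] q[OF assms(2)] by (simp add: ac_simps)
qed

definition removal_signature :: "'v matchgate \<Rightarrow> nat set \<Rightarrow> complex" where
  "removal_signature H S = (let Z = (!) (exts H) ` S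
     in perfmatch_sum (verts H - Z) {e \<in> edges H. e \<inter> Z = {}} (weight H))"

lemma removal_signature_eq:
  "removal_signature H S = (\<Sum>M\<in>matchings (verts H) (edges H) ((!) (exts H) ` S). prod (weight H) M)"
  by (simp add: removal_signature_def perfmatch_sum_def matchings_def Let_def)

text \<open>Between the two counts lie \<open>p\<close> itself and the even number of points
  strictly between \<open>p\<close> and \<open>p'\<close>, an odd number in all.\<close>

lemma minus_one_power_gap:
  fixes D :: "nat set"
  assumes "finite D" "p \<in> D" "p < p'" "even (card {q \<in> D. p < q \<and> q < p'})"
  shows "(-1 :: complex) ^ card {q \<in> D. q < p'} = - ((-1) ^ card {q \<in> D. q < p})"
proof -
  have "{q \<in> D. q < p'} = insert p {q \<in> D. q < p} \<union> {q \<in> D. p < q \<and> q < p'}"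
    using assms by auto
  moreover have "card (insert p {q \<in> D. q < p} \<union> {q \<in> D. p < q \<and> q < p'})
      = card (insert p {q \<in> D. q < p}) + card {q \<in> D. p < q \<and> q < p'}"
    using assms(1) by (intro card_Un_disjoint) auto
  moreover have "card (insert p {q \<in> D. q < p}) = Suc (card {q \<in> D. q < p})"
    using assms(1) by simp
  ultimately show ?thesis using assms(4) by (simp add: power_add)
qed

theorem matchgate_identity:
  fixes H :: "'v matchgate" and \<alpha> \<beta> :: "nat set"
  defines "D \<equiv> sym_diff \<alpha> \<beta>"
  assumes H: "is_matchgate H" and \<alpha>: "\<alpha> \<subseteq> {..<arity H}" and \<beta>: "\<beta> \<subseteq> {..<arity H}"
  shows "(\<Sum>p\<in>D. (-1) ^ card {q \<in> D. q < p} *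
      (removal_signature H (sym_diff \<alpha> {p}) * removal_signature H (sym_diff \<beta> {p}))) = 0"
proof -
  define V E w xs where "V = verts H" and "E = edges H" and "w = weight H" and "xs = exts H"
  have fg: "finite_graph V E" and dist: "distinct xs" and xsV: "set xs \<subseteq> V"
    using H by (auto simp: is_matchgate_def V_def E_def xs_def)
  obtain p0 c where pd: "plane_drawing V E p0 c" and of: "outer_face_ccw V E p0 c xs"
    using H by (auto simp: is_matchgate_def V_def E_def xs_def)
  have EV: "e \<subseteq> V" if "e \<in> E" for e using fg that by (auto simp: finite_graph_def)
  have finE: "finite E"
    using EV fg by (auto simp: finite_graph_def intro: finite_subset[of E "Pow V"])
  have len: "\<alpha> \<subseteq> {..<length xs}" "\<beta> \<subseteq> {..<length xs}" using \<alpha> \<beta> by (auto simp: arity_def xs_def)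
  have Dlen: "D \<subseteq> {..<length xs}" using len by (auto simp: D_def)
  have finD: "finite D" using Dlen finite_subset by blast
  define Z where "Z S = (!) xs ` S" for S
  define PM where "PM S = matchings V E (Z S)" for S
  define ta where "ta p = sym_diff \<alpha> {p}" for p
  define tb where "tb p = sym_diff \<beta> {p}" for p
  have inZ: "xs ! i \<in> Z S \<longleftrightarrow> i \<in> S" if "i < length xs" "S \<subseteq> {..<length xs}" for i S
    using that dist by (auto simp: Z_def nth_eq_iff_index_eq)
  have sub: "ta p \<subseteq> {..<length xs}" "tb p \<subseteq> {..<length xs}" if "p \<in> D" for p
    using that len Dlen by (auto simp: ta_def tb_def)
  \<comment> \<open>Toggling the same \<open>p\<close> in both sets keeps their symmetric
    difference. So for every \<open>p\<close>, the nodes missed by exactly one of the two matchings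
    are those at the positions in \<open>D\<close>.\<close>
  have tab: "i \<in> D \<longleftrightarrow> (i \<in> ta p \<longleftrightarrow> i \<notin> tb p)" for i p
    by (auto simp: D_def ta_def tb_def)
  have inV: "xs ! i \<in> V" if "i < length xs" for i using that xsV by auto
  have finPM: "finite (PM S)" for S
    by (rule finite_subset[of _ "Pow E"]) (use finE in \<open>auto simp: PM_def dest: matchingsD(1)\<close>)
  have finM: "finite M" if "M \<in> PM S" for M S
    using that finE matchingsD(1) finite_subset unfolding PM_def by metis

  define conn where "conn K a b \<longleftrightarrow> (xs ! a, xs ! b) \<in> (adj_rel K)\<^sup>*" for K :: "'v set set" and a b
  have conn_sym: "conn K a b \<Longrightarrow> conn K b a" for K a b
    by (auto simp: conn_def intro: adj_rel_rtrancl_sym)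
  have conn_trans: "conn K a b \<Longrightarrow> conn K b b' \<Longrightarrow> conn K a b'" for K a b b'
    by (auto simp: conn_def)
  define other where "other K a = (THE b. b \<in> D \<and> b \<noteq> a \<and> conn K a b)" for K :: "'v set set" and a

  have uniq: "\<exists>!b. b \<in> D \<and> b \<noteq> a \<and> conn (M \<union> N) a b"
    if p: "p \<in> D" and "M \<in> PM (ta p)" "N \<in> PM (tb p)" "a \<in> D" for p M N a
  proof -
    have al: "a < length xs" using that Dlen by auto
    have ends: "u \<in> V \<and> (u \<in> Z (ta p) \<longleftrightarrow> u \<notin> Z (tb p)) \<longleftrightarrow> (\<exists>b\<in>D. u = xs ! b)" for u
    proof
      assume u: "u \<in> V \<and> (u \<in> Z (ta p) \<longleftrightarrow> u \<notin> Z (tb p))"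
      then obtain b where "u = xs ! b" "b < length xs" using sub[OF p] by (auto simp: Z_def)
      with u show "\<exists>b\<in>D. u = xs ! b" using inZ sub[OF p] tab[of b p] by auto
    next
      assume "\<exists>b\<in>D. u = xs ! b"
      then obtain b where b: "b \<in> D" "u = xs ! b" by blast
      then have "b < length xs" using Dlen by auto
      with b show "u \<in> V \<and> (u \<in> Z (ta p) \<longleftrightarrow> u \<notin> Z (tb p))"
        using inZ sub[OF p] tab[of b p] inV by auto
    qed
    have "\<exists>!u. u \<noteq> xs ! a \<and> (xs ! a, u) \<in> (adj_rel (M \<union> N))\<^sup>* \<and> u \<in> V \<and> (u \<in> Z (ta p) \<longleftrightarrow> u \<notin> Z (tb p))"
      using that(2,3) ends[of "xs ! a"] \<open>a \<in> D\<close> unfolding PM_def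
      by (intro component_one_other_end[OF fg]) auto
    then have ex: "\<exists>!u. u \<noteq> xs ! a \<and> (xs ! a, u) \<in> (adj_rel (M \<union> N))\<^sup>* \<and> (\<exists>b\<in>D. u = xs ! b)"
      unfolding ends .
    have nth_inj: "b = b'" if "b \<in> D" "b' \<in> D" "xs ! b = xs ! b'" for b b'
      using that Dlen dist by (auto simp: nth_eq_iff_index_eq subset_iff)
    from ex obtain u where u: "u \<noteq> xs ! a" "(xs ! a, u) \<in> (adj_rel (M \<union> N))\<^sup>*" "\<exists>b\<in>D. u = xs ! b"
      and un: "\<And>u'. u' \<noteq> xs ! a \<and> (xs ! a, u') \<in> (adj_rel (M \<union> N))\<^sup>* \<and> (\<exists>b\<in>D. u' = xs ! b) \<Longrightarrow> u' = u"
      by (elim ex1E) blast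
    from u(3) obtain b where b: "b \<in> D" "u = xs ! b" by blast
    show ?thesis
    proof (rule ex1I[of _ b])
      show "b \<in> D \<and> b \<noteq> a \<and> conn (M \<union> N) a b" using b u by (auto simp: conn_def)
      fix b' assume b': "b' \<in> D \<and> b' \<noteq> a \<and> conn (M \<union> N) a b'"
      then have "xs ! b' \<noteq> xs ! a" using nth_inj \<open>a \<in> D\<close> by blast
      then have "xs ! b' = u" using b' by (intro un) (auto simp: conn_def)
      then show "b' = b" using nth_inj b b' by simp
    qed
  qed

  \<comment> \<open>Expanding the products turns the identity into a sum over triples
    \<open>(p, M, N)\<close>; \<open>swap\<close> will be an involution on them that negates every
    term.\<close>
  define T where "T = (SIGMA p:D. PM (ta p) \<times> PM (tb p))"
  define C where "C K p = {u. (xs ! p, u) \<in> (adj_rel K)\<^sup>*}" for K :: "'v set set" and p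
  define swap where "swap = (\<lambda>(p, M, N). (other (M \<union> N) p, exchange M N (C (M \<union> N) p), exchange N M (C (M \<union> N) p)))"
  define tm where "tm = (\<lambda>(p, M, N). (-1) ^ card {q \<in> D. q < p} * (prod w M * prod w N))"

  have step: "swap t \<in> T \<and> swap (swap t) = t \<and> tm (swap t) = - tm t" if "t \<in> T" for t
  proof -
    obtain p M N where t: "t = (p, M, N)" by (cases t)
    have p: "p \<in> D" and M: "M \<in> PM (ta p)" and N: "N \<in> PM (tb p)" using that by (auto simp: T_def t)
    define K where "K = M \<union> N"
    have oth: "other K a \<in> D \<and> other K a \<noteq> a \<and> conn K a (other K a)" if "a \<in> D" for a
      unfolding other_def K_def by (rule theI'[OF uniq[OF p M N that]])
    have oth_eq: "b = other K a" if "a \<in> D" "b \<in> D" "b \<noteq> a" "conn K a b" for a b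
      using uniq[OF p M N that(1)] oth[OF that(1)] that unfolding K_def by blast
    have oth_oth: "other K (other K a) = a" if "a \<in> D" for a
      using oth[OF that] oth_eq[of "other K a" a] that conn_sym by metis
    have KE: "K \<subseteq> E" using M N by (auto simp: K_def PM_def dest: matchingsD(1))
    define p' where "p' = other K p"
    have p': "p' \<in> D" "p' \<noteq> p" "conn K p p'" "other K p' = p" using oth[OF p] oth_oth[OF p] by (auto simp: p'_def)
    have CC: "C K p' = C K p"
      using p'(3) conn_sym[OF p'(3)] unfolding C_def conn_def by (auto intro: rtrancl_trans)
    have closed: "e \<subseteq> C K p \<or> e \<inter> C K p = {}" if "e \<in> K" for e
    proof -
      have "u \<in> C K p" if "v \<in> e" "v \<in> C K p" "u \<in> e" for u v
      proof -
        obtain x where x: "e = {v, x}" using finite_graph_edge[OF fg _ \<open>v \<in> e\<close>] \<open>e \<in> K\<close> KE by (metis subsetD)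
        show ?thesis
        proof (cases "u = v")
          case False
          then have "(v, u) \<in> adj_rel K" using x \<open>u \<in> e\<close> \<open>e \<in> K\<close> by (auto simp: adj_rel_def)
          then show ?thesis using \<open>v \<in> C K p\<close> by (auto simp: C_def)
        qed (use that in simp)
      qed
      then show ?thesis by blast
    qed
    have inC: "xs ! i \<in> C K p \<longleftrightarrow> i = p \<or> i = p'" if "i \<in> D" for i
      using oth_eq[OF p that] p'(3) by (auto simp: C_def conn_def p'_def)
    have nZ: "u \<notin> Z S" if "\<And>i. i < length xs \<Longrightarrow> u \<noteq> xs ! i" "S \<subseteq> {..<length xs}" for u S
      using that by (auto simp: Z_def)
    \<comment> \<open>Inside the component the two removed sets trade places. Positions outside
      \<open>D\<close> lie in both sets or in neither, and of \<open>D\<close> the component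
      contains only \<open>p\<close> and \<open>p'\<close>; the effect is to toggle
      \<open>p'\<close> in place of \<open>p\<close>.\<close>
    have Ya: "u \<in> Z (ta p') \<longleftrightarrow> (if u \<in> C K p then u \<in> Z (tb p) else u \<in> Z (ta p))"
      and Yb: "u \<in> Z (tb p') \<longleftrightarrow> (if u \<in> C K p then u \<in> Z (ta p) else u \<in> Z (tb p))" for u
    proof -
      have "(u \<in> Z (ta p') \<longleftrightarrow> (if u \<in> C K p then u \<in> Z (tb p) else u \<in> Z (ta p))) \<and>
        (u \<in> Z (tb p') \<longleftrightarrow> (if u \<in> C K p then u \<in> Z (ta p) else u \<in> Z (tb p)))"
      proof (cases "\<exists>i<length xs. u = xs ! i")
        case True
        then obtain i where i: "i < length xs" "u = xs ! i" by blast
        have "(i \<in> ta p' \<longleftrightarrow> (if u \<in> C K p then i \<in> tb p else i \<in> ta p)) \<and>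
           (i \<in> tb p' \<longleftrightarrow> (if u \<in> C K p then i \<in> ta p else i \<in> tb p))"
        proof (cases "i \<in> D")
          case True
          then show ?thesis using inC[OF True] p'(1,2) p unfolding i(2) by (auto simp: ta_def tb_def D_def)
        next
          case False
          then have "i \<noteq> p" "i \<noteq> p'" "i \<in> \<alpha> \<longleftrightarrow> i \<in> \<beta>" using p p' by (auto simp: D_def)
          then show ?thesis by (auto simp: ta_def tb_def)
        qed
        then show ?thesis using i inZ sub[OF p] sub[OF p'(1)] by auto
      next
        case False
        then have "u \<notin> Z S" if "S \<subseteq> {..<length xs}" for S using nZ that by blast
        then show ?thesis using sub[OF p] sub[OF p'(1)] by simp
      qed
      then show "u \<in> Z (ta p') \<longleftrightarrow> (if u \<in> C K p then u \<in> Z (tb p) else u \<in> Z (ta p))"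
        "u \<in> Z (tb p') \<longleftrightarrow> (if u \<in> C K p then u \<in> Z (ta p) else u \<in> Z (tb p))" by blast+
    qed
    define M' N' where "M' = exchange M N (C K p)" and "N' = exchange N M (C K p)"
    have M': "M' \<in> PM (ta p')"
      unfolding PM_def M'_def
      by (rule exchange_matching[OF M[unfolded PM_def] N[unfolded PM_def] EV])
        (use closed Ya in \<open>auto simp: K_def\<close>)
    have N': "N' \<in> PM (tb p')"
      unfolding PM_def N'_def
      by (rule exchange_matching[OF N[unfolded PM_def] M[unfolded PM_def] EV])
        (use closed Yb in \<open>auto simp: K_def\<close>)
    have st: "swap t = (p', M', N')"
      by (simp add: t swap_def M'_def N'_def p'_def K_def)
    \<comment> \<open>Components and partners depend on the union alone, which the exchange
      preserves; therefore a second exchange undoes the first.\<close>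
    have K': "M' \<union> N' = K" by (simp add: M'_def N'_def exchange_union K_def)
    have "swap (p', M', N') = (other K p', exchange M' N' (C K p'), exchange N' M' (C K p'))"
      by (simp add: swap_def K')
    then have "swap (swap t) = (p, exchange M' N' (C K p), exchange N' M' (C K p))"
      unfolding st CC p'(4) .
    also have "\<dots> = t" by (simp add: t M'_def N'_def exchange_exchange)
    finally have ss: "swap (swap t) = t" .
    \<comment> \<open>Interlacing pairs would lie in one component, which would then hold more than
      two nodes of \<open>D\<close>.\<close>
    have nc: False if a: "a \<in> D" "a' \<in> D" "a < a'" "a' < other K a" "other K a < other K a'" for a a'
    proof -
      have "other K a' < length xs" using oth[OF a(2)] Dlen by auto
      then have "conn K a a'"
        using crossing_walks_meet[OF pd of fg xsV KE a(3,4,5)] oth[OF a(1)] oth[OF a(2)] by (simp add: conn_def)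
      then have "a' = other K a" using oth_eq[OF a(1,2)] a(3) by simp
      then show False using a(4) by simp
    qed
    have oo: "other K q \<in> D \<and> other K (other K q) = q \<and> other K q \<noteq> q" if "q \<in> D" for q
      using oth[OF that] oth_oth[OF that] by simp
    have gap: "(-1 :: complex) ^ card {q \<in> D. q < p'} = - ((-1) ^ card {q \<in> D. q < p})"
    proof (cases "p < p'")
      case True
      have "even (card {q \<in> D. p < q \<and> q < p'})"
        unfolding p'_def
        by (rule noncrossing_even_between[OF finD oo nc p]) (use True in \<open>auto simp: p'_def\<close>)
      then show ?thesis using minus_one_power_gap[OF finD p True] by blast
    next
      case False
      then have lt: "p' < p" using p' by simp
      have "even (card {q \<in> D. p' < q \<and> q < other K p'})"
        by (rule noncrossing_even_between[OF finD oo nc p'(1)]) (use lt p' in auto)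
      then have "even (card {q \<in> D. p' < q \<and> q < p})" by (simp add: p')
      then show ?thesis using minus_one_power_gap[OF finD p'(1) lt] by simp
    qed
    have "prod w M' * prod w N' = prod w M * prod w N"
      unfolding M'_def N'_def by (rule prod_exchange[OF finM[OF M] finM[OF N]])
    then have "tm (swap t) = - tm t" unfolding st by (simp add: tm_def t gap)
    moreover have "swap t \<in> T" using st M' N' p' by (simp add: T_def)
    ultimately show ?thesis using ss by simp
  qed
  have "sum tm T = (\<Sum>t\<in>T. - tm t)"
    by (rule sum.reindex_bij_witness[of _ swap swap]) (use step in auto)
  then have "sum tm T = 0" by (simp add: sum_negf)
  moreover have "sum tm T = (\<Sum>p\<in>D. (-1) ^ card {q \<in> D. q < p} *
      (removal_signature H (ta p) * removal_signature H (tb p)))"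
  proof -
    have rs: "removal_signature H S = sum (prod w) (PM S)" for S
      by (simp add: removal_signature_eq PM_def Z_def V_def E_def w_def xs_def)
    have "(-1) ^ card {q \<in> D. q < p} * (removal_signature H (ta p) * removal_signature H (tb p))
        = (\<Sum>y\<in>PM (ta p) \<times> PM (tb p). tm (p, y))" for p
    proof -
      have "removal_signature H (ta p) * removal_signature H (tb p)
          = (\<Sum>y\<in>PM (ta p) \<times> PM (tb p). prod w (fst y) * prod w (snd y))"
        by (simp add: rs sum_product sum.cartesian_product split_def)
      then show ?thesis by (simp add: sum_distrib_left tm_def split_def)
    qed
    moreover have "(\<Sum>p\<in>D. \<Sum>y\<in>PM (ta p) \<times> PM (tb p). tm (p, y)) = (\<Sum>(p, y)\<in>T. tm (p, y))"
      unfolding T_def by (rule sum.Sigma) (use finD finPM in auto)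
    ultimately show ?thesis by simp
  qed
  ultimately show ?thesis by (simp add: ta_def tb_def)
qed

section \<open>Bit strings\<close>

lemma lex_index_append: "lex_index k (xs @ ys) = lex_index k xs * k ^ length ys + lex_index k ys"
proof -
  have *: "foldl (\<lambda>x d. k * x + d) a ys = a * k ^ length ys + foldl (\<lambda>x d. k * x + d) 0 ys" for a
  proof (induction ys rule: rev_induct)
    case (snoc y ys)
    then show ?case by (simp add: algebra_simps)
  qed simp
  show ?thesis unfolding lex_index_def foldl_append by (rule *)
qed

lemma lex_index_Nil [simp]: "lex_index k [] = 0"
  and lex_index_single [simp]: "lex_index k [d] = d"
  by (auto simp: lex_index_def)

lemma lex_index_less:
  assumes "\<forall>d\<in>set ds. d < k"
  shows "lex_index k ds < k ^ length ds"
  using assms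
proof (induction ds rule: rev_induct)
  case (snoc d ds)
  then have "lex_index k ds + 1 \<le> k ^ length ds" "d < k" by auto
  then have "k * (lex_index k ds + 1) \<le> k * k ^ length ds" by (intro mult_left_mono) auto
  with \<open>d < k\<close> show ?case by (simp add: lex_index_append algebra_simps)
qed simp

lemma length_digits [simp]: "length (digits k n x) = n"
  by (simp add: digits_def)

lemma digits_Suc: "digits k (Suc n) x = digits k n (x div k) @ [x mod k]"
proof (rule nth_equalityI)
  fix i assume "i < length (digits k (Suc n) x)"
  then have i: "i < Suc n" by simp
  show "digits k (Suc n) x ! i = (digits k n (x div k) @ [x mod k]) ! i"
  proof (cases "i = n")
    case False
    then have "n - i = Suc (n - 1 - i)" using i by simp
    then show ?thesis using i False by (simp add: digits_def nth_append div_mult2_eq)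
  qed (use i in \<open>simp add: digits_def nth_append\<close>)
qed simp

lemma digits_less: "0 < k \<Longrightarrow> d \<in> set (digits k n x) \<Longrightarrow> d < k"
  by (auto simp: digits_def)

lemma digits_lex_index:
  assumes "\<forall>d\<in>set ds. d < k" "length ds = n"
  shows "digits k n (lex_index k ds) = ds"
  using assms
proof (induction ds arbitrary: n rule: rev_induct)
  case (snoc d ds)
  then obtain m where "n = Suc m" "length ds = m" by auto
  with snoc show ?case by (simp add: lex_index_append digits_Suc)
qed (simp add: digits_def)

lemma lex_index_digits:
  assumes "x < k ^ n"
  shows "lex_index k (digits k n x) = x"
  using assms
proof (induction n arbitrary: x)
  case (Suc n)
  then have "x div k < k ^ n" by (simp add: less_mult_imp_div_less mult.commute)
  with Suc.IH show ?case by (simp add: digits_Suc lex_index_append)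
qed (simp add: digits_def)

section \<open>Base 4 digits as pairs of bits\<close>

definition ones :: "nat list \<Rightarrow> nat set" where
  "ones bs = {j. j < length bs \<and> bs ! j = 1}"

definition bits_of :: "nat list \<Rightarrow> nat list" where
  "bits_of ds = concat (map (\<lambda>d. [d div 2, d mod 2]) ds)"

lemma length_bits_of [simp]: "length (bits_of ds) = 2 * length ds"
  by (induction ds) (auto simp: bits_of_def)

lemma bits_of_append: "bits_of (xs @ ys) = bits_of xs @ bits_of ys"
  by (simp add: bits_of_def)

lemma bits_of_Cons: "bits_of (d # ds) = d div 2 # d mod 2 # bits_of ds"
  by (simp add: bits_of_def)

lemma lex_index_bits_of: "lex_index 2 (bits_of ds) = lex_index 4 ds"
proof (induction ds rule: rev_induct)
  case (snoc d ds)
  have "lex_index 2 [d div 2, d mod 2] = d" by (simp add: lex_index_def)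
  then show ?case using snoc
    by (simp add: bits_of_append lex_index_append) (simp add: bits_of_def)
qed (simp add: bits_of_def)

lemma bits_of_less: "\<forall>d\<in>set ds. d < 4 \<Longrightarrow> b \<in> set (bits_of ds) \<Longrightarrow> b < 2"
  by (auto simp: bits_of_def)

lemma bits_of_nth:
  assumes "j < 2 * length ds"
  shows "bits_of ds ! j = (if even j then ds ! (j div 2) div 2 else ds ! (j div 2) mod 2)"
  using assms
proof (induction ds arbitrary: j)
  case (Cons d ds)
  show ?case
  proof (cases "j < 2")
    case True
    then have "j = 0 \<or> j = 1" by auto
    then show ?thesis by (auto simp: bits_of_Cons)
  next
    case False
    then obtain i where i: "j = i + 2" by (metis add.commute le_Suc_ex linorder_not_less)
    then show ?thesis using Cons by (simp add: bits_of_Cons)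
  qed
qed simp

text \<open>The bit positions \<open>2 * t - 2\<close> and \<open>2 * t - 1\<close> are those of the block \<open>\<alpha>\<^sub>t\<close>.\<close>

definition block_set :: "nat \<Rightarrow> nat \<Rightarrow> nat set" where
  "block_set t a = (if 2 \<le> a then {2 * t - 2} else {}) \<union> (if odd a then {2 * t - 1} else {})"

text \<open>The digit 0 put into block \<open>t\<close> contributes no ones, so only the other
  blocks count, and their bits already have their final positions.\<close>

definition rest_set :: "nat \<Rightarrow> nat \<Rightarrow> nat \<Rightarrow> nat set" where
  "rest_set n t b = ones (bits_of (let ds = digits 4 (n - 1) b in take (t - 1) ds @ 0 # drop (t - 1) ds))"

lemma insert_index_less:
  assumes "a < 4" "1 \<le> t" "t \<le> n"
  shows "insert_index 4 n t a b < 4 ^ n"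
proof -
  let ?ds = "digits 4 (n - 1) b"
  let ?l = "take (t - 1) ?ds @ a # drop (t - 1) ?ds"
  have "\<forall>d\<in>set ?l. d < 4" using assms digits_less[of 4] by (auto dest: in_set_takeD in_set_dropD)
  from lex_index_less[OF this] have "lex_index 4 ?l < 4 ^ length ?l" .
  moreover have "length ?l = n" using assms by simp
  ultimately show ?thesis by (simp only: insert_index_def Let_def)
qed

lemma ones_insert_index:
  assumes "a < 4" "1 \<le> t" "t \<le> n"
  shows "ones (digits 2 (2 * n) (insert_index 4 n t a b)) = block_set t a \<union> rest_set n t b"
proof -
  let ?ds = "digits 4 (n - 1) b"
  define l where "l x = take (t - 1) ?ds @ x # drop (t - 1) ?ds" for x
  have len: "length (l x) = n" for x using assms by (simp add: l_def)
  have less: "\<forall>d\<in>set (l x). d < 4" if "x < 4" for x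
    using that digits_less[of 4] by (auto simp: l_def dest: in_set_takeD in_set_dropD)
  have "digits 2 (2 * n) (insert_index 4 n t a b) = bits_of (l a)"
    unfolding insert_index_def Let_def l_def[symmetric] lex_index_bits_of[symmetric]
    using bits_of_less[OF less[OF assms(1)]] len by (intro digits_lex_index) auto
  moreover have "ones (bits_of (l a)) = block_set t a \<union> ones (bits_of (l 0))"
  proof -
    have nth: "l x ! i = (if i = t - 1 then x else l 0 ! i)" for x i
    proof -
      have "length (take (t - 1) ?ds) = t - 1" using assms by simp
      then show ?thesis unfolding l_def by (auto simp: nth_append nth_Cons')
    qed
    have div: "j div 2 = t - 1 \<longleftrightarrow> j = 2 * t - 2 \<or> j = 2 * t - 1" for j using assms by auto
    have a: "a div 2 = 1 \<longleftrightarrow> 2 \<le> a" "a mod 2 = 1 \<longleftrightarrow> odd a" using assms(1) by auto presburger+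
    have "j \<in> ones (bits_of (l a)) \<longleftrightarrow> j \<in> block_set t a \<union> ones (bits_of (l 0))" for j
    proof (cases "j < 2 * n")
      case True
      show ?thesis
      proof (cases "j div 2 = t - 1")
        case T: True
        then have "l a ! (j div 2) = a" "l 0 ! (j div 2) = 0" using nth[of a "j div 2"] nth[of 0 "j div 2"] by auto
        moreover have "even (2 * t - 2)" "odd (2 * t - 1)" "2 * t - 2 \<noteq> 2 * t - 1" using assms by auto
        ultimately show ?thesis using True T a div[of j]
          by (auto simp: ones_def bits_of_nth len block_set_def)
      next
        case F: False
        then have "l a ! (j div 2) = l 0 ! (j div 2)" using nth[of a "j div 2"] by simp
        then show ?thesis using True F div[of j]
          by (auto simp: ones_def bits_of_nth len block_set_def)
      qed
    qed (use assms in \<open>auto simp: ones_def len block_set_def\<close>)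
    then show ?thesis by blast
  qed
  ultimately show ?thesis by (simp add: rest_set_def l_def Let_def)
qed

lemma ones_inj:
  assumes "length as = length bs" "\<forall>a\<in>set as. a < 2" "\<forall>b\<in>set bs. b < 2" "ones as = ones bs"
  shows "as = bs"
proof (rule nth_equalityI)
  fix i assume i: "i < length as"
  then have "as ! i < 2" "bs ! i < 2" using assms by auto
  moreover have "as ! i = 1 \<longleftrightarrow> bs ! i = 1" using assms(1,4) i by (auto simp: ones_def)
  ultimately show "as ! i = bs ! i" by linarith
qed (use assms in simp)

text \<open>This lets sums over columns become sums over subsets of the remaining bits. Decoding the
  index gives injectivity; surjectivity follows by counting, as both sides have 4^(n-1)
  elements.\<close>

lemma bij_betw_rest_set:
  assumes "1 \<le> t" "t \<le> n"
  shows "bij_betw (rest_set n t) {..<4 ^ (n - 1)} (Pow ({..<2 * n} - {2 * t - 2, 2 * t - 1}))"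
proof -
  let ?A = "{..<4 ^ (n - 1)} :: nat set" and ?R = "{..<2 * n} - {2 * t - 2, 2 * t - 1}"
  have eq: "ones (digits 2 (2 * n) (insert_index 4 n t 0 b)) = rest_set n t b" for b
    using ones_insert_index[of 0 t n b] assms by (simp add: block_set_def)
  have inj: "inj_on (rest_set n t) ?A"
  proof
    fix b b' assume b: "b \<in> ?A" "b' \<in> ?A" and e: "rest_set n t b = rest_set n t b'"
    have "digits 2 (2 * n) (insert_index 4 n t 0 b) = digits 2 (2 * n) (insert_index 4 n t 0 b')"
      using e by (intro ones_inj) (auto simp: eq digits_less)
    moreover have "insert_index 4 n t 0 x < 2 ^ (2 * n)" for x
      using insert_index_less[of 0 t n x] assms by (simp add: power_mult)
    ultimately have ii: "insert_index 4 n t 0 b = insert_index 4 n t 0 b'"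
      by (metis lex_index_digits)
    let ?l = "\<lambda>x. take (t - 1) (digits 4 (n - 1) x) @ 0 # drop (t - 1) (digits 4 (n - 1) x)"
    have "digits 4 n (lex_index 4 (?l x)) = ?l x" for x
      using assms digits_less[of 4] by (intro digits_lex_index) (auto dest: in_set_takeD in_set_dropD)
    then have "?l b = ?l b'" using ii unfolding insert_index_def Let_def by metis
    then have "digits 4 (n - 1) b = digits 4 (n - 1) b'"
      using assms by (simp add: append_eq_append_conv) (metis append_take_drop_id)
    then show "b = b'" using b by (metis lessThan_iff lex_index_digits)
  qed
  have sub: "rest_set n t ` ?A \<subseteq> Pow ?R"
  proof
    fix X assume "X \<in> rest_set n t ` ?A"
    then obtain b where X: "X = rest_set n t b" by blast
    have "X \<subseteq> {..<2 * n}" unfolding X eq[symmetric] by (auto simp: ones_def)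
    moreover have "2 * t - 2 \<notin> X" "2 * t - 1 \<notin> X"
    proof -
      have d: "(2 * t - 2) div 2 = t - 1" "(2 * t - 1) div 2 = t - 1" using assms by auto
      have m: "min (n - Suc 0) (t - Suc 0) = t - 1" using assms by auto
      show "2 * t - 2 \<notin> X" "2 * t - 1 \<notin> X"
        unfolding X rest_set_def Let_def ones_def using assms
        by (auto simp: bits_of_nth d nth_append m)
    qed
    ultimately show "X \<in> Pow ?R" by blast
  qed
  have fin: "finite (Pow ?R)" by simp
  have "{2 * t - 2, 2 * t - 1} \<subseteq> {..<2 * n}" "card {2 * t - 2, 2 * t - 1} = 2" using assms by auto
  then have "card ?R = 2 * n - 2" by (simp add: card_Diff_subset)
  then have "card (Pow ?R) = 2 ^ (2 * (n - 1))" by (simp add: card_Pow right_diff_distrib')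
  then have "card (Pow ?R) = card (rest_set n t ` ?A)"
    using card_image[OF inj] by (simp add: power_mult)
  then have "rest_set n t ` ?A = Pow ?R" by (metis card_subset_eq fin sub)
  then show ?thesis using inj by (simp add: bij_betw_def)
qed

section \<open>An invertible submatrix\<close>

text \<open>A maximal independent set of columns has \<open>n\<close> members and forms an
  invertible square matrix, whose transpose kills \<open>z\<close>.\<close>

lemma full_row_rank_left_kernel:
  fixes A :: "'a :: field mat"
  assumes A: "A \<in> carrier_mat n nc" and rank: "vec_space.rank n A = n"
    and z: "z \<in> carrier_vec n" and orth: "\<And>x. x \<in> set (cols A) \<Longrightarrow> z \<bullet> x = 0"
  shows "z = 0\<^sub>v n"
proof (rule ccontr)
  assume nz: "z \<noteq> 0\<^sub>v n"
  interpret vec_space "TYPE('a)" n .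
  have cA: "set (cols A) \<subseteq> carrier_vec n" using cols_dim A by blast
  have emp: "lin_indpt {}" by (rule finite_lin_indpt2) auto
  obtain S where S: "maximal S (\<lambda>T. T \<subseteq> set (cols A) \<and> lin_indpt T)"
    using maximal_exists_superset[of "set (cols A)" "\<lambda>T. T \<subseteq> set (cols A) \<and> lin_indpt T" "{}"]
      emp by auto
  have cS: "card S = n" using rank_card_indpt[OF A S] rank by simp
  have sub: "S \<subseteq> set (cols A)" and ind: "lin_indpt S" using S by (auto simp: maximal_def)
  obtain vs where vs: "set vs = S" "distinct vs" using finite_distinct_list finite_subset[OF sub] by blast
  have len: "length vs = n" using vs cS distinct_card by fastforce
  define B where "B = mat_of_cols n vs"
  have B: "B \<in> carrier_mat n n" by (auto simp: B_def len[symmetric])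
  have cB: "cols B = vs" unfolding B_def using vs sub cA by (intro cols_mat_of_cols) auto
  have "rank B = n" using lin_indpt_full_rank[OF B] cB vs ind by simp
  then have "det B \<noteq> 0" using det_rank_iff[OF B] by simp
  then have dt: "det (transpose_mat B) \<noteq> 0" using det_transpose[OF B] by simp
  have "transpose_mat B *\<^sub>v z = 0\<^sub>v n"
  proof (rule eq_vecI)
    fix i assume "i < dim_vec (0\<^sub>v n :: 'a vec)"
    then have i: "i < n" by simp
    then have "col B i \<in> set (cols A)" using sub vs cB B len by (metis carrier_matD(2) cols_length cols_nth nth_mem subsetD)
    moreover have "col B i \<in> carrier_vec n" using B i by auto
    ultimately have "col B i \<bullet> z = 0" using orth comm_scalar_prod[OF z] by metis
    then show "(transpose_mat B *\<^sub>v z) $ i = 0\<^sub>v n $ i" using B i by simp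
  qed (use B in simp)
  then have "det (transpose_mat B) = 0"
    using det_0_iff_vec_prod_zero[of "transpose_mat B" n] B z nz by auto
  then show False using dt by simp
qed

lemma gen_form_rows_independent:
  assumes rank: "vec_space.rank k (gen_form k n t G) = k"
    and zero: "\<And>b. b < k ^ (n - 1) \<Longrightarrow> (\<Sum>a<k. z a * G $ insert_index k n t a b) = 0"
    and "a < k"
  shows "z a = 0"
proof -
  let ?A = "gen_form k n t G"
  have A: "?A \<in> carrier_mat k (k ^ (n - 1))" by (simp add: gen_form_def)
  have "vec k z = 0\<^sub>v k"
  proof (rule full_row_rank_left_kernel[OF A rank])
    fix x assume "x \<in> set (cols ?A)"
    then obtain b where b: "b < k ^ (n - 1)" "x = col ?A b" using A by (auto simp: cols_def)
    have "vec k z \<bullet> x = (\<Sum>a<k. z a * G $ insert_index k n t a b)"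
      using b by (auto simp: scalar_prod_def gen_form_def lessThan_atLeast0 intro!: sum.cong)
    then show "vec k z \<bullet> x = 0" using zero b by simp
  qed simp
  then have "vec k z $ a = 0\<^sub>v k $ a" by simp
  then show ?thesis using \<open>a < k\<close> by simp
qed

abbreviation toggle :: "nat set \<Rightarrow> nat \<Rightarrow> nat set" where
  "toggle S p \<equiv> sym_diff S {p}"

text \<open>Separates the algebra from the graph: the construction of the inverse sees a generator
  only as a function on sets with these identities, a parity condition and independent rows.\<close>

definition satisfies_mgi :: "nat \<Rightarrow> (nat set \<Rightarrow> complex) \<Rightarrow> bool" where
  "satisfies_mgi m F \<longleftrightarrow> (\<forall>\<alpha> \<beta>. \<alpha> \<subseteq> {..<m} \<longrightarrow> \<beta> \<subseteq> {..<m} \<longrightarrow>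
     (\<Sum>p\<in>sym_diff \<alpha> \<beta>. (-1) ^ card {q \<in> sym_diff \<alpha> \<beta>. q < p} * (F (toggle \<alpha> p) * F (toggle \<beta> p))) = 0)"

text \<open>The identity for \<open>S \<union> {c}\<close> and \<open>X\<close>, solved for the term that toggles \<open>c\<close>.\<close>

lemma mgi_expand_row:
  fixes c :: nat
  assumes mgi: "satisfies_mgi m F" and c: "c < m" and S: "S \<subseteq> {..<m} - {c}" and X: "X \<subseteq> {..<m} - {c}"
  defines "Q \<equiv> sym_diff S X"
  shows "F S * F (insert c X) = - ((-1) ^ card {q \<in> Q. q < c}) *
    (\<Sum>p\<in>Q. (-1) ^ (card {q \<in> Q. q < p} + (if c < p then 1 else 0)) * (F (insert c (toggle S p)) * F (toggle X p)))"
proof -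
  have finQ: "finite Q" using S X finite_subset[of Q "{..<m}"] by (auto simp: Q_def)
  have cQ: "c \<notin> Q" using S X by (auto simp: Q_def)
  have D: "sym_diff (insert c S) X = insert c Q" using S X by (auto simp: Q_def)
  have e1: "toggle (insert c S) c = S" "toggle X c = insert c X" using S X by auto
  have e2: "toggle (insert c S) p = insert c (toggle S p)" if "p \<in> Q" for p using that cQ by auto
  have c1: "card {q \<in> insert c Q. q < c} = card {q \<in> Q. q < c}" by (rule arg_cong[of _ _ card]) auto
  \<comment> \<open>The extra element \<open>c\<close> raises the count below every \<open>p\<close>
    above it by one.\<close>
  have c2: "card {q \<in> insert c Q. q < p} = card {q \<in> Q. q < p} + (if c < p then 1 else 0)" for p
  proof (cases "c < p")
    case True
    then have "{q \<in> insert c Q. q < p} = insert c {q \<in> Q. q < p}" by auto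
    then show ?thesis using finQ cQ True by simp
  next
    case False
    then have "{q \<in> insert c Q. q < p} = {q \<in> Q. q < p}" by auto
    then show ?thesis using False by simp
  qed
  have "insert c S \<subseteq> {..<m}" "X \<subseteq> {..<m}" using c S X by auto
  with mgi have "(\<Sum>p\<in>insert c Q. (-1) ^ card {q \<in> insert c Q. q < p} *
      (F (toggle (insert c S) p) * F (toggle X p))) = 0"
    unfolding satisfies_mgi_def D[symmetric] by blast
  then have "(-1) ^ card {q \<in> Q. q < c} * (F S * F (insert c X)) +
     (\<Sum>p\<in>Q. (-1) ^ (card {q \<in> Q. q < p} + (if c < p then 1 else 0)) * (F (insert c (toggle S p)) * F (toggle X p))) = 0"
    (is "?s * ?a + ?r = 0")
    unfolding sum.insert[OF finQ cQ] e1 c1 c2 using e2 by simp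
  then have sa: "?s * ?a = - ?r" by (simp only: eq_neg_iff_add_eq_0)
  have "?s * ?s = 1" by (simp add: power_mult_distrib[symmetric])
  then have "?a = ?s * (?s * ?a)" by (simp only: mult.assoc[symmetric] mult_1)
  also have "\<dots> = - ?s * ?r" unfolding sa by (simp only: mult_minus_left mult_minus_right)
  finally show ?thesis .
qed

text \<open>If all minors vanished, the pairs of entries at the sets \<open>toggle S p\<close> would
  satisfy one nontrivial linear relation. The expansions of the rows \<open>c\<close> and
  \<open>cc\<close> use those entries with equal coefficients, so the relation would pass to the
  whole rows, against \<open>rows12\<close>. The last conclusion is the identity on the four
  positions; it relates this minor to that of the rows \<open>{}\<close> and
  \<open>{c, cc}\<close>.\<close>

lemma mgi_nonzero_minor:
  fixes c :: nat
  defines "cc \<equiv> Suc c"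
  assumes mgi: "satisfies_mgi m F" and c: "cc < m"
    and row0: "\<exists>X\<subseteq>{..<m} - {c, cc}. F X \<noteq> 0"
    and rows12: "\<And>x y. (\<And>X. X \<subseteq> {..<m} - {c, cc} \<Longrightarrow> x * F (insert c X) + y * F (insert cc X) = 0)
       \<Longrightarrow> x = 0 \<and> y = 0"
  obtains S i j where "S \<subseteq> {..<m} - {c, cc}" "F S \<noteq> 0" "i \<in> {..<m} - {c, cc}" "j \<in> {..<m} - {c, cc}"
    "i < j \<and> j < c \<or> cc < i \<and> i < j \<or> j < c \<and> cc < i"
    "F (insert c (toggle S i)) * F (insert cc (toggle S j)) \<noteq> F (insert c (toggle S j)) * F (insert cc (toggle S i))"
    "F S * F (insert c (insert cc (toggle (toggle S i) j))) - F (insert c (insert cc S)) * F (toggle (toggle S i) j)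
     = - (F (insert c (toggle S i)) * F (insert cc (toggle S j)) - F (insert c (toggle S j)) * F (insert cc (toggle S i)))"
proof -
  let ?R = "{..<m} - {c, cc}"
  obtain S where S: "S \<subseteq> ?R" "F S \<noteq> 0" using row0 by blast
  define u v where "u p = F (insert c (toggle S p))" and "v p = F (insert cc (toggle S p))" for p
  have tog: "toggle X p \<subseteq> ?R" if "X \<subseteq> ?R" "p \<in> ?R" for X p using that by auto
  have "\<exists>i\<in>?R. \<exists>j\<in>?R. u i * v j \<noteq> u j * v i"
  proof (rule ccontr)
    assume "\<not> ?thesis"
    then have dep: "u i * v j = u j * v i" if "i \<in> ?R" "j \<in> ?R" for i j using that by blast
    have "\<exists>x y. (x \<noteq> 0 \<or> y \<noteq> 0) \<and> (\<forall>p\<in>?R. x * u p + y * v p = 0)"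
    proof (cases "\<exists>k\<in>?R. u k \<noteq> 0")
      case True
      then obtain k where k: "k \<in> ?R" "u k \<noteq> 0" by blast
      have "v k * u p + (- u k) * v p = 0" if "p \<in> ?R" for p using dep[OF that k(1)] by (simp add: mult.commute)
      then show ?thesis using k by (intro exI[of _ "v k"] exI[of _ "- u k"]) auto
    next
      case False
      then show ?thesis by (intro exI[of _ 1] exI[of _ 0]) auto
    qed
    then obtain x y where xy: "x \<noteq> 0 \<or> y \<noteq> 0" and comb: "\<And>p. p \<in> ?R \<Longrightarrow> x * u p + y * v p = 0" by blast
    have "x * F (insert c X) + y * F (insert cc X) = 0" if X: "X \<subseteq> ?R" for X
    proof -
      define Q where "Q = sym_diff S X"
      have QR: "Q \<subseteq> ?R" using S X by (auto simp: Q_def)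
      define s where "s = (- ((-1) ^ card {q \<in> Q. q < c}) :: complex)"
      define e where "e p = ((-1) ^ (card {q \<in> Q. q < p} + (if c < p then 1 else 0)) :: complex)" for p
      have 1: "F S * F (insert c X) = s * (\<Sum>p\<in>Q. e p * (u p * F (toggle X p)))"
        unfolding s_def e_def u_def Q_def by (rule mgi_expand_row[OF mgi]) (use c S X in \<open>auto simp: cc_def\<close>)
      have 2: "F S * F (insert cc X) = s * (\<Sum>p\<in>Q. e p * (v p * F (toggle X p)))"
      proof -
        \<comment> \<open>Here adjacency of the two bits matters: no element of \<open>Q\<close>
          separates \<open>c\<close> from \<open>cc\<close>, so both expansions carry the same
          signs.\<close>
        have "{q \<in> Q. q < cc} = {q \<in> Q. q < c}" using QR by (auto simp: cc_def less_Suc_eq)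
        moreover have "cc < p \<longleftrightarrow> c < p" if "p \<in> Q" for p using that QR by (auto simp: cc_def)
        moreover have "F S * F (insert cc X) = - ((-1) ^ card {q \<in> Q. q < cc}) *
          (\<Sum>p\<in>Q. (-1) ^ (card {q \<in> Q. q < p} + (if cc < p then 1 else 0)) * (v p * F (toggle X p)))"
          unfolding Q_def v_def by (rule mgi_expand_row[OF mgi]) (use c S X in \<open>auto simp: cc_def\<close>)
        ultimately show ?thesis by (simp add: s_def e_def)
      qed
      have "F S * (x * F (insert c X) + y * F (insert cc X)) = x * (F S * F (insert c X)) + y * (F S * F (insert cc X))"
        by (simp add: algebra_simps)
      also have "\<dots> = s * (\<Sum>p\<in>Q. e p * ((x * u p + y * v p) * F (toggle X p)))"
      proof -
        have "e p * ((x * u p + y * v p) * F (toggle X p)) =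
            x * (e p * (u p * F (toggle X p))) + y * (e p * (v p * F (toggle X p)))" for p
          by (simp only: distrib_left distrib_right mult.left_commute mult.assoc)
        then have "(\<Sum>p\<in>Q. e p * ((x * u p + y * v p) * F (toggle X p))) =
            x * (\<Sum>p\<in>Q. e p * (u p * F (toggle X p))) + y * (\<Sum>p\<in>Q. e p * (v p * F (toggle X p)))"
          by (simp only: sum.distrib sum_distrib_left)
        then show ?thesis unfolding 1 2 by (simp only: distrib_left mult.left_commute)
      qed
      also have "\<dots> = 0" using comb QR by (simp add: subset_iff)
      finally show ?thesis using S(2) by simp
    qed
    then show False using rows12[of x y] xy by blast
  qed
  then obtain i0 j0 where ij0: "i0 \<in> ?R" "j0 \<in> ?R" "u i0 * v j0 \<noteq> u j0 * v i0" by blast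
  then have "i0 \<noteq> j0" by auto
  \<comment> \<open>All three cases put the four positions in the cyclic order
    \<open>c, cc, i, j\<close>. It can be reached by exchanging the two indices, since that only
    changes the sign of the minor.\<close>
  have "\<exists>i j. i \<in> ?R \<and> j \<in> ?R \<and> u i * v j \<noteq> u j * v i \<and> (i < j \<and> j < c \<or> cc < i \<and> i < j \<or> j < c \<and> cc < i)"
  proof -
    have "(i0 < j0 \<and> j0 < c \<or> cc < i0 \<and> i0 < j0 \<or> j0 < c \<and> cc < i0) \<or>
       (j0 < i0 \<and> i0 < c \<or> cc < j0 \<and> j0 < i0 \<or> i0 < c \<and> cc < j0)"
      using ij0 \<open>i0 \<noteq> j0\<close> by (auto simp: cc_def)
    then show ?thesis using ij0 by metis
  qed
  then obtain i j where ij: "i \<in> ?R" "j \<in> ?R" "u i * v j \<noteq> u j * v i"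
    and ord: "i < j \<and> j < c \<or> cc < i \<and> i < j \<or> j < c \<and> cc < i" by blast
  let ?T = "toggle (toggle S i) j"
  have ne: "i \<noteq> j" "i \<noteq> c" "i \<noteq> cc" "j \<noteq> c" "j \<noteq> cc" "c \<noteq> cc" using ij ord by (auto simp: cc_def)
  have notin: "c \<notin> S" "cc \<notin> S" using S by auto
  \<comment> \<open>Chosen to differ in exactly the four positions, with each toggle producing a row
    and column set of the submatrix.\<close>
  let ?A = "insert c S" and ?B = "insert cc ?T"
  have D: "sym_diff ?A ?B = {c, cc, i, j}" using ne notin by auto
  have sub: "?A \<subseteq> {..<m}" "?B \<subseteq> {..<m}" using S ij c by (auto simp: cc_def)
  have t: "toggle ?A c = S" "toggle ?B c = insert c (insert cc ?T)"
    "toggle ?A cc = insert c (insert cc S)" "toggle ?B cc = ?T"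
    "toggle ?A i = insert c (toggle S i)" "toggle ?B i = insert cc (toggle S j)"
    "toggle ?A j = insert c (toggle S j)" "toggle ?B j = insert cc (toggle S i)"
    using ne notin by auto
  define sg where "sg p = ((-1) ^ card {q \<in> {c, cc, i, j}. q < p} :: complex)" for p
  have four: "(\<Sum>p\<in>{c, cc, i, j}. h p) = h c + (h cc + (h i + h j))" for h :: "nat \<Rightarrow> complex"
    using ne by simp
  have "(\<Sum>p\<in>{c, cc, i, j}. sg p * (F (toggle ?A p) * F (toggle ?B p))) = 0"
    using mgi[unfolded satisfies_mgi_def, rule_format, OF sub] unfolding D sg_def .
  then have eq: "sg c * (F S * F (insert c (insert cc ?T))) + (sg cc * (F (insert c (insert cc S)) * F ?T) +
      (sg i * (u i * v j) + sg j * (u j * v i))) = 0"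
    unfolding four t u_def v_def .
  have cd: "card {q \<in> {c, cc, i, j}. q < p} = (if c < p then 1 else 0) + ((if cc < p then 1 else 0) +
      ((if i < p then 1 else 0) + (if j < p then 1 else 0)))" for p
  proof -
    have "card {q \<in> {c, cc, i, j}. q < p} = (\<Sum>q\<in>{c, cc, i, j}. if q < p then 1 else 0)"
      unfolding card_eq_sum by (rule sum.inter_filter) simp
    also have "\<dots> = (if c < p then 1 else 0) + ((if cc < p then 1 else 0) +
      ((if i < p then 1 else 0) + (if j < p then 1 else 0)))"
      using ne by simp
    finally show ?thesis .
  qed
  \<comment> \<open>The signs alternate along the cycle \<open>c, cc, i, j\<close> wherever it is
    cut, because its length is even.\<close>
  have sg: "sg cc = - sg c" "sg j = - sg c" "sg i = sg c" "sg c \<noteq> 0"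
    using ord unfolding sg_def cd by (elim disjE; simp add: cc_def)+
  have "sg c * (F S * F (insert c (insert cc ?T)) - F (insert c (insert cc S)) * F ?T + (u i * v j - u j * v i)) = 0"
  proof -
    have "s * (A - B + (U - W)) = s * A + (- s * B + (s * U + - s * W))" for s A B U W :: complex
      by (simp add: algebra_simps)
    then show ?thesis using eq unfolding sg(1-3) by (simp only:)
  qed
  then have "F S * F (insert c (insert cc ?T)) - F (insert c (insert cc S)) * F ?T = - (u i * v j - u j * v i)"
    using sg(4) by (simp only: mult_eq_0_iff simp_thms eq_neg_iff_add_eq_0)
  with S ij ord show thesis by (intro that[of S i j]) (auto simp: u_def v_def)
qed

section \<open>Recognizers supported on four nodes\<close>

definition exact_covers :: "'v set set \<Rightarrow> 'v set \<Rightarrow> 'v set set set" where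
  "exact_covers E V = {M. M \<subseteq> E \<and> (\<forall>e\<in>M. e \<subseteq> V) \<and> (\<forall>v\<in>V. \<exists>!e. e \<in> M \<and> v \<in> e)}"

definition cover_sum :: "'v set set \<Rightarrow> ('v set \<Rightarrow> complex) \<Rightarrow> 'v set \<Rightarrow> complex" where
  "cover_sum E w V = (\<Sum>M\<in>exact_covers E V. prod w M)"

lemma matchings_eq_exact_covers:
  assumes "\<And>e. e \<in> E \<Longrightarrow> e \<subseteq> V"
  shows "matchings V E Z = exact_covers E (V - Z)"
proof -
  have e: "e \<in> E \<and> e \<inter> Z = {} \<longleftrightarrow> e \<in> E \<and> e \<subseteq> V - Z" for e
    using assms[of e] by blast
  have "M \<subseteq> {e \<in> E. e \<inter> Z = {}} \<longleftrightarrow> M \<subseteq> E \<and> (\<forall>e\<in>M. e \<subseteq> V - Z)" for M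
    unfolding e by auto
  then show ?thesis by (simp add: matchings_def exact_covers_def perfect_matching_def conj_assoc)
qed

text \<open>Perfect matchings are sorted by the partner of \<open>v\<close>, as in the expansion of
  a Pfaffian along a row but without signs.\<close>

lemma cover_sum_expand:
  assumes "finite E" and E2: "\<And>e. e \<in> E \<Longrightarrow> card e = 2" and "finite V" and v: "v \<in> V"
  shows "cover_sum E w V = (\<Sum>u\<in>V - {v}. if {v, u} \<in> E then w {v, u} * cover_sum E w (V - {v, u}) else 0)"
proof -
  define U where "U = {u \<in> V - {v}. {v, u} \<in> E}"
  have finU: "finite U" using \<open>finite V\<close> by (simp add: U_def)
  have finC: "finite (exact_covers E X)" for X
    by (rule finite_subset[of _ "Pow E"]) (auto simp: exact_covers_def \<open>finite E\<close>)
  have edge: "\<exists>u. e = {v, u} \<and> u \<noteq> v" if "e \<in> E" "v \<in> e" for e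
    using E2[OF that(1)] that(2) by (metis card_2_iff insertE insert_commute singletonD)
  define ins where "ins = (\<lambda>(u, M). insert {v, u} M)"
  have bij: "bij_betw ins (SIGMA u:U. exact_covers E (V - {v, u})) (exact_covers E V)"
  proof (rule bij_betw_imageI)
    show "inj_on ins (SIGMA u:U. exact_covers E (V - {v, u}))"
    proof
      fix x y assume x: "x \<in> (SIGMA u:U. exact_covers E (V - {v, u}))"
        and y: "y \<in> (SIGMA u:U. exact_covers E (V - {v, u}))" and eq: "ins x = ins y"
      obtain u M u' M' where xy: "x = (u, M)" "y = (u', M')" by (cases x, cases y)
      have M: "\<forall>e\<in>M. v \<notin> e" "\<forall>e\<in>M'. v \<notin> e" using x y xy by (auto simp: exact_covers_def)
      have "insert {v, u} M = insert {v, u'} M'" using eq by (simp add: xy ins_def)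
      moreover have "{e \<in> insert {v, u} M. v \<in> e} = {{v, u}}" "{e \<in> insert {v, u'} M'. v \<in> e} = {{v, u'}}"
        "{e \<in> insert {v, u} M. v \<notin> e} = M" "{e \<in> insert {v, u'} M'. v \<notin> e} = M'"
        using M by auto
      ultimately have "{{v, u}} = {{v, u'}}" "M = M'" by metis+
      then show "x = y" using xy by (auto simp: doubleton_eq_iff)
    qed
    show "ins ` (SIGMA u:U. exact_covers E (V - {v, u})) = exact_covers E V"
    proof (intro equalityI subsetI)
      fix N assume "N \<in> ins ` (SIGMA u:U. exact_covers E (V - {v, u}))"
      then obtain u M where u: "u \<in> U" and M: "M \<in> exact_covers E (V - {v, u})" and N: "N = insert {v, u} M"
        by (auto simp: ins_def)
      have sub: "\<And>e. e \<in> M \<Longrightarrow> e \<subseteq> V - {v, u}" using M by (auto simp: exact_covers_def)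
      have "\<exists>!e. e \<in> N \<and> x \<in> e" if x: "x \<in> V" for x
      proof (cases "x \<in> {v, u}")
        case True
        show ?thesis
          by (rule ex1I[of _ "{v, u}"]) (use True sub N in auto)
      next
        case False
        then have "\<exists>!e. e \<in> M \<and> x \<in> e" using M x by (auto simp: exact_covers_def)
        moreover have "e \<in> N \<and> x \<in> e \<longleftrightarrow> e \<in> M \<and> x \<in> e" for e using False N by auto
        ultimately show ?thesis by simp
      qed
      moreover have "N \<subseteq> E" "\<forall>e\<in>N. e \<subseteq> V" using M u v N by (auto simp: exact_covers_def U_def)
      ultimately show "N \<in> exact_covers E V" by (simp add: exact_covers_def)
    next
      fix N assume N: "N \<in> exact_covers E V"
      then obtain e where e: "e \<in> N" "v \<in> e" using v by (auto simp: exact_covers_def)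
      then obtain u where u: "e = {v, u}" "u \<noteq> v" using edge[of e] N by (auto simp: exact_covers_def)
      have uV: "u \<in> V" using e u N by (auto simp: exact_covers_def)
      have un: "e' = e" if "e' \<in> N" "x \<in> e'" "x \<in> {v, u}" for e' x
      proof -
        have "x \<in> V" "x \<in> e" using that uV v u by auto
        then have "\<exists>!d. d \<in> N \<and> x \<in> d" using N by (auto simp: exact_covers_def)
        then show ?thesis using that(1,2) e(1) \<open>x \<in> e\<close> by blast
      qed
      have sub: "d \<subseteq> V - {v, u}" if "d \<in> N - {e}" for d
        using that un[of d] N by (auto simp: exact_covers_def)
      have ex: "\<exists>!d. d \<in> N - {e} \<and> x \<in> d" if "x \<in> V - {v, u}" for x
      proof -
        have "\<exists>!d. d \<in> N \<and> x \<in> d" using N that by (auto simp: exact_covers_def)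
        moreover have "d \<in> N - {e} \<and> x \<in> d \<longleftrightarrow> d \<in> N \<and> x \<in> d" for d using that u by auto
        ultimately show ?thesis by simp
      qed
      have "N - {e} \<subseteq> E" using N by (auto simp: exact_covers_def)
      with sub ex have "N - {e} \<in> exact_covers E (V - {v, u})" by (simp add: exact_covers_def)
      moreover have "u \<in> U" using u e N uV by (auto simp: U_def exact_covers_def)
      moreover have "N = ins (u, N - {e})" using e u by (auto simp: ins_def)
      ultimately show "N \<in> ins ` (SIGMA u:U. exact_covers E (V - {v, u}))" by blast
    qed
  qed
  have "cover_sum E w V = (\<Sum>x\<in>(SIGMA u:U. exact_covers E (V - {v, u})). prod w (ins x))"
    unfolding cover_sum_def by (rule sum.reindex_bij_betw[OF bij, symmetric])
  also have "\<dots> = (\<Sum>x\<in>(SIGMA u:U. exact_covers E (V - {v, u})). case x of (u, M) \<Rightarrow> w {v, u} * prod w M)"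
  proof (rule sum.cong[OF refl])
    fix x assume "x \<in> (SIGMA u:U. exact_covers E (V - {v, u}))"
    then obtain u M where x: "x = (u, M)" "M \<in> exact_covers E (V - {v, u})" by auto
    then have "{v, u} \<notin> M" "finite M" using finite_subset[OF _ \<open>finite E\<close>] by (auto simp: exact_covers_def)
    then show "prod w (ins x) = (case x of (u, M) \<Rightarrow> w {v, u} * prod w M)" by (simp add: x ins_def)
  qed
  also have "\<dots> = (\<Sum>u\<in>U. \<Sum>M\<in>exact_covers E (V - {v, u}). w {v, u} * prod w M)"
    by (rule sum.Sigma[symmetric]) (use finU finC in auto)
  also have "\<dots> = (\<Sum>u\<in>U. w {v, u} * cover_sum E w (V - {v, u}))"
    by (simp add: cover_sum_def sum_distrib_left)
  also have "\<dots> = (\<Sum>u\<in>V - {v}. if {v, u} \<in> E then w {v, u} * cover_sum E w (V - {v, u}) else 0)"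
    unfolding U_def using \<open>finite V\<close> by (intro sum.inter_filter) auto
  finally show ?thesis .
qed

lemma cover_sum_empty:
  assumes "{} \<notin> E"
  shows "cover_sum E w {} = 1"
proof -
  have "exact_covers E {} = {{}}" using assms by (auto simp: exact_covers_def)
  then show ?thesis by (simp add: cover_sum_def)
qed

lemma cover_sum_isolated:
  assumes "v \<in> V" "\<And>e. e \<in> E \<Longrightarrow> v \<in> e \<Longrightarrow> \<not> e \<subseteq> V"
  shows "cover_sum E w V = 0"
proof -
  have "M \<notin> exact_covers E V" for M
  proof
    assume M: "M \<in> exact_covers E V"
    then obtain e where "e \<in> M" "v \<in> e" using \<open>v \<in> V\<close> unfolding exact_covers_def by blast
    then show False using M assms(2)[of e] unfolding exact_covers_def by blast
  qed
  then have "exact_covers E V = {}" by blast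
  then show ?thesis by (simp add: cover_sum_def)
qed

lemma cover_sum_leaf:
  assumes "finite E" "\<And>e. e \<in> E \<Longrightarrow> card e = 2" "finite V" and x: "x \<in> V"
    and k: "k \<in> V" "k \<noteq> x" "{x, k} \<in> E" and leaf: "\<And>u. {x, u} \<in> E \<Longrightarrow> u = k"
  shows "cover_sum E w V = w {x, k} * cover_sum E w (V - {x, k})"
proof -
  have "cover_sum E w V = (\<Sum>u\<in>V - {x}. if {x, u} \<in> E then w {x, u} * cover_sum E w (V - {x, u}) else 0)"
    using assms(2) by (intro cover_sum_expand \<open>finite E\<close> \<open>finite V\<close> x)
  also have "\<dots> = (\<Sum>u\<in>V - {x}. if u = k then w {x, k} * cover_sum E w (V - {x, k}) else 0)"
  proof (rule sum.cong[OF refl])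
    fix u
    have "u \<noteq> k \<Longrightarrow> {x, u} \<notin> E" using leaf by blast
    then show "(if {x, u} \<in> E then w {x, u} * cover_sum E w (V - {x, u}) else 0) =
        (if u = k then w {x, k} * cover_sum E w (V - {x, k}) else 0)"
      using k(3) by (cases "u = k") simp_all
  qed
  also have "\<dots> = w {x, k} * cover_sum E w (V - {x, k})"
    using k(1,2) \<open>finite V\<close> by simp
  finally show ?thesis .
qed

text \<open>With weight 0 for missing edges, \<open>cover_sum\<close> is the hafnian of a symmetric
  matrix and can be evaluated without case distinctions on the edges.\<close>

definition pair_weight :: "'v set set \<Rightarrow> ('v set \<Rightarrow> complex) \<Rightarrow> 'v \<Rightarrow> 'v \<Rightarrow> complex" where
  "pair_weight E w u v = (if {u, v} \<in> E then w {u, v} else 0)"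

context
  fixes E :: "'v set set" and w :: "'v set \<Rightarrow> complex"
  assumes finE: "finite E" and E2: "\<And>e. e \<in> E \<Longrightarrow> card e = 2"
begin

lemma cover_sum_expand_pair:
  assumes "finite V" "v \<in> V"
  shows "cover_sum E w V = (\<Sum>u\<in>V - {v}. pair_weight E w v u * cover_sum E w (V - {v, u}))"
  by (rule trans[OF cover_sum_expand[OF finE E2 assms] sum.cong[OF refl]])
    (simp_all add: pair_weight_def)

lemma cover_sum_odd:
  assumes "finite V" "odd (card V)"
  shows "cover_sum E w V = 0"
  using assms
proof (induction "card V" arbitrary: V rule: less_induct)
  case less
  then obtain v where v: "v \<in> V" by (metis card.empty equals0I even_zero)
  have "cover_sum E w (V - {v, u}) = 0" if u: "u \<in> V - {v}" for u
  proof -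
    have "{v, u} \<subseteq> V" "card {v, u} = 2" using u v by auto
    then have "card (V - {v, u}) = card V - 2" "2 \<le> card V"
      using less.prems(1) card_mono[of V "{v, u}"] by (auto simp: card_Diff_subset)
    then show ?thesis using less by (intro less.hyps) auto
  qed
  then show ?case unfolding cover_sum_expand_pair[OF less.prems(1) v] by simp
qed

lemma cover_sum_0: "cover_sum E w {} = 1"
  using E2 by (intro cover_sum_empty) force

lemma cover_sum_2:
  assumes "x \<noteq> y"
  shows "cover_sum E w {x, y} = pair_weight E w x y"
proof -
  have "{x, y} - {x} = {y}" using assms by auto
  then show ?thesis using cover_sum_expand_pair[of "{x, y}" x] by (simp add: cover_sum_0)
qed

lemma cover_sum_4:
  assumes "distinct [x, y, z, t]"
  shows "cover_sum E w {x, y, z, t} = pair_weight E w x y * pair_weight E w z t +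
    pair_weight E w x z * pair_weight E w y t + pair_weight E w x t * pair_weight E w y z"
proof -
  have "{x, y, z, t} - {x} = {y, z, t}" "{x, y, z, t} - {x, y} = {z, t}"
    "{x, y, z, t} - {x, z} = {y, t}" "{x, y, z, t} - {x, t} = {y, z}" using assms by auto
  then show ?thesis using cover_sum_expand_pair[of "{x, y, z, t}" x] assms by (simp add: cover_sum_2)
qed

lemma cover_sum_6:
  assumes "distinct [x, y, z, t, r, s]"
  shows "cover_sum E w {x, y, z, t, r, s} =
    pair_weight E w x y * cover_sum E w {z, t, r, s} +
    pair_weight E w x z * cover_sum E w {y, t, r, s} +
    pair_weight E w x t * cover_sum E w {y, z, r, s} +
    pair_weight E w x r * cover_sum E w {y, z, t, s} +
    pair_weight E w x s * cover_sum E w {y, z, t, r}"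
proof -
  let ?V = "{x, y, z, t, r, s}"
  have "?V - {x} = {y, z, t, r, s}" "?V - {x, y} = {z, t, r, s}" "?V - {x, z} = {y, t, r, s}"
    "?V - {x, t} = {y, z, r, s}" "?V - {x, r} = {y, z, t, s}" "?V - {x, s} = {y, z, t, r}"
    using assms by auto
  then show ?thesis using cover_sum_expand_pair[of ?V x] assms by simp
qed

text \<open>Every leaf forces its only edge, which has weight 1; the forced pairs are stripped off
  one at a time.\<close>

lemma cover_sum_leaves:
  assumes "finite A" "finite B"
    and "inj_on x A" "x ` A \<inter> A = {}" "B \<inter> (A \<union> x ` A) = {}"
    and "\<And>k. k \<in> A \<Longrightarrow> {x k, k} \<in> E \<and> w {x k, k} = 1" "\<And>k u. k \<in> A \<Longrightarrow> {x k, u} \<in> E \<Longrightarrow> u = k"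
  shows "cover_sum E w (B \<union> A \<union> x ` A) = cover_sum E w B"
  using assms(1,3-)
proof (induction A rule: finite_induct)
  case (insert k A)
  let ?V = "B \<union> insert k A \<union> x ` insert k A"
  have kx: "x k \<noteq> k" "k \<notin> x ` A" "x k \<notin> A" "x k \<notin> x ` A" "k \<notin> B" "x k \<notin> B"
    using insert.prems insert.hyps by (auto simp: inj_on_def)
  have "cover_sum E w ?V = w {x k, k} * cover_sum E w (?V - {x k, k})"
    by (rule cover_sum_leaf[OF finE E2]) (use insert.prems(4,5) insert.hyps(1) assms(2) kx in auto)
  also have "?V - {x k, k} = B \<union> A \<union> x ` A" using kx insert.hyps by auto
  also have "cover_sum E w (B \<union> A \<union> x ` A) = cover_sum E w B"
    by (rule insert.IH) (use insert.prems in auto)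
  finally show ?case using insert.prems(4)[of k] by simp
qed simp

end

text \<open>The gate consists of core nodes \<open>k < m\<close>, pendant nodes \<open>m + k\<close> and two inner nodes
  \<open>p\<close>, \<open>q\<close>. A bit \<open>k \<in> \<rho>\<close> has its core node as external node, any other bit the pendant
  node: either way the core node is left to the core edges exactly if \<open>k\<close> lies in the
  symmetric difference \<open>Y\<close> of the removed set and \<open>\<rho>\<close>. The core edges are the 4-cycle
  \<open>a b c d\<close> and, inside it, the tree \<open>{a, b} - p - q - {c, d}\<close>, with weights making the
  matching sum over \<open>Y \<union> {p, q}\<close> equal to \<open>\<phi> Y\<close>.\<close>

locale gadget =
  fixes m a b c d :: nat and \<rho> :: "nat set" and \<phi> :: "nat set \<Rightarrow> complex"
  assumes ord: "a < b" "b < c" "c < d" "d < m"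
    and \<rho>: "\<rho> \<subseteq> {..<m}"
    and \<phi>_nz: "\<phi> {} \<noteq> 0"
    and \<phi>_odd: "\<And>Y. Y \<subseteq> {a, b, c, d} \<Longrightarrow> odd (card Y) \<Longrightarrow> \<phi> Y = 0"
    and \<phi>_rel: "\<phi> {} * \<phi> {a, b, c, d} + \<phi> {a, c} * \<phi> {b, d} = \<phi> {a, b} * \<phi> {c, d} + \<phi> {a, d} * \<phi> {b, c}"
begin

definition "p = 2 * m"
definition "q = 2 * m + 1"

definition "core_edges = {{a, p}, {b, p}, {p, q}, {c, q}, {d, q}, {a, b}, {b, c}, {c, d}, {a, d}}"
definition "pendant_edges = (\<lambda>k. {k, m + k}) ` ({..<m} - \<rho>)"
definition "gverts = {..<m} \<union> (\<lambda>k. m + k) ` ({..<m} - \<rho>) \<union> {p, q}"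
definition "gedges = core_edges \<union> pendant_edges"
definition "gext k = (if k \<in> \<rho> then k else m + k)"

text \<open>Solved from the two-element sets. A diagonal pair is matched only through
  \<open>p\<close> and \<open>q\<close>, so with \<open>{b, p}\<close> and \<open>{c, q}\<close> of
  weight 1 the other two spokes carry \<open>\<phi> {a, c}\<close> and \<open>\<phi> {b, d}\<close>.
  The same detour contributes 1 to \<open>{b, c}\<close> and
  \<open>\<phi> {a, c} * \<phi> {b, d}\<close> to \<open>{a, d}\<close>; the edges of the 4-cycle
  supply the remainder, divided by the weight \<open>\<phi> {}\<close> of
  \<open>{p, q}\<close>.\<close>

definition gweight :: "nat set \<Rightarrow> complex" where
  "gweight e = (if e = {a, p} then \<phi> {a, c} else if e = {p, q} then \<phi> {}
     else if e = {d, q} then \<phi> {b, d} else if e = {a, b} then \<phi> {a, b} / \<phi> {}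
     else if e = {b, c} then (\<phi> {b, c} - 1) / \<phi> {} else if e = {c, d} then \<phi> {c, d} / \<phi> {}
     else if e = {a, d} then (\<phi> {a, d} - \<phi> {a, c} * \<phi> {b, d}) / \<phi> {} else 1)"

definition gate :: "nat matchgate" where
  "gate = \<lparr>verts = gverts, edges = gedges, weight = gweight, exts = map gext [0..<m],
     inputs = gext ` {..<m}, outputs = {}\<rparr>"

lemma dist: "distinct [a, b, c, d, p, q]"
  using ord by (auto simp: p_def q_def)

lemma gedges_finite: "finite gedges" and gedges_card: "e \<in> gedges \<Longrightarrow> card e = 2"
  and gedges_sub: "e \<in> gedges \<Longrightarrow> e \<subseteq> gverts"
  using ord by (auto simp: gedges_def core_edges_def pendant_edges_def gverts_def card_insert_if p_def q_def)

lemma in_pendant: "{u, v} \<in> pendant_edges \<longleftrightarrow> (\<exists>k<m. k \<notin> \<rho> \<and> (u = k \<and> v = m + k \<or> v = k \<and> u = m + k))"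
  by (auto simp: pendant_edges_def doubleton_eq_iff)

lemma core_pair_not_pendant:
  assumes "u < m \<or> 2 * m \<le> u" "v < m \<or> 2 * m \<le> v"
  shows "{u, v} \<notin> pendant_edges"
  using assms by (auto simp: in_pendant)

abbreviation "pw \<equiv> pair_weight gedges gweight"

lemma pw_core:
  "pw a p = \<phi> {a, c}" "pw b p = 1" "pw p q = \<phi> {}" "pw c q = 1" "pw d q = \<phi> {b, d}"
  "pw a b = \<phi> {a, b} / \<phi> {}" "pw b c = (\<phi> {b, c} - 1) / \<phi> {}" "pw c d = \<phi> {c, d} / \<phi> {}"
  "pw a d = (\<phi> {a, d} - \<phi> {a, c} * \<phi> {b, d}) / \<phi> {}"
  "pw a c = 0" "pw b d = 0" "pw a q = 0" "pw b q = 0" "pw c p = 0" "pw d p = 0"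
  using ord core_pair_not_pendant
  by (auto simp: pair_weight_def gedges_def core_edges_def gweight_def doubleton_eq_iff p_def q_def)

lemmas cs2 = cover_sum_2[OF gedges_finite gedges_card]
lemmas cs4 = cover_sum_4[OF gedges_finite gedges_card]
lemmas cs6 = cover_sum_6[OF gedges_finite gedges_card]

lemma cover_sum_core:
  assumes Y: "Y \<subseteq> {a, b, c, d}"
  shows "cover_sum gedges gweight (Y \<union> {p, q}) = \<phi> Y"
proof (cases "odd (card Y)")
  case True
  have fin: "finite Y" using Y finite_subset by blast
  have "p \<notin> Y" "q \<notin> Y" "p \<noteq> q" using Y dist by auto
  then have "card (Y \<union> {p, q}) = card Y + 2" using fin by simp
  then have "odd (card (Y \<union> {p, q}))" using True by simp
  then have "cover_sum gedges gweight (Y \<union> {p, q}) = 0"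
    using fin by (intro cover_sum_odd[OF gedges_finite gedges_card]) auto
  then show ?thesis using \<phi>_odd[OF Y True] by simp
next
  case False
  \<comment> \<open>The weights are already fixed by the smaller sets; \<open>\<phi>_rel\<close> is
    precisely the condition that the full set comes out right.\<close>
  have six: "cover_sum gedges gweight {a, b, c, d, p, q} = \<phi> {a, b, c, d}"
  proof -
    have "cover_sum gedges gweight {a, b, c, d, p, q} =
        \<phi> {a, b} * \<phi> {c, d} / \<phi> {} + (\<phi> {a, d} * \<phi> {b, c} - \<phi> {a, c} * \<phi> {b, d}) / \<phi> {}"
      using dist \<phi>_nz by (simp add: cs6 cs4 pw_core) (simp add: field_simps)
    also have "\<dots> = \<phi> {a, b, c, d}" using \<phi>_rel \<phi>_nz by (simp add: field_simps)
    finally show ?thesis .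
  qed
  have two: "cover_sum gedges gweight {p, q} = \<phi> {}" using cs2[of p q gweight] dist by (simp add: pw_core)
  have four: "cover_sum gedges gweight {a, b, p, q} = \<phi> {a, b}"
    "cover_sum gedges gweight {a, c, p, q} = \<phi> {a, c}"
    "cover_sum gedges gweight {a, d, p, q} = \<phi> {a, d}"
    "cover_sum gedges gweight {b, c, p, q} = \<phi> {b, c}"
    "cover_sum gedges gweight {b, d, p, q} = \<phi> {b, d}"
    "cover_sum gedges gweight {c, d, p, q} = \<phi> {c, d}"
    using dist \<phi>_nz by (simp_all add: cs4 pw_core)
  have "Y \<in> {{}, {a, b}, {a, c}, {a, d}, {b, c}, {b, d}, {c, d}, {a, b, c, d}}"
  proof -
    have "Y = (if a \<in> Y then {a} else {}) \<union> (if b \<in> Y then {b} else {}) \<union>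
        (if c \<in> Y then {c} else {}) \<union> (if d \<in> Y then {d} else {})"
      using Y by auto
    then obtain A B C D :: bool where "Y = (if A then {a} else {}) \<union> (if B then {b} else {}) \<union>
        (if C then {c} else {}) \<union> (if D then {d} else {})"
      by blast
    then show ?thesis using False dist by (cases A; cases B; cases C; cases D; auto simp: insert_commute card_insert_if)
  qed
  then show ?thesis
    by (elim insertE emptyE) (simp_all only: Un_insert_left Un_empty_left six two four)
qed

theorem removal_signature_gate:
  assumes S: "S \<subseteq> {..<m}"
  shows "removal_signature gate S =
    (if sym_diff S \<rho> \<subseteq> {a, b, c, d} then \<phi> (sym_diff S \<rho>) else 0)"
proof -
  define Y where "Y = sym_diff S \<rho>"
  define A where "A = {..<m} - \<rho> - S"
  define B where "B = Y \<union> {p, q}"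
  have Ym: "Y \<subseteq> {..<m}" using S \<rho> by (auto simp: Y_def)
  have Z: "(!) (exts gate) ` S = gext ` S" using S by (intro image_cong) (auto simp: gate_def)
  \<comment> \<open>What is left: the core nodes in \<open>Y\<close>, the inner nodes, and for
    \<open>k \<in> A\<close> a core node together with its pendant node.\<close>
  have V: "gverts - gext ` S = B \<union> A \<union> (+) m ` A"
  proof (rule Set.set_eqI)
    fix v
    consider "v < m" | k where "v = m + k" "k < m" | "2 * m \<le> v"
      by (metis add.commute add_less_cancel_right less_eqE linorder_not_less mult_2)
    then show "v \<in> gverts - gext ` S \<longleftrightarrow> v \<in> B \<union> A \<union> (+) m ` A"
      using S \<rho> by cases (auto simp: gverts_def gext_def B_def A_def Y_def image_iff p_def q_def)
  qed
  have "removal_signature gate S = cover_sum gedges gweight (gverts - gext ` S)"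
    unfolding removal_signature_eq Z cover_sum_def
    using matchings_eq_exact_covers[OF gedges_sub] by (simp add: gate_def)
  also have "\<dots> = cover_sum gedges gweight B"
    unfolding V
  proof (rule cover_sum_leaves[OF gedges_finite gedges_card])
    show "B \<inter> (A \<union> (+) m ` A) = {}" using Ym by (auto simp: A_def B_def Y_def p_def q_def)
    fix k assume k: "k \<in> A"
    then have km: "k < m" "k \<notin> \<rho>" by (auto simp: A_def)
    show "{m + k, k} \<in> gedges \<and> gweight {m + k, k} = 1"
      using km ord by (auto simp: gedges_def in_pendant gweight_def doubleton_eq_iff p_def q_def)
    show "u = k" if "{m + k, u} \<in> gedges" for u
      using that km ord by (auto simp: gedges_def core_edges_def in_pendant doubleton_eq_iff p_def q_def)
  qed (use Ym in \<open>auto simp: A_def B_def finite_subset\<close>)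
  also have "\<dots> = (if Y \<subseteq> {a, b, c, d} then \<phi> Y else 0)"
  proof (cases "Y \<subseteq> {a, b, c, d}")
    case True
    then show ?thesis using cover_sum_core[OF True] by (simp add: B_def)
  next
    \<comment> \<open>A core node other than \<open>a, b, c, d\<close> can only be matched with its
      pendant node, and that is absent for \<open>k \<in> Y\<close>.\<close>
    case False
    then obtain k where k: "k \<in> Y" "k \<notin> {a, b, c, d}" by blast
    then have km: "k < m" using Ym by auto
    have "cover_sum gedges gweight B = 0"
    proof (rule cover_sum_isolated)
      show "k \<in> B" using k by (simp add: B_def)
      fix e assume e: "e \<in> gedges" "k \<in> e"
      then have "e = {k, m + k}" using k km ord by (auto simp: gedges_def core_edges_def pendant_edges_def p_def q_def)
      moreover have "m + k \<notin> B" using km Ym by (auto simp: B_def p_def q_def)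
      ultimately show "\<not> e \<subseteq> B" by auto
    qed
    then show ?thesis using False by simp
  qed
  finally show ?thesis by (simp add: Y_def)
qed

end

text \<open>In quarter turns, a piecewise linear function takes the values 0, 1, 2, 3 at
  \<open>a, b, c, d\<close>, so the core can be drawn in fixed coordinates. The slope 1 / (4 m) at
  both ends keeps all values between -1/4 and 13/4, within less than a full turn.\<close>

lemma exists_angles:
  fixes a b c d m :: nat
  assumes ord: "a < b" "b < c" "c < d" "d < m"
  obtains \<theta> :: "nat \<Rightarrow> real" where "\<theta> a = 0" "\<theta> b = pi / 2" "\<theta> c = pi" "\<theta> d = 3 * pi / 2"
    "\<And>i j. i < j \<Longrightarrow> j < m \<Longrightarrow> \<theta> i < \<theta> j \<and> \<theta> j < \<theta> i + 2 * pi"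
proof -
  define g :: "nat \<Rightarrow> real" where
    "g k = (if k \<le> a then (real k - real a) / (4 * real m)
       else if k \<le> b then (real k - real a) / (real b - real a)
       else if k \<le> c then 1 + (real k - real b) / (real c - real b)
       else if k \<le> d then 2 + (real k - real c) / (real d - real c)
       else 3 + (real k - real d) / (4 * real m))" for k
  have vals: "g a = 0" "g b = 1" "g c = 2" "g d = 3" using ord by (auto simp: g_def)
  have lin: "(x - y) / z < (real (Suc k) - y) / z" if "x = real k" "0 < z" for k x y z
    using that by (simp add: divide_strict_right_mono)
  have step: "g k < g (Suc k)" for k
  proof -
    consider "k < a" | "a \<le> k" "k < b" | "b \<le> k" "k < c" | "c \<le> k" "k < d" | "d \<le> k" by linarith
    then show ?thesis
    proof cases
      case 1
      then show ?thesis using ord by (simp add: g_def divide_strict_right_mono)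
    next
      case 2
      then have "g k = (real k - real a) / (real b - real a)" "g (Suc k) = (real (Suc k) - real a) / (real b - real a)"
        using ord by (auto simp: g_def)
      then show ?thesis using lin[of "real k" k "real b - real a" "real a"] ord by simp
    next
      case 3
      then have "g k = 1 + (real k - real b) / (real c - real b)" "g (Suc k) = 1 + (real (Suc k) - real b) / (real c - real b)"
        using ord by (auto simp: g_def)
      then show ?thesis using lin[of "real k" k "real c - real b" "real b"] ord by simp
    next
      case 4
      then have "g k = 2 + (real k - real c) / (real d - real c)" "g (Suc k) = 2 + (real (Suc k) - real c) / (real d - real c)"
        using ord by (auto simp: g_def)
      then show ?thesis using lin[of "real k" k "real d - real c" "real c"] ord by simp
    next
      case 5
      then have "g k = 3 + (real k - real d) / (4 * real m)" "g (Suc k) = 3 + (real (Suc k) - real d) / (4 * real m)"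
        using ord by (auto simp: g_def)
      then show ?thesis using lin[of "real k" k "4 * real m" "real d"] ord by simp
    qed
  qed
  have mono: "g i < g j" if "i < j" for i j using lift_Suc_mono_less[of g, OF step that] .
  have mle: "g i \<le> g j" if "i \<le> j" for i j using mono[of i j] that by (cases "i = j") auto
  have low: "- 1 / 4 \<le> g k" for k
  proof -
    have "g 0 = - (real a / (4 * real m))" by (simp add: g_def)
    moreover have "real a / (4 * real m) \<le> 1 / 4" using ord by (simp add: field_simps)
    ultimately show ?thesis using mle[of 0 k] by simp
  qed
  have up: "g k \<le> 13 / 4" if "k < m" for k
  proof -
    have "g k \<le> g m" using mle that by simp
    also have "g m = 3 + (real m - real d) / (4 * real m)" using ord by (auto simp: g_def)
    also have "\<dots> \<le> 13 / 4" using ord by (simp add: field_simps)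
    finally show ?thesis .
  qed
  show thesis
  proof (rule that[of "\<lambda>k. g k * (pi / 2)"])
    fix i j :: nat assume ij: "i < j" "j < m"
    have "g j < g i + 4" using low[of i] up[OF ij(2)] by simp
    then have "g j * (pi / 2) < (g i + 4) * (pi / 2)" by (intro mult_strict_right_mono) auto
    then show "g i * (pi / 2) < g j * (pi / 2) \<and> g j * (pi / 2) < g i * (pi / 2) + 2 * pi"
      using mono[OF ij(1)] by (simp add: algebra_simps)
  qed (use vals in auto)
qed

text \<open>Linear descriptions, in the coordinates \<open>x + \<i> y\<close>, of the nine straight core edges.\<close>

definition core_con :: "nat \<Rightarrow> real \<Rightarrow> real \<Rightarrow> bool" where
  "core_con i x y \<longleftrightarrow>
     i = 0 \<and> x + 3 * y = 1 \<and> 0 \<le> y \<and> y \<le> 1 / 4 \<or>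
     i = 1 \<and> 3 * x + y = 1 \<and> 0 \<le> x \<and> x \<le> 1 / 4 \<or>
     i = 2 \<and> x = y \<and> -1 / 4 \<le> x \<and> x \<le> 1 / 4 \<or>
     i = 3 \<and> x + 3 * y = -1 \<and> -1 / 4 \<le> y \<and> y \<le> 0 \<or>
     i = 4 \<and> 3 * x + y = -1 \<and> -1 / 4 \<le> x \<and> x \<le> 0 \<or>
     i = 5 \<and> x + y = 1 \<and> 0 \<le> x \<and> 0 \<le> y \<or>
     i = 6 \<and> y - x = 1 \<and> x \<le> 0 \<and> 0 \<le> y \<or>
     i = 7 \<and> x + y = -1 \<and> x \<le> 0 \<and> y \<le> 0 \<or>
     i = 8 \<and> x - y = 1 \<and> 0 \<le> x \<and> y \<le> 0"

text \<open>For two different edges the linear constraints are contradictory or force one of the six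
  node positions, which the alternatives of the proof try in turn.\<close>

lemma core_con_meet:
  assumes "core_con i x y" "core_con j x y" "i \<noteq> j"
  shows "x = 1 \<and> y = 0 \<or> x = 0 \<and> y = 1 \<or> x = -1 \<and> y = 0 \<or> x = 0 \<and> y = -1 \<or>
    x = 1 / 4 \<and> y = 1 / 4 \<or> x = -1 / 4 \<and> y = -1 / 4"
  using assms unfolding core_con_def
  by (elim disjE)
    ((elim conjE, rule FalseE, linarith)
    | (elim conjE, rule disjI1, rule conjI, linarith, linarith)
    | (elim conjE, rule disjI2, rule disjI1, rule conjI, linarith, linarith)
    | (elim conjE, rule disjI2, rule disjI2, rule disjI1, rule conjI, linarith, linarith)
    | (elim conjE, rule disjI2, rule disjI2, rule disjI2, rule disjI1, rule conjI, linarith, linarith)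
    | (elim conjE, rule disjI2, rule disjI2, rule disjI2, rule disjI2, rule disjI1, rule conjI, linarith, linarith)
    | (elim conjE, rule disjI2, rule disjI2, rule disjI2, rule disjI2, rule disjI2, rule conjI, linarith, linarith))+

lemma core_con_diamond: "core_con i x y \<Longrightarrow> \<bar>x\<bar> + \<bar>y\<bar> \<le> 1"
  unfolding core_con_def by (elim disjE; elim conjE; linarith)
section \<open>The drawing of the gadget\<close>

lemma cis_eq_imp_eq:
  assumes "cis x = cis y" "\<bar>x - y\<bar> < 2 * pi"
  shows "x = y"
proof (rule ccontr)
  assume "x \<noteq> y"
  define u where "u = \<bar>x - y\<bar> / 2"
  have u: "0 < u" "u < pi" using assms(2) \<open>x \<noteq> y\<close> by (auto simp: u_def)
  have "cos x = cos y" "sin x = sin y" using assms(1) by (auto simp: complex_eq_iff)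
  then have "cos (x - y) = 1" by (simp add: cos_diff power2_eq_square[symmetric])
  then have "cos (2 * u) = 1" by (auto simp: u_def abs_if cos_minus[of "x - y", symmetric])
  then have "sin u = 0" unfolding cos_double_sin by simp
  then show False using sin_gt_zero[OF u] by simp
qed

text \<open>The part of the ray beyond \<open>s0\<close> is connected, unbounded and disjoint from
  \<open>D\<close>, hence lies in an unbounded component of the complement.\<close>

lemma ray_in_outside:
  fixes D :: "complex set"
  assumes "\<And>s. s0 < s \<Longrightarrow> rcis s t \<notin> D" "s0 < s"
  shows "rcis s t \<in> outside D"
proof -
  define T where "T = (\<lambda>s. rcis s t) ` {s0<..}"
  have "continuous_on {s0<..} (\<lambda>s. rcis s t)" unfolding rcis_def by (intro continuous_intros)
  then have "connected T" unfolding T_def by (intro connected_continuous_image) auto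
  moreover have "T \<subseteq> - D" using assms(1) by (auto simp: T_def)
  moreover have "rcis s t \<in> T" using assms(2) by (auto simp: T_def)
  ultimately have sub: "T \<subseteq> connected_component_set (- D) (rcis s t)"
    by (intro connected_component_maximal)
  have "\<not> bounded T"
  proof
    assume "bounded T"
    then obtain B where B: "\<And>z. z \<in> T \<Longrightarrow> norm z \<le> B" by (auto simp: bounded_iff)
    have "rcis (max s0 \<bar>B\<bar> + 1) t \<in> T" by (auto simp: T_def)
    from B[OF this] show False by simp
  qed
  then show ?thesis using sub bounded_subset unfolding outside by blast
qed

text \<open>The special core nodes sit at \<open>1, \<i>, -1, -\<i>\<close>, the other core nodes on the circle of radius 2,
  the pendant nodes on the circle of radius 3. Pendant edges and dangling edges are radial,
  while the core edges stay in the closed unit disc and touch its boundary only in special nodes.\<close>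

locale gadget_drawing = gadget +
  fixes \<theta> :: "nat \<Rightarrow> real"
  assumes th_val: "\<theta> a = 0" "\<theta> b = pi / 2" "\<theta> c = pi" "\<theta> d = 3 * pi / 2"
    and th_less: "\<And>i j. i < j \<Longrightarrow> j < m \<Longrightarrow> \<theta> i < \<theta> j \<and> \<theta> j < \<theta> i + 2 * pi"
begin

definition crad :: "nat \<Rightarrow> real" where
  "crad k = (if k \<in> {a, b, c, d} then 1 else 2)"

definition pos :: "nat \<Rightarrow> complex" where
  "pos v = (if v < m then rcis (crad v) (\<theta> v) else if v < 2 * m then rcis 3 (\<theta> (v - m))
     else if v = p then Complex (1 / 4) (1 / 4) else Complex (-1 / 4) (-1 / 4))"

text \<open>An edge is an unordered pair, so \<open>Min\<close> and \<open>Max\<close> select a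
  direction for its segment.\<close>

definition arc_of :: "nat set \<Rightarrow> real \<Rightarrow> complex" where
  "arc_of e = linepath (pos (Min e)) (pos (Max e))"

text \<open>Radius of the external node for bit \<open>k\<close>; beyond it the ray at angle
  \<open>\<theta> k\<close> is free of the drawing.\<close>

definition erad :: "nat \<Rightarrow> real" where
  "erad k = (if k \<in> \<rho> then crad k else 3)"

lemma crad_bounds: "1 \<le> crad k" "crad k \<le> 2" "0 < crad k" by (auto simp: crad_def)
lemma erad_bounds: "1 \<le> erad k" "erad k \<le> 3" "crad k \<le> erad k" by (auto simp: erad_def crad_def)

text \<open>Different indices below \<open>m\<close> have different angles less than a full turn
  apart, so their rays meet only at the origin. The disjointness of radial pieces rests on
  this.\<close>

lemma polar_unique:
  assumes "rcis s (\<theta> i) = rcis s' (\<theta> j)" "0 < s" "0 < s'" "i < m" "j < m"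
  shows "s = s'" "i = j"
proof -
  have "norm (rcis s (\<theta> i)) = norm (rcis s' (\<theta> j))" using assms(1) by simp
  then show s: "s = s'" using assms(2,3) by simp
  then have "cis (\<theta> i) = cis (\<theta> j)" using assms(1,2) by (simp add: rcis_def)
  moreover have "\<bar>\<theta> i - \<theta> j\<bar> < 2 * pi"
    using th_less[of i j] th_less[of j i] assms(4,5) by (cases i j rule: linorder_cases) auto
  ultimately have "\<theta> i = \<theta> j" by (rule cis_eq_imp_eq)
  then show "i = j" using th_less[of i j] th_less[of j i] assms(4,5) by (cases i j rule: linorder_cases) auto
qed

lemma pos_core: "k < m \<Longrightarrow> pos k = rcis (crad k) (\<theta> k)"
  and pos_ext: "k < m \<Longrightarrow> pos (m + k) = rcis 3 (\<theta> k)"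
  by (auto simp: pos_def)

lemma pos_gext: "k < m \<Longrightarrow> pos (gext k) = rcis (erad k) (\<theta> k)"
  by (simp add: gext_def erad_def pos_core pos_ext)

lemma pos_special:
  "pos a = Complex 1 0" "pos b = Complex 0 1" "pos c = Complex (-1) 0" "pos d = Complex 0 (-1)"
  "pos p = Complex (1 / 4) (1 / 4)" "pos q = Complex (-1 / 4) (-1 / 4)"
proof -
  have "cos (3 * pi / 2) = 0" "sin (3 * pi / 2) = -1"
    using cos_periodic_pi[of "pi / 2"] sin_periodic_pi[of "pi / 2"] by (auto simp: field_simps)
  then show "pos a = Complex 1 0" "pos b = Complex 0 1" "pos c = Complex (-1) 0" "pos d = Complex 0 (-1)"
    using ord by (auto simp: pos_core crad_def th_val rcis_def complex_eq_iff)
  show "pos p = Complex (1 / 4) (1 / 4)" "pos q = Complex (-1 / 4) (-1 / 4)"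
    using ord by (auto simp: pos_def p_def q_def)
qed

lemma gverts_cases:
  assumes "v \<in> gverts"
  obtains "v \<in> {a, b, c, d, p, q}" | "v < m" "v \<notin> {a, b, c, d}" | k where "v = m + k" "k < m"
  using assms by (auto simp: gverts_def)

lemma norm_pq: "norm (pos p) < 1" "norm (pos q) < 1"
proof -
  have "norm (Complex (1 / 4) (1 / 4)) \<le> 1 / 2" "norm (Complex (-1 / 4) (-1 / 4)) \<le> 1 / 2"
    using cmod_le[of "Complex (1 / 4) (1 / 4)"] cmod_le[of "Complex (-1 / 4) (-1 / 4)"] by auto
  then show "norm (pos p) < 1" "norm (pos q) < 1" by (auto simp: pos_special)
qed

text \<open>\<open>p\<close> and \<open>q\<close> lie inside the unit circle, all other nodes on or
  outside it. There the angle determines the index, and radius 3 tells pendant nodes from core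
  nodes, whose radius is at most 2.\<close>

lemma inj_pos: "inj_on pos gverts"
proof
  fix u v assume uv: "u \<in> gverts" "v \<in> gverts" "pos u = pos v"
  have pqne: "pos p \<noteq> pos q" by (simp add: pos_special)
  have form: "u \<in> {p, q} \<or> (\<exists>s k. k < m \<and> 1 \<le> s \<and> pos u = rcis s (\<theta> k) \<and>
      (u = k \<and> s = crad k \<or> u = m + k \<and> s = 3))" if "u \<in> gverts" for u
    using that crad_bounds(1) unfolding gverts_def by (fastforce simp: pos_core pos_ext)
  have big: "1 \<le> norm (pos u)" if "u \<in> gverts" "u \<notin> {p, q}" for u
    using form[OF that(1)] that(2) by auto
  show "u = v"
  proof (cases "u \<in> {p, q} \<or> v \<in> {p, q}")
    case True
    then have "norm (pos u) < 1" using norm_pq uv(3) by auto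
    then have "u \<in> {p, q}" "v \<in> {p, q}" using big[OF uv(1)] big[OF uv(2)] uv(3) by force+
    then show ?thesis using pqne uv(3) by auto
  next
    case False
    then obtain s k s' k' where *: "k < m" "1 \<le> s" "pos u = rcis s (\<theta> k)" "u = k \<and> s = crad k \<or> u = m + k \<and> s = 3"
       "k' < m" "1 \<le> s'" "pos v = rcis s' (\<theta> k')" "v = k' \<and> s' = crad k' \<or> v = m + k' \<and> s' = 3"
      using form[OF uv(1)] form[OF uv(2)] by metis
    then have eq: "rcis s (\<theta> k) = rcis s' (\<theta> k')" using uv(3) by simp
    have "0 < s" "0 < s'" using *(2,6) by auto
    with polar_unique[OF eq _ _ *(1,5)] have sk: "s' = s" "k' = k" by auto
    show ?thesis using *(4,8) crad_bounds(2)[of k] unfolding sk by auto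
  qed
qed

lemma arc_of_pair:
  assumes "u \<noteq> v"
  shows "path_image (arc_of {u, v}) = closed_segment (pos u) (pos v)"
    and "{pathstart (arc_of {u, v}), pathfinish (arc_of {u, v})} = pos ` {u, v}"
    and "pos u \<noteq> pos v \<Longrightarrow> arc (arc_of {u, v})"
  using assms by (cases "u < v"; auto simp: arc_of_def min_def max_def closed_segment_commute)+

lemma pendant_points:
  assumes "k < m" "z \<in> path_image (arc_of {k, m + k})"
  obtains s where "crad k \<le> s" "s \<le> 3" "z = rcis s (\<theta> k)"
proof -
  have "z \<in> closed_segment (rcis (crad k) (\<theta> k)) (rcis 3 (\<theta> k))"
    using assms by (simp add: arc_of_pair(1) pos_core pos_ext)
  then obtain u where u: "0 \<le> u" "u \<le> 1" "z = (1 - u) *\<^sub>R rcis (crad k) (\<theta> k) + u *\<^sub>R rcis 3 (\<theta> k)"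
    by (auto simp: closed_segment_def)
  define s where "s = (1 - u) * crad k + u * 3"
  have "z = rcis s (\<theta> k)" using u(3) by (simp add: s_def rcis_def scaleR_conv_of_real algebra_simps)
  moreover have "s = crad k + u * (3 - crad k)" by (simp add: s_def algebra_simps)
  then have "crad k \<le> s" using u crad_bounds(2)[of k] by simp
  moreover have "s \<le> 3"
  proof -
    have "(1 - u) * crad k \<le> (1 - u) * 3" using u crad_bounds(2)[of k] by (intro mult_left_mono) auto
    then show ?thesis by (simp add: s_def algebra_simps)
  qed
  ultimately show thesis using that by blast
qed

definition core_index :: "nat set \<Rightarrow> nat" where
  "core_index e = (if e = {a, p} then 0 else if e = {b, p} then 1 else if e = {p, q} then 2
     else if e = {c, q} then 3 else if e = {d, q} then 4 else if e = {a, b} then 5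
     else if e = {b, c} then 6 else if e = {c, d} then 7 else 8)"

lemma core_index_simps:
  "core_index {a, p} = 0" "core_index {b, p} = 1" "core_index {p, q} = 2" "core_index {c, q} = 3"
  "core_index {d, q} = 4" "core_index {a, b} = 5" "core_index {b, c} = 6" "core_index {c, d} = 7"
  "core_index {a, d} = 8"
  using dist by (auto simp: core_index_def doubleton_eq_iff)

lemma inj_core_index: "inj_on core_index core_edges"
  unfolding core_edges_def by (auto simp: inj_on_def core_index_simps)

lemma segment_ReIm:
  assumes "z \<in> closed_segment (Complex x y) (Complex x' y')"
  obtains u where "0 \<le> u" "u \<le> 1" "Re z = x + u * (x' - x)" "Im z = y + u * (y' - y)"
proof -
  from assms obtain u where u: "0 \<le> u" "u \<le> 1" "z = (1 - u) *\<^sub>R Complex x y + u *\<^sub>R Complex x' y'"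
    by (auto simp: closed_segment_def)
  show thesis by (rule that[OF u(1,2)]) (simp_all add: u(3) algebra_simps)
qed

lemma core_points:
  assumes "e \<in> core_edges" "z \<in> path_image (arc_of e)"
  shows "core_con (core_index e) (Re z) (Im z)"
proof -
  have d: "a \<noteq> p" "b \<noteq> p" "p \<noteq> q" "c \<noteq> q" "d \<noteq> q" "a \<noteq> b" "b \<noteq> c" "c \<noteq> d" "a \<noteq> d" using dist by auto
  note arcs = d[THEN arc_of_pair(1), unfolded pos_special]
  show ?thesis
    using assms unfolding core_edges_def
    by (elim insertE emptyE; simp only: arcs core_index_simps; elim segment_ReIm; simp add: core_con_def)
qed

lemma core_ends:
  assumes "e \<in> core_edges" "v \<in> {a, b, c, d, p, q}" "core_con (core_index e) (Re (pos v)) (Im (pos v))"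
  shows "v \<in> e"
  using assms unfolding core_edges_def
  by (elim insertE emptyE; simp add: core_index_simps pos_special core_con_def)

lemma core_norm_le:
  assumes "core_con i (Re z) (Im z)"
  shows "norm z \<le> 1"
  using cmod_le[of z] core_con_diamond[OF assms] by linarith

text \<open>The core lies in the diamond with corners 1, i, -1, -i, which touches the unit circle
  only in its corners: x + y at most 1 and x^2 + y^2 at least 1 force x y = 0 for nonnegative x,
  y.\<close>

lemma core_norm_1:
  assumes "core_con i (Re z) (Im z)" "1 \<le> norm z"
  shows "z \<in> pos ` {a, b, c, d}"
proof -
  define x y where "x = \<bar>Re z\<bar>" and "y = \<bar>Im z\<bar>"
  have xy: "0 \<le> x" "0 \<le> y" "x + y \<le> 1" using core_con_diamond[OF assms(1)] by (auto simp: x_def y_def)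
  have "1 \<le> (norm z)\<^sup>2" using assms(2) by (simp add: one_le_power)
  then have 1: "1 \<le> x * x + y * y" unfolding cmod_power2 x_def y_def by (simp add: power2_eq_square)
  have "x * x \<le> x * (1 - y)" "y * y \<le> y * (1 - x)" using xy by (auto intro!: mult_left_mono)
  then have "x * x + y * y \<le> x + y - 2 * (x * y)" by (simp add: algebra_simps)
  then have "x * y \<le> 0" "1 \<le> x + y" using 1 xy mult_nonneg_nonneg[OF xy(1,2)] by linarith+
  then have "x = 0 \<or> y = 0" using mult_nonneg_nonneg[OF xy(1,2)] by (simp add: antisym)
  then have "x = 0 \<and> y = 1 \<or> y = 0 \<and> x = 1" using xy \<open>1 \<le> x + y\<close> by auto
  then have "z = Complex 1 0 \<or> z = Complex 0 1 \<or> z = Complex (-1) 0 \<or> z = Complex 0 (-1)"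
    by (auto simp: x_def y_def complex_eq_iff abs_if split: if_splits)
  then show ?thesis by (auto simp: pos_special[symmetric])
qed

lemma gedges_cases:
  assumes "e \<in> gedges"
  obtains "e \<in> core_edges" | k where "e = {k, m + k}" "k < m" "k \<notin> \<rho>"
  using assms by (auto simp: gedges_def pendant_edges_def)

lemma special_in_gverts: "{a, b, c, d, p, q} \<subseteq> gverts"
  using ord by (auto simp: gverts_def)

lemma plane_drawing_gate: "plane_drawing gverts gedges pos arc_of"
  unfolding plane_drawing_def
proof (intro conjI ballI impI)
  show "inj_on pos gverts" by (rule inj_pos)
next
  fix e assume e: "e \<in> gedges"
  then obtain u v where uv: "e = {u, v}" "u \<noteq> v" using gedges_card by (metis card_2_iff)
  then have "u \<in> gverts" "v \<in> gverts" using gedges_sub[OF e] by auto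
  then have ne: "pos u \<noteq> pos v" using inj_pos uv(2) by (auto simp: inj_on_def)
  show "arc (arc_of e)" using arc_of_pair(3)[OF uv(2) ne] uv(1) by simp
  show ends: "{pathstart (arc_of e), pathfinish (arc_of e)} = pos ` e" using arc_of_pair(2)[OF uv(2)] uv(1) by simp
  show "path_image (arc_of e) \<inter> pos ` gverts = pos ` e"
  proof
    show "pos ` e \<subseteq> path_image (arc_of e) \<inter> pos ` gverts"
      using ends[symmetric] gedges_sub[OF e] pathstart_in_path_image[of "arc_of e"] pathfinish_in_path_image[of "arc_of e"]
      by auto
    show "path_image (arc_of e) \<inter> pos ` gverts \<subseteq> pos ` e"
    proof
      fix z assume "z \<in> path_image (arc_of e) \<inter> pos ` gverts"
      then obtain w where w: "w \<in> gverts" "z = pos w" "pos w \<in> path_image (arc_of e)" by auto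
      from e have "w \<in> e"
      proof (cases rule: gedges_cases)
        case 1
        note con = core_points[OF 1 w(3)]
        from w(1) show ?thesis
        proof (cases rule: gverts_cases)
          case 1
          then show ?thesis using core_ends[OF \<open>e \<in> core_edges\<close> _ con] by blast
        next
          case 2
          then have "norm (pos w) = 2" by (simp add: pos_core crad_def)
          then show ?thesis using core_norm_le[OF con] by simp
        next
          case (3 k)
          then have "norm (pos w) = 3" by (simp add: pos_ext)
          then show ?thesis using core_norm_le[OF con] by simp
        qed
      next
        case (2 k)
        obtain s where s: "crad k \<le> s" "s \<le> 3" "pos w = rcis s (\<theta> k)"
          using pendant_points[OF 2(2) w(3)[unfolded 2(1)]] by blast
        have s0: "0 < s" using s(1) crad_bounds(3)[of k] by simp
        show ?thesis
        proof (cases "w < m")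
          case True
          then show ?thesis
            using polar_unique[of s k "crad w" w] s s0 crad_bounds(3)[of w] 2 by (simp add: pos_core)
        next
          case False
          with w(1) consider "w = p \<or> w = q" | k' where "w = m + k'" "k' < m" by (auto simp: gverts_def)
          then show ?thesis
          proof cases
            case 1
            then have "norm (pos w) < 1" using norm_pq by auto
            then show ?thesis using s crad_bounds(1)[of k] by simp
          next
            case (2 k')
            then show ?thesis
              using polar_unique[of s k 3 k'] s s0 \<open>k < m\<close> \<open>e = {k, m + k}\<close> by (simp add: pos_ext)
          qed
        qed
      qed
      then show "z \<in> pos ` e" using w(2) by blast
    qed
  qed
next
  fix e e' assume e: "e \<in> gedges" and e': "e' \<in> gedges" and ne: "e \<noteq> e'"
  have sp: "pos ` {a, b, c, d} \<subseteq> pos ` gverts" using special_in_gverts by (intro image_mono) auto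
  \<comment> \<open>Pendant edges keep to radius at least 1 and core edges to radius at most 1, so
    they can share only a special node.\<close>
  have mixed: "z \<in> pos ` gverts"
    if ec: "e \<in> core_edges" and km: "k < m" and ze: "z \<in> path_image (arc_of e)"
      and zk: "z \<in> path_image (arc_of {k, m + k})" for e k z
  proof -
    obtain s where "crad k \<le> s" "z = rcis s (\<theta> k)" using pendant_points[OF km zk] by blast
    then have "1 \<le> norm z" using crad_bounds(1)[of k] by simp
    then show ?thesis using core_norm_1[OF core_points[OF ec ze]] sp by blast
  qed
  show "path_image (arc_of e) \<inter> path_image (arc_of e') \<subseteq> pos ` gverts"
  proof
    fix z assume "z \<in> path_image (arc_of e) \<inter> path_image (arc_of e')"
    then have z: "z \<in> path_image (arc_of e)" "z \<in> path_image (arc_of e')" by auto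
    from e show "z \<in> pos ` gverts"
    proof (cases rule: gedges_cases)
      case 1
      note ce = this
      from e' show ?thesis
      proof (cases rule: gedges_cases)
        case 1
        have "core_index e \<noteq> core_index e'" using inj_core_index ce 1 ne by (auto simp: inj_on_def)
        from core_con_meet[OF core_points[OF ce z(1)] core_points[OF 1 z(2)] this]
        have "z = Complex 1 0 \<or> z = Complex 0 1 \<or> z = Complex (-1) 0 \<or> z = Complex 0 (-1) \<or>
            z = Complex (1 / 4) (1 / 4) \<or> z = Complex (-1 / 4) (-1 / 4)"
          by (simp add: complex_eq_iff)
        then have "z \<in> pos ` {a, b, c, d, p, q}" unfolding pos_special[symmetric] by blast
        then show ?thesis using special_in_gverts by blast
      next
        case (2 k)
        then show ?thesis using mixed[OF ce] z by simp
      qed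
    next
      case (2 k)
      note k = this
      from e' show ?thesis
      proof (cases rule: gedges_cases)
        case 1
        then show ?thesis using mixed[OF 1 k(2)] z k(1) by simp
      next
        case (2 k')
        obtain s where s: "crad k \<le> s" "z = rcis s (\<theta> k)"
          using pendant_points[OF k(2) z(1)[unfolded k(1)]] by blast
        obtain s' where s': "crad k' \<le> s'" "z = rcis s' (\<theta> k')"
          using pendant_points[OF 2(2) z(2)[unfolded 2(1)]] by blast
        have "k = k'"
          using polar_unique(2)[of s k s' k'] s s' crad_bounds(3)[of k] crad_bounds(3)[of k'] k(2) 2(2) by simp
        then show ?thesis using ne k(1) 2(1) by simp
      qed
    qed
  qed
qed

lemma drawn_points_gate:
  assumes "z \<in> drawn_points gverts gedges pos arc_of"
  shows "norm z \<le> 1 \<or> (\<exists>s k. k < m \<and> 0 < s \<and> s \<le> erad k \<and> z = rcis s (\<theta> k))"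
proof -
  from assms consider v where "v \<in> gverts" "z = pos v" | e where "e \<in> gedges" "z \<in> path_image (arc_of e)"
    by (auto simp: drawn_points_def)
  then show ?thesis
  proof cases
    case 1
    from 1(1) consider "v < m" | "v \<in> {p, q}" | k where "v = m + k" "k < m" "k \<notin> \<rho>"
      by (auto simp: gverts_def)
    then show ?thesis
    proof cases
      case a: 1
      then show ?thesis using 1 crad_bounds(3) erad_bounds(3) by (auto simp: pos_core)
    next
      case b: 2
      then show ?thesis using 1 norm_pq by auto
    next
      case (3 k)
      then show ?thesis using 1 by (intro disjI2 exI[of _ 3] exI[of _ k]) (simp add: pos_ext erad_def)
    qed
  next
    case 2
    from 2(1) show ?thesis
    proof (cases rule: gedges_cases)
      case 1
      then show ?thesis using core_norm_le[OF core_points[OF 1 2(2)]] by simp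
    next
      case (2 k)
      obtain s where "crad k \<le> s" "s \<le> 3" "z = rcis s (\<theta> k)"
        using pendant_points[OF 2(2)] \<open>z \<in> path_image (arc_of e)\<close> 2(1) by blast
      then show ?thesis using 2 crad_bounds(3)[of k] by (intro disjI2 exI[of _ s] exI[of _ k]) (simp add: erad_def)
    qed
  qed
qed

lemma beyond_not_drawn:
  assumes "k < m" "erad k < s"
  shows "rcis s (\<theta> k) \<notin> drawn_points gverts gedges pos arc_of"
proof
  assume "rcis s (\<theta> k) \<in> drawn_points gverts gedges pos arc_of"
  from drawn_points_gate[OF this] show False
  proof
    assume "norm (rcis s (\<theta> k)) \<le> 1"
    then show False using assms erad_bounds(1)[of k] by simp
  next
    assume "\<exists>s' k'. k' < m \<and> 0 < s' \<and> s' \<le> erad k' \<and> rcis s (\<theta> k) = rcis s' (\<theta> k')"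
    then obtain s' k' where "k' < m" "0 < s'" "s' \<le> erad k'" "rcis s (\<theta> k) = rcis s' (\<theta> k')" by blast
    then show False using polar_unique[of s k s' k'] assms erad_bounds(1)[of k] by auto
  qed
qed

lemma outer_face_ccw_gate: "outer_face_ccw gverts gedges pos arc_of (map gext [0..<m])"
proof -
  define D where "D = drawn_points gverts gedges pos arc_of"
  \<comment> \<open>The dangling arcs prolong the rays; any radius above 3 would do for the outer
    circle.\<close>
  define l where "l k = linepath (rcis (erad k) (\<theta> k)) (rcis 4 (\<theta> k))" for k
  have outD: "rcis s (\<theta> k) \<in> outside D" if "k < m" "erad k < s" for k s
    by (rule ray_in_outside[of "erad k"]) (use that beyond_not_drawn in \<open>auto simp: D_def\<close>)
  have lpt: "\<exists>s. erad k \<le> s \<and> s \<le> 4 \<and> z = rcis s (\<theta> k)" if "z \<in> path_image (l k)" for z k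
  proof -
    from that obtain u where u: "0 \<le> u" "u \<le> 1" "z = (1 - u) *\<^sub>R rcis (erad k) (\<theta> k) + u *\<^sub>R rcis 4 (\<theta> k)"
      by (auto simp: l_def closed_segment_def)
    define s where "s = (1 - u) * erad k + u * 4"
    have "z = rcis s (\<theta> k)" using u(3) by (simp add: s_def rcis_def scaleR_conv_of_real algebra_simps)
    moreover have "s = erad k + u * (4 - erad k)" by (simp add: s_def algebra_simps)
    then have "erad k \<le> s" using u erad_bounds(2)[of k] by simp
    moreover have "(1 - u) * erad k \<le> (1 - u) * 4" using u erad_bounds(2)[of k] by (intro mult_left_mono) auto
    then have "s \<le> 4" by (simp add: s_def algebra_simps)
    ultimately show ?thesis by blast
  qed
  have inD: "rcis (erad k) (\<theta> k) \<in> D" if "k < m" for k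
  proof -
    have "gext k \<in> gverts" using that by (auto simp: gext_def gverts_def)
    then show ?thesis unfolding D_def drawn_points_def pos_gext[OF that, symmetric] by blast
  qed
  \<comment> \<open>The node belongs to \<open>D\<close>, hence not to the outside, but is a limit
    of points of its dangling arc, which are outside.\<close>
  have front: "rcis (erad k) (\<theta> k) \<in> frontier (outside D)" if k: "k < m" for k
  proof -
    have ne: "rcis (erad k) (\<theta> k) \<noteq> rcis 4 (\<theta> k)"
      using polar_unique(1)[of "erad k" k 4 k] k erad_bounds[of k] by auto
    have "open_segment (rcis (erad k) (\<theta> k)) (rcis 4 (\<theta> k)) \<subseteq> outside D"
    proof
      fix z assume z: "z \<in> open_segment (rcis (erad k) (\<theta> k)) (rcis 4 (\<theta> k))"
      then have "z \<in> path_image (l k)" by (simp add: l_def open_segment_def)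
      then obtain s where "erad k \<le> s" "z = rcis s (\<theta> k)" using lpt by blast
      moreover have "s \<noteq> erad k" using z calculation by (auto simp: open_segment_def)
      ultimately show "z \<in> outside D" using outD[OF k] by simp
    qed
    then have "closure (open_segment (rcis (erad k) (\<theta> k)) (rcis 4 (\<theta> k))) \<subseteq> closure (outside D)"
      by (rule closure_mono)
    then have "rcis (erad k) (\<theta> k) \<in> closure (outside D)" using ne by (auto simp: closure_open_segment)
    moreover have "rcis (erad k) (\<theta> k) \<notin> outside D" using inD[OF k] outside_no_overlap[of D] by blast
    ultimately show ?thesis using interior_subset[of "outside D"] by (auto simp: frontier_def)
  qed
  have Dball: "D \<subseteq> ball 0 4"
  proof
    fix z assume "z \<in> D"
    from drawn_points_gate[OF this[unfolded D_def]] show "z \<in> ball 0 4"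
    proof
      assume "\<exists>s k. k < m \<and> 0 < s \<and> s \<le> erad k \<and> z = rcis s (\<theta> k)"
      then obtain s k where "0 < s" "s \<le> erad k" "z = rcis s (\<theta> k)" by blast
      then show ?thesis using erad_bounds(2)[of k] by simp
    qed simp
  qed
  show ?thesis
    unfolding outer_face_ccw_def Let_def D_def[symmetric]
  proof (intro conjI exI[of _ l] exI[of _ \<theta>] exI[of _ 4])
    show "\<forall>x\<in>set (map gext [0..<m]). pos x \<in> frontier (outside D)"
      using front by (auto simp: pos_gext)
    show "\<forall>i<length (map gext [0..<m]). arc (l i) \<and> pathstart (l i) = pos (map gext [0..<m] ! i) \<and>
        pathfinish (l i) = rcis 4 (\<theta> i) \<and> path_image (l i) - {pos (map gext [0..<m] ! i)} \<subseteq> outside D \<and>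
        path_image (l i) - {rcis 4 (\<theta> i)} \<subseteq> ball 0 4"
    proof (intro allI impI)
      fix i assume "i < length (map gext [0..<m])"
      then have i: "i < m" and nth: "pos (map gext [0..<m] ! i) = rcis (erad i) (\<theta> i)" by (auto simp: pos_gext)
      have "rcis (erad i) (\<theta> i) \<noteq> rcis 4 (\<theta> i)"
        using polar_unique(1)[of "erad i" i 4 i] i erad_bounds[of i] by auto
      then have 1: "arc (l i)" by (simp add: l_def)
      have 2: "path_image (l i) - {rcis (erad i) (\<theta> i)} \<subseteq> outside D"
      proof
        fix z assume z: "z \<in> path_image (l i) - {rcis (erad i) (\<theta> i)}"
        then obtain s where s: "erad i \<le> s" "z = rcis s (\<theta> i)" using lpt by blast
        then have "s \<noteq> erad i" using z by auto
        then show "z \<in> outside D" using outD[OF i] s by simp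
      qed
      have 3: "path_image (l i) - {rcis 4 (\<theta> i)} \<subseteq> ball 0 4"
      proof
        fix z assume z: "z \<in> path_image (l i) - {rcis 4 (\<theta> i)}"
        then obtain s where s: "erad i \<le> s" "s \<le> 4" "z = rcis s (\<theta> i)" using lpt by blast
        then have "s \<noteq> 4" using z by auto
        then show "z \<in> ball 0 4" using s erad_bounds(1)[of i] by simp
      qed
      show "arc (l i) \<and> pathstart (l i) = pos (map gext [0..<m] ! i) \<and>
        pathfinish (l i) = rcis 4 (\<theta> i) \<and> path_image (l i) - {pos (map gext [0..<m] ! i)} \<subseteq> outside D \<and>
        path_image (l i) - {rcis 4 (\<theta> i)} \<subseteq> ball 0 4"
        unfolding nth using 1 2 3 by (simp add: l_def)
    qed
    show "\<forall>i<length (map gext [0..<m]). \<forall>j<length (map gext [0..<m]). i \<noteq> j \<longrightarrow>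
        path_image (l i) \<inter> path_image (l j) = {}"
    proof (intro allI impI)
      fix i j assume "i < length (map gext [0..<m])" "j < length (map gext [0..<m])" and ij: "i \<noteq> j"
      then have m: "i < m" "j < m" by auto
      have False if z: "z \<in> path_image (l i)" "z \<in> path_image (l j)" for z
      proof -
        obtain s s' where "erad i \<le> s" "z = rcis s (\<theta> i)" "erad j \<le> s'" "z = rcis s' (\<theta> j)"
          using lpt[OF z(1)] lpt[OF z(2)] by blast
        then show False
          using polar_unique(2)[of s i s' j] m ij erad_bounds(1)[of i] erad_bounds(1)[of j] by simp
      qed
      then show "path_image (l i) \<inter> path_image (l j) = {}" by blast
    qed
    show "\<forall>i<length (map gext [0..<m]). \<forall>j<length (map gext [0..<m]). i < j \<longrightarrow> \<theta> i < \<theta> j \<and> \<theta> j < \<theta> i + 2 * pi"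
      using th_less by simp
  qed (use Dball in auto)
qed

end

context gadget
begin

lemma recognizer_gate: "recognizer gate"
proof -
  obtain \<theta> where "\<theta> a = 0" "\<theta> b = pi / 2" "\<theta> c = pi" "\<theta> d = 3 * pi / 2"
    "\<And>i j. i < j \<Longrightarrow> j < m \<Longrightarrow> \<theta> i < \<theta> j \<and> \<theta> j < \<theta> i + 2 * pi"
    using exists_angles[OF ord] by blast
  then interpret gadget_drawing m a b c d \<rho> \<phi> \<theta> by unfold_locales auto
  have "finite_graph gverts gedges"
    using gedges_sub gedges_card by (auto simp: finite_graph_def gverts_def)
  moreover have "distinct (map gext [0..<m])" "gext ` {..<m} \<subseteq> gverts"
    by (auto simp: distinct_map inj_on_def gext_def gverts_def split: if_splits)
  ultimately show ?thesis
    using plane_drawing_gate outer_face_ccw_gate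
    unfolding recognizer_def is_matchgate_def by (auto simp: gate_def lessThan_atLeast0)
qed

lemma arity_gate: "arity gate = m"
  by (simp add: arity_def gate_def)

end

section \<open>The right inverse\<close>

lemma std_signature_index:
  assumes "x < 2 ^ arity H"
  shows "std_signature H $ x = removal_signature H (ones (digits 2 (arity H) x))"
proof -
  have "removed H (digits 2 (arity H) x) = (!) (exts H) ` ones (digits 2 (arity H) x)"
    by (auto simp: removed_def ones_def)
  then show ?thesis using assms by (simp add: std_signature_def removal_signature_def Let_def)
qed

lemma std_signature_insert_index:
  assumes "arity H = 2 * n" "1 \<le> t" "t \<le> n" "a < 4"
  shows "std_signature H $ insert_index 4 n t a b = removal_signature H (block_set t a \<union> rest_set n t b)"
proof -
  have "insert_index 4 n t a b < 2 ^ arity H"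
    using insert_index_less[of a t n b] assms by (simp add: power_mult)
  then show ?thesis
    using std_signature_index[of "insert_index 4 n t a b" H] ones_insert_index[of a t n b] assms by simp
qed

text \<open>An odd number of remaining nodes admits no perfect matching. This is what splits the
  submatrix into two blocks.\<close>

lemma removal_signature_parity:
  assumes H: "is_matchgate H" and X: "X \<subseteq> {..<arity H}" and nz: "removal_signature H X \<noteq> 0"
  shows "even (card (verts H) + card X)"
proof (rule ccontr)
  assume odd: "odd (card (verts H) + card X)"
  let ?Z = "(!) (exts H) ` X"
  have fg: "finite_graph (verts H) (edges H)" and xs: "distinct (exts H)" "set (exts H) \<subseteq> verts H"
    using H by (auto simp: is_matchgate_def)
  have E: "\<And>e. e \<in> edges H \<Longrightarrow> e \<subseteq> verts H" "\<And>e. e \<in> edges H \<Longrightarrow> card e = 2" and V: "finite (verts H)"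
    using fg by (auto simp: finite_graph_def)
  have fE: "finite (edges H)" using E(1) V by (auto intro: finite_subset[of _ "Pow (verts H)"])
  have Z: "?Z \<subseteq> verts H" using X xs(2) by (auto simp: arity_def subset_iff)
  have "inj_on ((!) (exts H)) X" using X xs(1) by (auto simp: arity_def inj_on_def nth_eq_iff_index_eq subset_iff)
  then have cZ: "card ?Z = card X" by (rule card_image)
  have fZ: "finite ?Z" using Z V finite_subset by blast
  have "card (verts H - ?Z) = card (verts H) - card X" "card X \<le> card (verts H)"
    using Z V cZ fZ card_mono[OF V Z] by (auto simp: card_Diff_subset)
  then have "odd (card (verts H - ?Z))" using odd by (simp add: even_diff_nat)
  then have "cover_sum (edges H) (weight H) (verts H - ?Z) = 0"
    using V by (intro cover_sum_odd[OF fE E(2)]) auto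
  then show False
    using nz matchings_eq_exact_covers[OF E(1)] by (simp add: removal_signature_eq cover_sum_def)
qed

text \<open>The three cases are the three ways to cut the cycle \<open>c, cc, i, j\<close> that
  respect the adjacency of \<open>c\<close> and \<open>Suc c\<close>. The relation survives each cut
  because \<open>{c, i}\<close> and \<open>{Suc c, j}\<close> remain the diagonals.\<close>

lemma exists_recognizer_on_four:
  fixes c :: nat
  assumes ord: "i < j \<and> j < c \<or> Suc c < i \<and> i < j \<or> j < c \<and> Suc c < i"
    and less: "i < m" "j < m" "Suc c < m" and \<rho>: "\<rho> \<subseteq> {..<m}"
    and nz: "\<phi> {} \<noteq> 0"
    and odd: "\<And>Y. Y \<subseteq> {c, Suc c, i, j} \<Longrightarrow> odd (card Y) \<Longrightarrow> \<phi> Y = 0"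
    and rel: "\<phi> {} * \<phi> {c, Suc c, i, j} + \<phi> {c, i} * \<phi> {Suc c, j} = \<phi> {c, Suc c} * \<phi> {i, j} + \<phi> {c, j} * \<phi> {Suc c, i}"
  shows "\<exists>H' :: nat matchgate. recognizer H' \<and> arity H' = m \<and> (\<forall>X\<subseteq>{..<m}. removal_signature H' X =
     (if sym_diff X \<rho> \<subseteq> {c, Suc c, i, j} then \<phi> (sym_diff X \<rho>) else 0))"
  using ord
proof (elim disjE conjE)
  have pr: "{i, c} = {c, i}" "{j, c} = {c, j}" "{i, Suc c} = {Suc c, i}" "{j, Suc c} = {Suc c, j}" "{j, i} = {i, j}"
    by (rule insert_commute)+
  {
    assume o: "i < j" "j < c"
    have s: "{i, j, c, Suc c} = {c, Suc c, i, j}" by auto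
    have rel': "\<phi> {} * \<phi> {i, j, c, Suc c} + \<phi> {i, c} * \<phi> {j, Suc c} = \<phi> {i, j} * \<phi> {c, Suc c} + \<phi> {i, Suc c} * \<phi> {j, c}"
      unfolding s pr using rel by (simp add: mult.commute)
    have odd': "\<phi> Y = 0" if "Y \<subseteq> {i, j, c, Suc c}" "odd (card Y)" for Y
      using odd that unfolding s by blast
    interpret gadget m i j c "Suc c" \<rho> \<phi>
      by (rule gadget.intro[OF o lessI less(3) \<rho> nz odd' rel'])
    show ?thesis using recognizer_gate arity_gate removal_signature_gate unfolding s by blast
  next
    assume o: "Suc c < i" "i < j"
    interpret gadget m c "Suc c" i j \<rho> \<phi>
      by (rule gadget.intro[OF lessI o less(2) \<rho> nz odd rel])
    show ?thesis using recognizer_gate arity_gate removal_signature_gate by blast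
  next
    assume o: "j < c" "Suc c < i"
    have s: "{j, c, Suc c, i} = {c, Suc c, i, j}" by auto
    have rel': "\<phi> {} * \<phi> {j, c, Suc c, i} + \<phi> {j, Suc c} * \<phi> {c, i} = \<phi> {j, c} * \<phi> {Suc c, i} + \<phi> {j, i} * \<phi> {c, Suc c}"
      unfolding s pr using rel by (simp add: mult.commute add.commute)
    have odd': "\<phi> Y = 0" if "Y \<subseteq> {j, c, Suc c, i}" "odd (card Y)" for Y
      using odd that unfolding s by blast
    interpret gadget m j c "Suc c" i \<rho> \<phi>
      by (rule gadget.intro[OF o(1) lessI o(2) less(1) \<rho> nz odd' rel'])
    show ?thesis using recognizer_gate arity_gate removal_signature_gate unfolding s by blast
  }
qed

text \<open>Rank 4 enters as \<open>row0\<close> and \<open>rows12\<close>; that the rows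
  \<open>{}\<close> and \<open>{c, cc}\<close> are independent on the chosen columns follows from
  the identity.\<close>

lemma mgi_recognizer_inverse:
  fixes c :: nat
  defines "cc \<equiv> Suc c"
  assumes mgi: "satisfies_mgi m F" and c: "cc < m"
    and row0: "\<exists>X\<subseteq>{..<m} - {c, cc}. F X \<noteq> 0"
    and rows12: "\<And>x y. (\<And>X. X \<subseteq> {..<m} - {c, cc} \<Longrightarrow> x * F (insert c X) + y * F (insert cc X) = 0)
       \<Longrightarrow> x = 0 \<and> y = 0"
    and parity: "\<And>X. X \<subseteq> {..<m} \<Longrightarrow> F X \<noteq> 0 \<Longrightarrow> even (N + card X)"
  shows "\<exists>H' :: nat matchgate. recognizer H' \<and> arity H' = m \<and>
    (\<forall>T T'. T \<in> {{}, {c}, {cc}, {c, cc}} \<longrightarrow> T' \<in> {{}, {c}, {cc}, {c, cc}} \<longrightarrow>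
      (\<Sum>X\<in>Pow ({..<m} - {c, cc}). F (T \<union> X) * removal_signature H' (T' \<union> X)) = (if T = T' then 1 else 0))"
proof -
  let ?R = "{..<m} - {c, cc}"
  obtain S i j where S: "S \<subseteq> ?R" "F S \<noteq> 0" and ij: "i \<in> ?R" "j \<in> ?R"
    and ord: "i < j \<and> j < c \<or> cc < i \<and> i < j \<or> j < c \<and> cc < i"
    and ne: "F (insert c (toggle S i)) * F (insert cc (toggle S j)) \<noteq> F (insert c (toggle S j)) * F (insert cc (toggle S i))"
    and det: "F S * F (insert c (insert cc (toggle (toggle S i) j))) - F (insert c (insert cc S)) * F (toggle (toggle S i) j)
     = - (F (insert c (toggle S i)) * F (insert cc (toggle S j)) - F (insert c (toggle S j)) * F (insert cc (toggle S i)))"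
    using mgi_nonzero_minor[OF mgi, of c] c row0 rows12 unfolding cc_def by metis
  define Si where "Si = toggle S i"
  define Sj where "Sj = toggle S j"
  define Sij where "Sij = toggle (toggle S i) j"
  have dist: "distinct [c, cc, i, j]" using ord by (auto simp: cc_def)
  have sub: "Si \<subseteq> ?R" "Sj \<subseteq> ?R" "Sij \<subseteq> ?R" using S ij by (auto simp: Si_def Sj_def Sij_def)
  have four: "S \<noteq> Si" "S \<noteq> Sj" "S \<noteq> Sij" "Si \<noteq> Sj" "Si \<noteq> Sij" "Sj \<noteq> Sij"
    using dist by (auto simp: Si_def Sj_def Sij_def)
  define ui uj vi vj where "ui = F (insert c Si)" and "uj = F (insert c Sj)" and "vi = F (insert cc Si)" and "vj = F (insert cc Sj)"
  define f0 f1 f2 f3 where "f0 = F S" and "f1 = F (insert c (insert cc S))" and "f2 = F Sij" and "f3 = F (insert c (insert cc Sij))"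
  define \<Delta> where "\<Delta> = ui * vj - uj * vi"
  have \<Delta>: "\<Delta> \<noteq> 0" using ne by (simp add: \<Delta>_def ui_def uj_def vi_def vj_def Si_def Sj_def)
  have E: "f0 * f3 - f1 * f2 = - \<Delta>"
    using det by (simp add: \<Delta>_def ui_def uj_def vi_def vj_def f0_def f1_def f2_def f3_def Si_def Sj_def Sij_def)
  \<comment> \<open>The corner opposite to row \<open>{}\<close> and column \<open>S\<close>, since
    inversion moves entries to complementary places: the entry for row \<open>T\<close> and column
    \<open>X\<close> sits at \<open>({c, cc} - T) \<union> sym_diff X Sij\<close>. Thus
    \<open>\<phi> {}\<close> comes from \<open>F S\<close>, which is nonzero.\<close>
  define \<rho> where "\<rho> = insert c (insert cc Sij)"
  \<comment> \<open>The adjugates of the two blocks divided by their determinants, which are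
    -\<Delta> for the rows \<open>{}\<close> and \<open>{c, cc}\<close> and \<Delta> for the rows
    \<open>{c}\<close> and \<open>{cc}\<close>.\<close>
  define \<phi> where "\<phi> Y = (if Y = {} then - f0 / \<Delta> else if Y = {c, cc} then f1 / \<Delta> else if Y = {i, j} then f2 / \<Delta>
     else if Y = {c, cc, i, j} then - f3 / \<Delta> else if Y = {c, i} then ui / \<Delta> else if Y = {c, j} then - uj / \<Delta>
     else if Y = {cc, i} then - vi / \<Delta> else if Y = {cc, j} then vj / \<Delta> else 0)" for Y :: "nat set"
  have \<phi>: "\<phi> {} = - f0 / \<Delta>" "\<phi> {c, cc} = f1 / \<Delta>" "\<phi> {i, j} = f2 / \<Delta>" "\<phi> {c, cc, i, j} = - f3 / \<Delta>"
    "\<phi> {c, i} = ui / \<Delta>" "\<phi> {c, j} = - uj / \<Delta>" "\<phi> {cc, i} = - vi / \<Delta>" "\<phi> {cc, j} = vj / \<Delta>"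
    using dist by (auto simp: \<phi>_def doubleton_eq_iff)
  have \<phi>_odd: "\<phi> Y = 0" if "odd (card Y)" for Y
  proof -
    have "card {c, cc} = 2" "card {i, j} = 2" "card {c, cc, i, j} = 4" "card {c, i} = 2" "card {c, j} = 2"
      "card {cc, i} = 2" "card {cc, j} = 2" using dist by auto
    then have "Y \<notin> {{}, {c, cc}, {i, j}, {c, cc, i, j}, {c, i}, {c, j}, {cc, i}, {cc, j}}"
      using that by auto
    then show ?thesis by (simp add: \<phi>_def)
  qed
  \<comment> \<open>The two sides differ by the sum of the block determinants over \<Delta>^2, and
    these determinants are opposite.\<close>
  have rel: "\<phi> {} * \<phi> {c, cc, i, j} + \<phi> {c, i} * \<phi> {cc, j} = \<phi> {c, cc} * \<phi> {i, j} + \<phi> {c, j} * \<phi> {cc, i}"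
  proof -
    have "\<phi> {} * \<phi> {c, cc, i, j} + \<phi> {c, i} * \<phi> {cc, j} - (\<phi> {c, cc} * \<phi> {i, j} + \<phi> {c, j} * \<phi> {cc, i})
      = (f0 * f3 - f1 * f2 + (ui * vj - uj * vi)) / (\<Delta> * \<Delta>)"
      unfolding \<phi> using \<Delta> by (simp add: field_simps)
    also have "\<dots> = 0" unfolding E \<Delta>_def[symmetric] by simp
    finally show ?thesis by simp
  qed
  have "\<exists>H' :: nat matchgate. recognizer H' \<and> arity H' = m \<and> (\<forall>X\<subseteq>{..<m}. removal_signature H' X =
     (if sym_diff X \<rho> \<subseteq> {c, cc, i, j} then \<phi> (sym_diff X \<rho>) else 0))"
    unfolding cc_def
  proof (rule exists_recognizer_on_four)
    show "i < j \<and> j < c \<or> Suc c < i \<and> i < j \<or> j < c \<and> Suc c < i" using ord by (simp add: cc_def)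
    show "i < m" "j < m" "Suc c < m" using ij c by (auto simp: cc_def)
    show "\<rho> \<subseteq> {..<m}" using sub(3) c by (auto simp: \<rho>_def cc_def)
    show "\<phi> {} \<noteq> 0" using S(2) \<Delta> by (simp add: \<phi>(1) f0_def)
    show "\<phi> Y = 0" if "odd (card Y)" for Y by (rule \<phi>_odd[OF that])
    show "\<phi> {} * \<phi> {c, Suc c, i, j} + \<phi> {c, i} * \<phi> {Suc c, j} = \<phi> {c, Suc c} * \<phi> {i, j} + \<phi> {c, j} * \<phi> {Suc c, i}"
      using rel by (simp only: cc_def)
  qed
  then obtain H' :: "nat matchgate" where H': "recognizer H'" "arity H' = m"
    and sig: "\<And>X. X \<subseteq> {..<m} \<Longrightarrow> removal_signature H' X =
     (if sym_diff X \<rho> \<subseteq> {c, cc, i, j} then \<phi> (sym_diff X \<rho>) else 0)"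
    by blast
  let ?T = "{{}, {c}, {cc}, {c, cc}}"
  have TR: "T \<subseteq> {..<m}" if "T \<in> ?T" for T using that c by (auto simp: cc_def)
  have sd: "sym_diff (T \<union> X) \<rho> = ({c, cc} - T) \<union> sym_diff X Sij" if "T \<in> ?T" "X \<subseteq> ?R" for T X
    using that sub(3) by (auto simp: \<rho>_def)
  have X4: "sym_diff S Sij = {i, j}" "sym_diff Si Sij = {j}" "sym_diff Sj Sij = {i}" "sym_diff Sij Sij = {}"
    using dist by (auto simp: Si_def Sj_def Sij_def)
  \<comment> \<open>Such an \<open>X\<close> differs from \<open>Sij\<close> in a position other
    than \<open>i\<close> and \<open>j\<close>, so the removed set differs from \<rho> outside the
    four bits.\<close>
  have out: "removal_signature H' (T \<union> X) = 0" if T: "T \<in> ?T" and X: "X \<subseteq> ?R" "X \<notin> {S, Si, Sj, Sij}" for T X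
  proof -
    have "\<not> sym_diff X Sij \<subseteq> {i, j}"
    proof
      assume A: "sym_diff X Sij \<subseteq> {i, j}"
      define A where "A = sym_diff X Sij"
      have "A = {} \<or> A = {i} \<or> A = {j} \<or> A = {i, j}"
        using A unfolding A_def[symmetric] by (cases "i \<in> A"; cases "j \<in> A"; blast)
      moreover have "X = sym_diff A Sij" by (auto simp: A_def)
      moreover have "sym_diff {} Sij = Sij" by simp
      ultimately have "X = Sij \<or> X = sym_diff {i} Sij \<or> X = sym_diff {j} Sij \<or> X = sym_diff {i, j} Sij" by metis
      moreover have "sym_diff {i} Sij = Sj" "sym_diff {j} Sij = Si" "sym_diff {i, j} Sij = S"
        using dist by (auto simp: Si_def Sj_def Sij_def)
      ultimately show False using X(2) by auto
    qed
    moreover have "sym_diff X Sij \<inter> {c, cc} = {}" using X(1) sub(3) by auto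
    moreover have "\<not> B \<union> A \<subseteq> {c, cc, i, j}" if "\<not> A \<subseteq> {i, j}" "A \<inter> {c, cc} = {}" for A B :: "nat set"
      using that by blast
    ultimately have "\<not> sym_diff (T \<union> X) \<rho> \<subseteq> {c, cc, i, j}" unfolding sd[OF T X(1)] by blast
    moreover have "T \<union> X \<subseteq> {..<m}" using TR[OF T] X(1) by blast
    ultimately show ?thesis by (simp only: sig if_False)
  qed
  have val: "removal_signature H' (T \<union> X) = \<phi> (({c, cc} - T) \<union> sym_diff X Sij)"
    if T: "T \<in> ?T" and X: "X \<in> {S, Si, Sj, Sij}" for T X
  proof -
    have XR: "X \<subseteq> ?R" using X by (elim insertE emptyE) (simp_all only: S(1) sub)
    have "sym_diff X Sij \<subseteq> {i, j}"
      using X by (elim insertE emptyE; simp only: X4; blast)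
    then have "sym_diff (T \<union> X) \<rho> \<subseteq> {c, cc, i, j}"
      unfolding sd[OF T XR] by blast
    moreover have "T \<union> X \<subseteq> {..<m}" using TR[OF T] XR by blast
    ultimately show ?thesis by (simp only: sig if_True sd[OF T XR])
  qed
  have sum4: "(\<Sum>X\<in>Pow ?R. F (T \<union> X) * removal_signature H' (T' \<union> X)) =
      F (T \<union> S) * \<phi> (({c, cc} - T') \<union> {i, j}) + F (T \<union> Si) * \<phi> (({c, cc} - T') \<union> {j}) +
      F (T \<union> Sj) * \<phi> (({c, cc} - T') \<union> {i}) + F (T \<union> Sij) * \<phi> ({c, cc} - T')"
    if T': "T' \<in> ?T" for T T'
  proof -
    have "(\<Sum>X\<in>Pow ?R. F (T \<union> X) * removal_signature H' (T' \<union> X)) =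
        (\<Sum>X\<in>{S, Si, Sj, Sij}. F (T \<union> X) * removal_signature H' (T' \<union> X))"
      by (rule sum.mono_neutral_right) (use S(1) sub out[OF T'] in auto)
    also have "\<dots> = (\<Sum>X\<in>{S, Si, Sj, Sij}. F (T \<union> X) * \<phi> (({c, cc} - T') \<union> sym_diff X Sij))"
      by (rule sum.cong[OF refl]) (simp add: val[OF T'])
    also have "\<dots> = F (T \<union> S) * \<phi> (({c, cc} - T') \<union> {i, j}) + F (T \<union> Si) * \<phi> (({c, cc} - T') \<union> {j}) +
      F (T \<union> Sj) * \<phi> (({c, cc} - T') \<union> {i}) + F (T \<union> Sij) * \<phi> ({c, cc} - T')"
      using four by (simp add: X4 add.assoc)
    finally show ?thesis .
  qed
  have fin: "finite S" using S(1) finite_subset by blast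
  have tog: "odd (card (toggle X k)) \<longleftrightarrow> even (card X)" if "finite X" for X :: "nat set" and k
  proof (cases "k \<in> X")
    case True
    then have "toggle X k = X - {k}" "0 < card X" using that by (auto simp: card_gt_0_iff)
    then show ?thesis using that True by (auto simp: card_Diff_singleton)
  next
    case False
    then have "toggle X k = insert k X" by auto
    then show ?thesis using that False by simp
  qed
  have even0: "even (N + card S)" using parity[of S] S by auto
  have finT: "finite Si" "finite Sj" "finite Sij" using fin by (auto simp: Si_def Sj_def Sij_def)
  have par: "even (card Si) \<longleftrightarrow> odd (card S)" "even (card Sj) \<longleftrightarrow> odd (card S)" "even (card Sij) \<longleftrightarrow> even (card S)"
  proof -
    show 1: "even (card Si) \<longleftrightarrow> odd (card S)" using tog[OF fin, of i] unfolding Si_def by blast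
    show "even (card Sj) \<longleftrightarrow> odd (card S)" using tog[OF fin, of j] unfolding Sj_def by blast
    have "odd (card Sij) \<longleftrightarrow> even (card Si)" using tog[OF finT(1), of j] unfolding Sij_def Si_def .
    then show "even (card Sij) \<longleftrightarrow> even (card S)" using 1 by blast
  qed
  have cols: "X \<subseteq> ?R \<and> finite X" if "X \<in> {S, Si, Sj, Sij}" for X
    using that by (elim insertE emptyE) (simp_all only: S(1) sub fin finT simp_thms)
  have ins: "card (insert c X) = Suc (card X)" "card (insert cc X) = Suc (card X)"
    "card (insert c (insert cc X)) = Suc (Suc (card X))" "insert c X \<subseteq> {..<m}" "insert cc X \<subseteq> {..<m}"
    "insert c (insert cc X) \<subseteq> {..<m}" "X \<subseteq> {..<m}" if "X \<in> {S, Si, Sj, Sij}" for X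
  proof -
    have "finite X" "c \<notin> X" "cc \<notin> X" and X: "X \<subseteq> {..<m}" using cols[OF that] by blast+
    then show "card (insert c X) = Suc (card X)" "card (insert cc X) = Suc (card X)"
      "card (insert c (insert cc X)) = Suc (Suc (card X))" by (auto simp: cc_def)
    have "c < m" using c by (simp add: cc_def)
    with X c show "insert c X \<subseteq> {..<m}" "insert cc X \<subseteq> {..<m}" "insert c (insert cc X) \<subseteq> {..<m}" "X \<subseteq> {..<m}"
      by simp_all
  qed
  have F0: "F X = 0" if "X \<subseteq> {..<m}" "odd (N + card X)" for X
    using parity[OF that(1)] that(2) by blast
  have mem: "S \<in> {S, Si, Sj, Sij}" "Si \<in> {S, Si, Sj, Sij}" "Sj \<in> {S, Si, Sj, Sij}" "Sij \<in> {S, Si, Sj, Sij}"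
    by simp_all
  have cards: "odd (N + card Si)" "odd (N + card Sj)" "even (N + card Sij)"
    using even0 par by simp_all
  \<comment> \<open>Since \<open>F S\<close> is nonzero, \<open>F\<close> vanishes on sets of the
    other parity: these are the entries that join a row of one block to a column of the
    other.\<close>
  have zero: "F Si = 0" "F Sj = 0" "F (insert c (insert cc Si)) = 0" "F (insert c (insert cc Sj)) = 0"
    "F (insert c S) = 0" "F (insert c Sij) = 0" "F (insert cc S) = 0" "F (insert cc Sij) = 0"
    by (rule F0; simp add: mem[THEN ins(1)] mem[THEN ins(2)] mem[THEN ins(3)] mem[THEN ins(4)] mem[THEN ins(5)]
      mem[THEN ins(6)] mem[THEN ins(7)] cards even0 del: insert_subset card_insert_disjoint even_add odd_add)+
  have ccne: "c \<noteq> cc" by (simp add: cc_def)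
  have dif: "{c, cc} - {} = {c, cc}" "{c, cc} - {c} = {cc}" "{c, cc} - {cc} = {c}" "{c, cc} - {c, cc} = {}"
    using ccne by auto
  have \<phi>0: "\<phi> {c, cc, j} = 0" "\<phi> {c, cc, i} = 0" "\<phi> {cc, i, j} = 0" "\<phi> {cc} = 0" "\<phi> {c, i, j} = 0" "\<phi> {c} = 0"
    "\<phi> {j} = 0" "\<phi> {i} = 0"
    by (rule \<phi>_odd; use dist in simp)+
  have Tne: "{} \<noteq> {c}" "{} \<noteq> {cc}" "{} \<noteq> {c, cc}" "{c} \<noteq> {cc}" "{c} \<noteq> {c, cc}" "{cc} \<noteq> {c, cc}" using ccne by auto
  \<comment> \<open>The diagonal entries of the two block products; the off-diagonal ones
    cancel.\<close>
  have prods: "(f1 * f2 - f0 * f3) / \<Delta> = 1" "(ui * vj - uj * vi) / \<Delta> = 1"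
    using E \<Delta> by (auto simp: \<Delta>_def[symmetric]) (simp add: algebra_simps divide_eq_1_iff eq_diff_eq)
  have main: "(\<Sum>X\<in>Pow ?R. F (T \<union> X) * removal_signature H' (T' \<union> X)) = (if T = T' then 1 else 0)"
    if T: "T \<in> ?T" and T': "T' \<in> ?T" for T T'
    using T T' unfolding sum4[OF T']
    apply (elim insertE emptyE)
    apply (simp_all only: dif Un_insert_left Un_empty_left zero \<phi> \<phi>0 f0_def[symmetric] f1_def[symmetric] f2_def[symmetric]
       f3_def[symmetric] ui_def[symmetric] uj_def[symmetric] vi_def[symmetric] vj_def[symmetric] Tne Tne[symmetric] if_True if_False
       mult_zero_left mult_zero_right add_0_left add_0_right refl)
    using prods \<Delta> apply (simp_all add: field_simps)
    done
  show ?thesis using H' main by blast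
qed

theorem theorem5p5:
  fixes n t :: nat and H :: "'v matchgate" and G :: "complex vec"
  assumes "n \<ge> 1"
    and "generator H" and "arity H = 2 * n" and "G = std_signature H"
    and "full_rank 4 n G"
    and "1 \<le> t" and "t \<le> n" and "vec_space.rank 4 (gen_form 4 n t G) = 4"
  shows "\<exists>(H' :: nat matchgate) (R :: complex vec).
           recognizer H' \<and> arity H' = 2 * n \<and> R = std_signature H' \<and>
           gen_form 4 n t G * rec_form 4 n t R = 1\<^sub>m 4"
proof -
  define c where "c = 2 * t - 2"
  have cc: "Suc c = 2 * t - 1" "Suc c < 2 * n" using assms(6,7) by (auto simp: c_def)
  let ?R = "{..<2 * n} - {c, Suc c}"
  define F where "F = removal_signature H"
  have H: "is_matchgate H" using assms(2) by (simp add: generator_def)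
  have mgi: "satisfies_mgi (2 * n) F"
    using matchgate_identity[OF H] assms(3) by (simp add: satisfies_mgi_def F_def)
  have block: "block_set t 0 = {}" "block_set t 1 = {Suc c}" "block_set t 2 = {c}" "block_set t 3 = {c, Suc c}"
    using cc by (auto simp: block_set_def c_def)
  have block4: "block_set t a \<in> {{}, {c}, {Suc c}, {c, Suc c}}" for a
    using cc by (auto simp: block_set_def c_def)
  have bij: "bij_betw (rest_set n t) {..<4 ^ (n - 1)} (Pow ?R)"
    using bij_betw_rest_set[OF assms(6,7)] cc by (simp add: c_def)
  have G: "G $ insert_index 4 n t a b = F (block_set t a \<union> rest_set n t b)" if "a < 4" for a b
    using std_signature_insert_index[OF assms(3,6,7) that] by (simp add: assms(4) F_def)
  have in_R: "rest_set n t b \<subseteq> ?R" if "b < 4 ^ (n - 1)" for b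
    using bij_betw_apply[OF bij, of b] that by simp
  have four: "(\<Sum>a<4. z a * G $ insert_index 4 n t a b) = z 0 * F (rest_set n t b) + z 1 * F (insert (Suc c) (rest_set n t b))
      + z 2 * F (insert c (rest_set n t b)) + z 3 * F (insert c (insert (Suc c) (rest_set n t b)))" for z :: "nat \<Rightarrow> complex" and b
  proof -
    have "{..<4} = {0, 1, 2, 3 :: nat}" by auto
    then show ?thesis by (simp add: G block[unfolded One_nat_def] add.assoc)
  qed
  have row0: "\<exists>X\<subseteq>?R. F X \<noteq> 0"
  proof (rule ccontr)
    assume no: "\<not> ?thesis"
    \<comment> \<open>Selects row 0: if \<open>F\<close> vanished on all these sets, the matrix
      would have a zero row.\<close>
    define w where "w a = (if a = 0 then 1 else 0 :: complex)" for a :: nat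
    have "(\<Sum>a<4. w a * G $ insert_index 4 n t a b) = 0" if "b < 4 ^ (n - 1)" for b
    proof -
      have "F (rest_set n t b) = 0" using no in_R[OF that] by blast
      then show ?thesis unfolding four by (simp add: w_def)
    qed
    then have "w 0 = 0" by (rule gen_form_rows_independent[OF assms(8)]) simp_all
    then show False by (simp add: w_def)
  qed
  have rows12: "x = 0 \<and> y = 0"
    if z: "\<And>X. X \<subseteq> ?R \<Longrightarrow> x * F (insert c X) + y * F (insert (Suc c) X) = 0" for x y
  proof -
    \<comment> \<open>Digit 1 is the bit pair (0, 1), so the row of \<open>Suc c\<close> has index 1
      and the row of \<open>c\<close> has index 2.\<close>
    define w where "w a = (if a = 1 then y else if a = 2 then x else 0)" for a :: nat
    have "(\<Sum>a<4. w a * G $ insert_index 4 n t a b) = 0" if "b < 4 ^ (n - 1)" for b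
      unfolding four using z[OF in_R[OF that]] by (simp add: w_def add.commute)
    then have "w a = 0" if "a < 4" for a using gen_form_rows_independent[OF assms(8)] that by blast
    from this[of 1] this[of 2] show ?thesis by (simp add: w_def)
  qed
  have parity: "even (card (verts H) + card X)" if "X \<subseteq> {..<2 * n}" "F X \<noteq> 0" for X
    using removal_signature_parity[OF H] that assms(3) by (simp add: F_def)
  obtain H' :: "nat matchgate" where H': "recognizer H'" "arity H' = 2 * n"
    and inv: "\<And>T T'. T \<in> {{}, {c}, {Suc c}, {c, Suc c}} \<Longrightarrow> T' \<in> {{}, {c}, {Suc c}, {c, Suc c}} \<Longrightarrow>
      (\<Sum>X\<in>Pow ?R. F (T \<union> X) * removal_signature H' (T' \<union> X)) = (if T = T' then 1 else 0)"
    using mgi_recognizer_inverse[OF mgi cc(2) row0 rows12 parity] by blast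
  define R where "R = std_signature H'"
  have "gen_form 4 n t G * rec_form 4 n t R = 1\<^sub>m 4"
  proof (rule eq_matI)
    fix a a' assume "a < dim_row (1\<^sub>m 4 :: complex mat)" "a' < dim_col (1\<^sub>m 4 :: complex mat)"
    then have a: "a < 4" "a' < 4" by auto
    have "(gen_form 4 n t G * rec_form 4 n t R) $$ (a, a') =
        (\<Sum>b<4 ^ (n - 1). G $ insert_index 4 n t a b * R $ insert_index 4 n t a' b)"
      using a by (auto simp: gen_form_def rec_form_def scalar_prod_def lessThan_atLeast0 intro!: sum.cong)
    also have "\<dots> = (\<Sum>b<4 ^ (n - 1). F (block_set t a \<union> rest_set n t b) * removal_signature H' (block_set t a' \<union> rest_set n t b))"
      using std_signature_insert_index[OF H'(2) assms(6,7) a(2)] by (simp add: G[OF a(1)] R_def)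
    \<comment> \<open>A column number merely names a set of bits outside the block.\<close>
    also have "\<dots> = (\<Sum>X\<in>Pow ?R. F (block_set t a \<union> X) * removal_signature H' (block_set t a' \<union> X))"
      by (rule sum.reindex_bij_betw[OF bij])
    also have "\<dots> = (if block_set t a = block_set t a' then 1 else 0)"
      by (rule inv[OF block4 block4])
    also have "\<dots> = 1\<^sub>m 4 $$ (a, a')"
    proof -
      have "a \<in> {0, 1, 2, 3}" "a' \<in> {0, 1, 2, 3}" using a by auto
      then have "block_set t a = block_set t a' \<longleftrightarrow> a = a'" using block by auto
      then show ?thesis using a by simp
    qed
    finally show "(gen_form 4 n t G * rec_form 4 n t R) $$ (a, a') = 1\<^sub>m 4 $$ (a, a')" .
  qed (auto simp: gen_form_def rec_form_def)
  then show ?thesis using H' R_def by blast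
qed

end
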